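(* Let $T$ be a rooted ordered labeled tree with $n_T$ nodes and top DAG $\mathcal{TD}$. In the word RAM model with logarithmic word size, there is a representation of $T$ using $O(n_{\mathcal{TD}})$ words of space that supports each of the queries $\mathsf{Access}$, $\mathsf{Depth}$, $\mathsf{Height}$, $\mathsf{Size}$, $\mathsf{Parent}$, $\mathsf{Firstchild}$, $\mathsf{NextSibling}$, $\mathsf{LevelAncestor}$ and $\mathsf{NCA}$ in $O(\log n_T)$ time, and supports $\mathsf{Decompress}(x)$, returning the rooted subtree $T'=T(x)$, in $O(\log n_T + |T'|)$ time.
   Context: A labeled tree $T$ is a rooted, ordered tree each of whose nodes carries a label; $n_T$ is its number of nodes and $p(v)$ denotes the parent of $v$. For a graph $G$, $n_G$ is its total size (vertices plus edges). Nodes of $T$ are identified by their preorder numbers. For nodes $x,y$ (given by preorder numbers) and integer $i\ge 0$ the queries are: $\mathsf{Access}(x)$: the label of $x$; $\mathsf{Decompress}(x)$: the subtree $T(x)$; $\mathsf{Parent}(x)$: the parent of $x$; $\mathsf{Depth}(x)$: the depth of $x$; $\mathsf{Height}(x)$: the height of $x$; $\mathsf{Size}(x)$: the number of nodes of $T(x)$; $\mathsf{Firstchild}(x)$: the first child of $x$; $\mathsf{NextSibling}(x)$: the sibling immediately to the right of $x$; $\mathsf{LevelAncestor}(x,i)$: the ancestor of $x$ at distance $i$ from $x$; $\mathsf{NCA}(x,y)$: the nearest common ancestor of $x$ and $y$. Clusters. For a node $v$ with children $v_1,\dots,v_k$ (left to right), $T(v)$ is the subtree consisting of $v$ and its descendants,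 $F(v)$ the forest of proper descendants of $v$, and for $1\le s\le r\le k$, $T(v,v_s,v_r)$ is the tree pattern induced by $\{v\}\cup T(v_s)\cup\dots\cup T(v_r)$. A cluster with top boundary node $v$ is either a pattern $T(v,v_s,v_r)$ (no bottom boundary node) or a pattern $T(v,v_s,v_r)\setminus F(u)$ for a node $u$ of $T(v_s)\cup\dots\cup T(v_r)$ ($u$ is its bottom boundary node). A single edge $(v,p(v))$ is a cluster with top boundary $p(v)$, and with bottom boundary $v$ unless $v$ is a leaf of $T$. Two edge-disjoint clusters $A,B$ sharing one boundary node can be merged into $C=A\cup B$ (when $C$ is a cluster) in five ways: vertical merges, where the bottom boundary node of $A$ is the top boundary node of $B$ and $B$ contains all children of this node (allowed only if this node is a boundary node of no cluster other than $A,B$): type (a) if $B$ has a bottom boundary node, type (b) if not; horizontal merges, where $A,B$ have the same top boundary node, $A$ left of $B$, and at least one of them has no bottom boundary node: type (c) if only $A$ has a bottom boundary node, (d) if only $B$ has one, (e) if neither has one. $A$ is always the cluster first visited in a preorder traversal of $T$. Top tree. A top tree of $T$ is an ordered rooted binary labeled tree whose nodes correspond to clusters: the root to $T$, the leaves to the edges of $T$ (labeled by the pair (label of parent endpoint, label of child endpoint)), and each internal node to the merge of its left child's cluster $A$ and right child's cluster $B$, labeled by the merge type (a)–(e). Greedy construction. Maintain an auxiliary rooted ordered tree $\tilde T$, initially $T$, whose edges correspond to the current roots of the partial top tree (initially the edges of $T$). Merging edges $(u,v),(v,w)$ of $\tilde T$ creates a new top tree node whose children are the two corresponding clusters; if $v$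 is the parent of $u$ and the only child of $w$ (vertical merge) the two edges are replaced by $(u,w)$; if $v$ is the parent of both $u,w$ and one of $u,w$ is a leaf (horizontal merge) they are replaced by a single edge from $v$ to one of $u,w$ (the non-leaf one, if any). While $\tilde T$ has more than one edge, do an iteration: Step 1 (horizontal): for each node $v$ of $\tilde T$ with children $v_1,\dots,v_k$, $k\ge 2$, for $i=1,\dots,\lfloor k/2\rfloor$ merge $(v,v_{2i-1}),(v,v_{2i})$ if $v_{2i-1}$ or $v_{2i}$ is a leaf; if $k$ is odd, $v_k$ is a leaf and $v_{k-2},v_{k-1}$ are non-leaves, also merge $(v,v_{k-1}),(v,v_k)$. Step 2 (vertical): for each maximal path $v_1,\dots,v_p$ with $v_{i+1}$ the parent of $v_i$ and $v_2,\dots,v_{p-1}$ each having exactly one child, with $e_i=(v_i,v_{i+1})$: if $p$ is even merge $\{e_1,e_2\},\{e_3,e_4\},\dots,\{e_{p-3},e_{p-2}\}$; if $p$ is odd merge $\{e_1,e_2\},\dots,\{e_{p-4},e_{p-3}\}$ and also $\{e_{p-2},e_{p-1}\}$ if $e_{p-1}$ was not merged in Step 1. Top DAG. The top DAG $\mathcal{TD}$ of $T$ is the minimal DAG representation of this top tree $\mathcal T$, in which identical rooted subtrees of $\mathcal T$ are represented once. *)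

theory Defs
  imports Complex_Main "HOL-Library.Sublist" "HOL-Library.While_Combinator"
begin

section \<open>Labeled trees and the queries\<close>

datatype 'a tree = Node (label: 'a) (children: "'a tree list")

fun num_nodes :: "'a tree \<Rightarrow> nat" where
  "num_nodes (Node a ts) = Suc (sum_list (map num_nodes ts))"

text \<open>The number of edges on a longest path down to a leaf.\<close>

fun height :: "'a tree \<Rightarrow> nat" where
  "height (Node a ts) = (if ts = [] then 0 else Suc (Max (height ` set ts)))"

text \<open>A node is addressed by the list of child indices on the path leading to it from the root.
  The node with preorder number \<open>x\<close> (counted from 0, so that the root is 0) is the entry
  \<open>x\<close> of the following list.\<close>

fun preorder :: "'a tree \<Rightarrow> nat list list" where
  "preorder (Node a ts) =
     [] # concat (map2 (\<lambda>i ps. map ((#) i) ps) [0..<length ts] (map preorder ts))"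

definition path_of :: "'a tree \<Rightarrow> nat \<Rightarrow> nat list" where
  "path_of T x = preorder T ! x"

definition number_of :: "'a tree \<Rightarrow> nat list \<Rightarrow> nat option" where
  "number_of T p =
     (if p \<in> set (preorder T) then Some (THE x. x < num_nodes T \<and> path_of T x = p) else None)"

fun subtree_at :: "'a tree \<Rightarrow> nat list \<Rightarrow> 'a tree" where
  "subtree_at T [] = T"
| "subtree_at T (i # p) = subtree_at (children T ! i) p"

text \<open>The queries below are meant for \<open>x, y < num_nodes T\<close>. A query whose answer is a node
  gives \<^const>\<open>None\<close> if there is no such node.\<close>

definition q_decompress :: "'a tree \<Rightarrow> nat \<Rightarrow> 'a tree" where
  "q_decompress T x = subtree_at T (path_of T x)"

definition q_access :: "'a tree \<Rightarrow> nat \<Rightarrow> 'a" where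
  "q_access T x = label (q_decompress T x)"

definition q_depth :: "'a tree \<Rightarrow> nat \<Rightarrow> nat" where
  "q_depth T x = length (path_of T x)"

definition q_height :: "'a tree \<Rightarrow> nat \<Rightarrow> nat" where
  "q_height T x = height (q_decompress T x)"

definition q_size :: "'a tree \<Rightarrow> nat \<Rightarrow> nat" where
  "q_size T x = num_nodes (q_decompress T x)"

definition q_parent :: "'a tree \<Rightarrow> nat \<Rightarrow> nat option" where
  "q_parent T x =
     (let p = path_of T x in if p = [] then None else number_of T (butlast p))"

definition q_first_child :: "'a tree \<Rightarrow> nat \<Rightarrow> nat option" where
  "q_first_child T x = number_of T (path_of T x @ [0])"

definition q_next_sibling :: "'a tree \<Rightarrow> nat \<Rightarrow> nat option" where
  "q_next_sibling T x =
     (let p = path_of T x in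
      if p = [] then None else number_of T (butlast p @ [Suc (last p)]))"

definition q_level_ancestor :: "'a tree \<Rightarrow> nat \<Rightarrow> nat \<Rightarrow> nat option" where
  "q_level_ancestor T x i =
     (let p = path_of T x in
      if i \<le> length p then number_of T (take (length p - i) p) else None)"

definition q_nca :: "'a tree \<Rightarrow> nat \<Rightarrow> nat \<Rightarrow> nat option" where
  "q_nca T x y = number_of T (longest_common_prefix (path_of T x) (path_of T y))"


section \<open>Top trees and the greedy construction\<close>

text \<open>\<open>VBottom\<close>, \<open>VNoBottom\<close> are the vertical merges of types (a) and (b);
  \<open>HLeft\<close>, \<open>HRight\<close>, \<open>HNone\<close> are the horizontal merges of types (c), (d) and (e).\<close>

datatype merge_type = VBottom | VNoBottom | HLeft | HRight | HNone

datatype 'a top_tree =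
    TEdge 'a 'a
  | TMerge merge_type "'a top_tree" "'a top_tree"

text \<open>The auxiliary tree is given by the ordered list of the edges leaving its root. The term
  \<open>Edge c m es\<close> is an edge together with the list \<open>es\<close> of the edges leaving its lower
  endpoint; \<open>c\<close> is the current root of the partial top tree for this edge, and \<open>m\<close>
  records whether the edge was produced by a merge in Step 1 of the current iteration.

  The cluster of an edge has a bottom boundary node iff the lower endpoint of the edge is not a
  leaf of the auxiliary tree. This holds initially and is preserved by all merges, and it
  determines the merge types.\<close>

datatype 'a edge = Edge "'a top_tree" bool "'a edge list"

fun initial_edges :: "'a tree \<Rightarrow> 'a edge list" where
  "initial_edges (Node a ts) =
     map (\<lambda>t. Edge (TEdge a (label t)) False (initial_edges t)) ts"

fun edge_count :: "'a edge \<Rightarrow> nat" where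
  "edge_count (Edge c m es) = Suc (sum_list (map edge_count es))"

fun to_leaf :: "'a edge \<Rightarrow> bool" where
  "to_leaf (Edge c m es) \<longleftrightarrow> es = []"

text \<open>Step 1.\<close>

fun hmerge :: "'a edge \<Rightarrow> 'a edge \<Rightarrow> 'a edge" where
  "hmerge (Edge A m es) (Edge B m' es') =
     (if es = [] \<and> es' = [] then Edge (TMerge HNone A B) True []
      else if es' = [] then Edge (TMerge HLeft A B) True es
      else Edge (TMerge HRight A B) True es')"

text \<open>The argument lists the edges from a node to all of its children. The first equation treats
  the last three children if their number is odd and at least 3.\<close>

fun hmerge_children :: "'a edge list \<Rightarrow> 'a edge list" where
  "hmerge_children [e, f, g] =
     (if to_leaf e \<or> to_leaf f then [hmerge e f, g]
      else if to_leaf g then [e, hmerge f g]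
      else [e, f, g])"
| "hmerge_children (e # f # es) =
     (if to_leaf e \<or> to_leaf f then hmerge e f # hmerge_children es
      else e # f # hmerge_children es)"
| "hmerge_children es = es"

fun step1_edge :: "'a edge \<Rightarrow> 'a edge" where
  "step1_edge (Edge c m es) = Edge c False (hmerge_children (map step1_edge es))"

definition step1 :: "'a edge list \<Rightarrow> 'a edge list" where
  "step1 es = hmerge_children (map step1_edge es)"

text \<open>Step 2. The edges \<open>e\<^sub>1, \<dots>, e\<^sub>p\<^sub>-\<^sub>1\<close> of a maximal path are listed from bottom to top.
  The flag \<open>leaf\<close> tells whether the lower endpoint of the first edge of the list is a leaf.
  If the number \<open>p - 1\<close> of edges is odd, the top edge remains; if it is even, the topmost pair is
  merged only if the top edge was not merged in Step 1.\<close>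

fun vmerge_path :: "bool \<Rightarrow> ('a top_tree \<times> bool) list \<Rightarrow> ('a top_tree \<times> bool) list" where
  "vmerge_path leaf ((B, m) # (A, m') # es) =
     (if es = [] \<and> m' then [(B, m), (A, m')]
      else (TMerge (if leaf then VNoBottom else VBottom) A B, False) # vmerge_path False es)"
| "vmerge_path leaf es = es"

text \<open>The arguments are a nonempty path, listed from bottom to top, and the edges leaving its lowest
  node.\<close>

fun attach_path :: "('a top_tree \<times> bool) list \<Rightarrow> 'a edge list \<Rightarrow> 'a edge" where
  "attach_path [(c, m)] es = Edge c m es"
| "attach_path ((c, m) # ps) es = attach_path ps [Edge c m es]"

definition vmerge :: "('a top_tree \<times> bool) list \<times> 'a edge list \<Rightarrow> 'a edge" where
  "vmerge = (\<lambda>(ps, es). attach_path (vmerge_path (es = []) ps) es)"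

text \<open>For an edge leaving the root or a node with at least two children, \<open>max_path\<close> gives the
  maximal path that starts downwards with this edge, listed from bottom to top, and the edges leaving
  its lowest node, below which all maximal paths have already been treated.\<close>

fun max_path :: "'a edge \<Rightarrow> ('a top_tree \<times> bool) list \<times> 'a edge list" where
  "max_path (Edge c m [e]) = (case max_path e of (ps, es) \<Rightarrow> (ps @ [(c, m)], es))"
| "max_path (Edge c m es) = ([(c, m)], map (\<lambda>e. vmerge (max_path e)) es)"

definition step2 :: "'a edge list \<Rightarrow> 'a edge list" where
  "step2 es = map (\<lambda>e. vmerge (max_path e)) es"

text \<open>This is meaningful only for trees with at least one edge.\<close>

definition top_tree :: "'a tree \<Rightarrow> 'a top_tree" where
  "top_tree T =
     (case while (\<lambda>es. sum_list (map edge_count es) > 1) (\<lambda>es. step2 (step1 es))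
             (initial_edges T)
      of Edge c m es # _ \<Rightarrow> c)"


section \<open>Top DAGs\<close>

fun rooted_subtrees :: "'a top_tree \<Rightarrow> 'a top_tree set" where
  "rooted_subtrees (TEdge a b) = {TEdge a b}"
| "rooted_subtrees (TMerge k l r) =
     insert (TMerge k l r) (rooted_subtrees l \<union> rooted_subtrees r)"

definition top_dag_vertices :: "'a tree \<Rightarrow> 'a top_tree set" where
  "top_dag_vertices T = rooted_subtrees (top_tree T)"

text \<open>The Boolean component distinguishes the edges to the left (\<^const>\<open>False\<close>) and the right child,
  which may be parallel.\<close>

definition top_dag_edges :: "'a tree \<Rightarrow> ('a top_tree \<times> bool \<times> 'a top_tree) set" where
  "top_dag_edges T =
     {(TMerge k l r, False, l) | k l r. TMerge k l r \<in> top_dag_vertices T} \<union>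
     {(TMerge k l r, True, r) | k l r. TMerge k l r \<in> top_dag_vertices T}"

definition top_dag_size :: "'a tree \<Rightarrow> nat" where
  "top_dag_size T = card (top_dag_vertices T) + card (top_dag_edges T)"


section \<open>The word RAM\<close>

text \<open>Words of \<open>w\<close> bits are the natural numbers below \<open>2 ^ w\<close>; all operations are taken
  modulo \<open>2 ^ w\<close>.\<close>

datatype binop =
  Add | Sub | Mul | Div | Mod | BitAnd | BitOr | BitXor | ShiftL | ShiftR | Less | Equal

fun eval_binop :: "nat \<Rightarrow> binop \<Rightarrow> nat \<Rightarrow> nat \<Rightarrow> nat" where
  "eval_binop w Add x y = (x + y) mod 2 ^ w"
| "eval_binop w Sub x y = (x + 2 ^ w - y) mod 2 ^ w"
| "eval_binop w Mul x y = (x * y) mod 2 ^ w"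
| "eval_binop w Div x y = x div y"
| "eval_binop w Mod x y = x mod y"
| "eval_binop w BitAnd x y = Bit_Operations.and x y"
| "eval_binop w BitOr x y = Bit_Operations.or x y"
| "eval_binop w BitXor x y = Bit_Operations.xor x y"
| "eval_binop w ShiftL x y = push_bit y x mod 2 ^ w"
| "eval_binop w ShiftR x y = drop_bit y x"
| "eval_binop w Less x y = of_bool (x < y) mod 2 ^ w"
| "eval_binop w Equal x y = of_bool (x = y) mod 2 ^ w"

text \<open>Registers are numbered; a program mentions only finitely many of them. \<open>Load r a\<close> reads
  the memory word at the address in register \<open>a\<close> into \<open>r\<close>; \<open>Store a r\<close> writes
  register \<open>r\<close> to that address; \<open>JumpZero r l\<close> continues at instruction \<open>l\<close> if
  register \<open>r\<close> is 0; \<open>Output r\<close> appends a word to the answer. Every instruction takes one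
  unit of time, and the machine halts when the program counter leaves the program.\<close>

datatype instr =
    Const nat nat
  | Op binop nat nat nat
  | Load nat nat
  | Store nat nat
  | Jump nat
  | JumpZero nat nat
  | Output nat

type_synonym program = "instr list"

record config =
  pc :: nat
  regs :: "nat \<Rightarrow> nat"
  mem :: "nat \<Rightarrow> nat"
  outp :: "nat list"

fun exec :: "nat \<Rightarrow> instr \<Rightarrow> config \<Rightarrow> config" where
  "exec w (Const r k) s =
     s\<lparr>pc := Suc (pc s), regs := (regs s)(r := k mod 2 ^ w)\<rparr>"
| "exec w (Op f r a b) s =
     s\<lparr>pc := Suc (pc s), regs := (regs s)(r := eval_binop w f (regs s a) (regs s b))\<rparr>"
| "exec w (Load r a) s =
     s\<lparr>pc := Suc (pc s), regs := (regs s)(r := mem s (regs s a))\<rparr>"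
| "exec w (Store a r) s =
     s\<lparr>pc := Suc (pc s), mem := (mem s)(regs s a := regs s r)\<rparr>"
| "exec w (Jump l) s = s\<lparr>pc := l\<rparr>"
| "exec w (JumpZero r l) s = s\<lparr>pc := (if regs s r = 0 then l else Suc (pc s))\<rparr>"
| "exec w (Output r) s = s\<lparr>pc := Suc (pc s), outp := outp s @ [regs s r]\<rparr>"

definition halted :: "program \<Rightarrow> config \<Rightarrow> bool" where
  "halted P s \<longleftrightarrow> length P \<le> pc s"

definition step :: "nat \<Rightarrow> program \<Rightarrow> config \<Rightarrow> config" where
  "step w P s = (if halted P s then s else exec w (P ! pc s) s)"

text \<open>The arguments are passed in the registers \<open>0, 1, \<dots>\<close>.\<close>

definition start :: "nat list \<Rightarrow> (nat \<Rightarrow> nat) \<Rightarrow> config" where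
  "start args m =
     \<lparr>pc = 0, regs = (\<lambda>r. if r < length args then args ! r else 0), mem = m, outp = []\<rparr>"

text \<open>With the representation \<open>D\<close> in the memory words \<open>0, \<dots>, length D - 1\<close>, the program
  \<open>P\<close> answers the query with arguments \<open>args\<close> by \<open>ans\<close> in time at most \<open>\<tau>\<close>.
  The remaining memory, which serves as working space, has arbitrary contents at the start, and
  \<open>D\<close> is intact at the end, so queries can be answered one after the other.\<close>

definition answers ::
  "nat \<Rightarrow> nat list \<Rightarrow> program \<Rightarrow> nat list \<Rightarrow> real \<Rightarrow> nat list \<Rightarrow> bool" where
  "answers w D P args \<tau> ans \<longleftrightarrow>
     (\<forall>m. (\<forall>a. m a < 2 ^ w) \<and> (\<forall>a < length D. m a = D ! a) \<longrightarrow>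
        (\<exists>t. real t \<le> \<tau> \<and>
           (let s = (step w P ^^ t) (start args m) in
              halted P s \<and> outp s = ans \<and> (\<forall>a < length D. mem s a = D ! a))))"

fun node_words :: "nat option \<Rightarrow> nat list" where
  "node_words None = []"
| "node_words (Some x) = [x]"

text \<open>A tree is output as a sequence of words in balanced parentheses form: 1 followed by the label
  opens a node and 0 closes it.\<close>

fun tree_words :: "nat tree \<Rightarrow> nat list" where
  "tree_words (Node a ts) = [1, a] @ concat (map tree_words ts) @ [0]"

datatype query =
    Access | Depth | Height | Size | Parent | Firstchild | NextSibling | LevelAncestor | NCA
  | Decompress

end

theory Submission
  imports Defs
begin

text \<open>A cluster stands for a forest with a hole: the trees below its top boundary node, where the hole
  is the list of children of its bottom boundary node. Vertical merges compose such contexts and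
  horizontal merges concatenate them, so the top tree is an expression for \<open>T\<close> whose value is
  preserved by every iteration of the greedy construction. An iteration leaves at most \<open>5/6\<close> of the
  edges of the auxiliary tree, since unmerged edges to leaves can be charged to merges; hence the top tree has height \<open>O(log n)\<close>.

  A query descends from the root of the top DAG to the edge above the wanted node. Besides the
  number of the first node of the current cluster it maintains size and height of what lies below the
  bottom boundary node, depth and number of the top boundary node, and the list of the clusters that
  fill the hole. For level ancestors and nearest common ancestors, a searched node that lies below the
  bottom boundary node of the cluster to be entered is replaced by this boundary node. The subtree
  of a node \<open>x\<close> consists of \<open>x\<close> and the list of clusters that fill its hole, and is written by a
  traversal of these clusters in time linear in their size.\<close>

section \<open>Semantics and height of the top tree\<close>

text \<open>The obstacle is sharing: a vertex of the top DAG stands for many occurrences of a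
  cluster in \<open>T\<close>, so it can store only data relative to the cluster, and no preorder
  number, depth or parent. All absolute data has to be recomputed on the way down. It depends on
  what fills the hole: nodes visited after the hole are shifted by the size of its contents, and
  their height enters as well. Hence the search state carries these two numbers along with the list
  itself. The constants: an iteration multiplies the number of edges by at most 5/6, (6/5)^4 > 2,
  and an iteration adds at most two levels, which gives height at most 8 log n. Running time and
  absence of overflow are part of the claim. Therefore the programs are written in a small
  structured language whose weakest preconditions count only loop iterations and demand that no
  operation wraps around. Correctness of the search itself is proved for a functional version,
  \<open>locate\<close>, which works with ancestor lists instead of machine words; the programs are
  then shown to imitate it.\<close>

fun vertical :: "merge_type \<Rightarrow> bool" where
  "vertical VBottom = True" | "vertical VNoBottom = True" | "vertical _ = False"

text \<open>The value of a cluster when the trees \<open>h\<close> hang below its bottom boundary node. Clusters without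
  bottom boundary node occur only with \<open>h = []\<close>, so that \<^const>\<open>VNoBottom\<close> can be treated like
  \<^const>\<open>VBottom\<close> and \<^const>\<open>HNone\<close> like \<^const>\<open>HLeft\<close>. An edge may be used in both ways.\<close>

fun sem :: "'a top_tree \<Rightarrow> 'a tree list \<Rightarrow> 'a tree list" where
  "sem (TEdge a b) h = [Node b h]"
| "sem (TMerge k A B) h =
     (if vertical k then sem A (sem B h)
      else if k = HRight then sem A [] @ sem B h
      else sem A h @ sem B [])"

fun top_height :: "'a top_tree \<Rightarrow> nat" where
  "top_height (TEdge a b) = 0"
| "top_height (TMerge k A B) = Suc (max (top_height A) (top_height B))"

fun edge_sem :: "'a edge \<Rightarrow> 'a tree list" where
  "edge_sem (Edge c m es) = sem c (concat (map edge_sem es))"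

abbreviation edges_sem :: "'a edge list \<Rightarrow> 'a tree list" where
  "edges_sem es \<equiv> concat (map edge_sem es)"

text \<open>Paths are listed from bottom to top, so folding from the left fills each hole with the
  value of the part of the path below it.\<close>

definition path_sem :: "('a top_tree \<times> bool) list \<Rightarrow> 'a tree list \<Rightarrow> 'a tree list" where
  "path_sem ps h = foldl (\<lambda>h (c, m). sem c h) h ps"

section \<open>The value of the auxiliary tree under the two steps\<close>

lemma edges_sem_initial: "edges_sem (initial_edges T) = children T"
  by (induction T rule: initial_edges.induct) (auto simp: comp_def intro: nth_equalityI)

text \<open>An edge to a leaf has nothing in its hole, so there is at most one child list to pass
  on, and the merge type decides which of the two holes receives it.\<close>

lemma edge_sem_hmerge:
  "to_leaf e \<or> to_leaf f \<Longrightarrow> edge_sem (hmerge e f) = edge_sem e @ edge_sem f"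
  by (cases e; cases f) auto

lemma edges_sem_hmerge_children: "edges_sem (hmerge_children es) = edges_sem es"
  by (induction es rule: hmerge_children.induct) (auto simp: edge_sem_hmerge)

lemma edge_sem_step1: "edge_sem (step1_edge e) = edge_sem e"
proof (induction e rule: step1_edge.induct)
  case (1 c m es)
  then have "edges_sem (map step1_edge es) = edges_sem es" by (simp add: comp_def cong: map_cong)
  then show ?case by (simp only: step1_edge.simps edge_sem.simps edges_sem_hmerge_children)
qed

lemma edges_sem_step1: "edges_sem (step1 es) = edges_sem es"
  by (simp add: step1_def edges_sem_hmerge_children edge_sem_step1 comp_def)

lemma path_sem_vmerge_path: "path_sem (vmerge_path b ps) h = path_sem ps h"
  by (induction b ps arbitrary: h rule: vmerge_path.induct) (auto simp: path_sem_def)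

lemma vmerge_path_Nil [simp]: "vmerge_path b ps = [] \<longleftrightarrow> ps = []"
  by (induction b ps rule: vmerge_path.induct) auto

lemma edge_sem_attach_path:
  "ps \<noteq> [] \<Longrightarrow> edge_sem (attach_path ps es) = path_sem ps (edges_sem es)"
  by (induction ps es rule: attach_path.induct) (auto simp: path_sem_def)

lemma fst_max_path_nonempty: "fst (max_path e) \<noteq> []"
  by (induction e rule: max_path.induct) (auto split: prod.splits)

text \<open>The second claim is the one proved by induction; \<open>vm\<close> turns it into the
  first one for the edges leaving a branching node, to which \<open>max_path\<close> has already
  applied \<open>vmerge\<close>.\<close>

lemma edge_sem_vmerge_max_path:
  "edge_sem (vmerge (max_path e)) = edge_sem e \<and>
   path_sem (fst (max_path e)) (edges_sem (snd (max_path e))) = edge_sem e"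
proof -
  have vm: "edge_sem (vmerge (max_path f)) =
      path_sem (fst (max_path f)) (edges_sem (snd (max_path f)))" for f :: "'a edge"
    using fst_max_path_nonempty[of f]
    by (cases "max_path f") (simp add: vmerge_def edge_sem_attach_path path_sem_vmerge_path)
  have "path_sem (fst (max_path e)) (edges_sem (snd (max_path e))) = edge_sem e"
  proof (induction e rule: max_path.induct)
    case (1 c m e)
    then show ?case by (cases "max_path e") (simp add: path_sem_def)
  next
    case ("2_1" c m)
    then show ?case by (simp add: path_sem_def)
  next
    case ("2_2" c m e1 e2 es)
    then show ?case by (simp add: vm path_sem_def comp_def cong: map_cong)
  qed
  then show ?thesis by (simp add: vm)
qed

lemma edges_sem_step2: "edges_sem (step2 es) = edges_sem es"
  by (simp add: step2_def edge_sem_vmerge_max_path comp_def)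

section \<open>Amortized count of the edges in one iteration\<close>

abbreviation edges_count :: "'a edge list \<Rightarrow> nat" where
  "edges_count es \<equiv> sum_list (map edge_count es)"

fun merged :: "'a edge \<Rightarrow> bool" where
  "merged (Edge c m es) = m"

fun merged_count :: "'a edge \<Rightarrow> nat" where
  "merged_count (Edge c m es) = of_bool m + sum_list (map merged_count es)"

abbreviation "merged_counts es \<equiv> sum_list (map merged_count es)"

abbreviation unmerged_leaf :: "'a edge \<Rightarrow> bool" where
  "unmerged_leaf e \<equiv> to_leaf e \<and> \<not> merged e"

text \<open>The charging scheme for one list of siblings after Step 1. An unmerged edge to a leaf
  can remain only at the end of an odd list, next to a merged pair; an only child is the
  exception.\<close>

definition balanced :: "'a edge list \<Rightarrow> bool" where
  "balanced es \<longleftrightarrow> length es \<le> 1 \<or> length (filter unmerged_leaf es) \<le> length (filter merged es)"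

fun hereditarily_balanced :: "'a edge \<Rightarrow> bool" where
  "hereditarily_balanced (Edge c m es) \<longleftrightarrow> balanced es \<and> (\<forall>e\<in>set es. hereditarily_balanced e)"

text \<open>A horizontal merge removes one edge and sets one flag. The flags have to be clear at the
  start because \<open>hmerge\<close> discards those of its arguments.\<close>

lemma edges_count_hmerge_children:
  "\<forall>e\<in>set es. \<not> merged e \<Longrightarrow>
   edges_count (hmerge_children es) + merged_counts (hmerge_children es) =
   edges_count es + merged_counts es"
proof (induction es rule: hmerge_children.induct)
  case (1 e f g)
  then show ?case by (cases e; cases f; cases g) auto
next
  case ("2_1" e f)
  then show ?case by (cases e; cases f) auto
next
  case ("2_2" e f g h es)
  then show ?case by (cases e; cases f) auto
qed auto

lemma unmerged_leaves_hmerge_children: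
  "\<forall>e\<in>set es. \<not> merged e \<Longrightarrow> length es \<noteq> 1 \<Longrightarrow>
   length (filter unmerged_leaf (hmerge_children es)) \<le> length (filter merged (hmerge_children es))"
proof (induction es rule: hmerge_children.induct)
  case (1 e f g)
  then show ?case by (cases e; cases f; cases g) auto
next
  case ("2_1" e f)
  then show ?case by (cases e; cases f) auto
next
  case ("2_2" e f g h es)
  then show ?case by (cases e; cases f) auto
qed auto

lemma balanced_hmerge_children: "\<forall>e\<in>set es. \<not> merged e \<Longrightarrow> balanced (hmerge_children es)"
  using unmerged_leaves_hmerge_children[of es]
  by (cases "length es = 1") (auto simp: balanced_def length_Suc_conv)

text \<open>A merged edge takes over the child list of one operand or gets an empty one, so no new
  list arises below the siblings.\<close>

lemma hereditarily_balanced_hmerge_children: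
  "\<forall>e\<in>set es. hereditarily_balanced e \<Longrightarrow> \<forall>e\<in>set (hmerge_children es). hereditarily_balanced e"
proof (induction es rule: hmerge_children.induct)
  case (1 e f g)
  then show ?case by (cases e; cases f; cases g) (auto simp: balanced_def)
next
  case ("2_1" e f)
  then show ?case by (cases e; cases f) (auto simp: balanced_def)
next
  case ("2_2" e f g h es)
  then show ?case by (cases e; cases f) (auto simp: balanced_def)
qed auto

lemma not_merged_step1_edge: "\<not> merged (step1_edge e)"
  by (cases e) auto

lemma step1_edge_invariant:
  "edge_count (step1_edge e) + merged_count (step1_edge e) = edge_count e \<and>
   hereditarily_balanced (step1_edge e)"
proof (induction e rule: step1_edge.induct)
  case (1 c m es)
  then have "edges_count (map step1_edge es) + merged_counts (map step1_edge es) = edges_count es"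
    by (simp add: comp_def cong: map_cong flip: sum_list_addf)
  moreover have nm: "\<forall>e\<in>set (map step1_edge es). \<not> merged e"
    by (auto simp: not_merged_step1_edge)
  ultimately show ?case
    using edges_count_hmerge_children[OF nm] balanced_hmerge_children[OF nm]
      hereditarily_balanced_hmerge_children[of "map step1_edge es"] 1
    by auto
qed

lemma step1_invariant:
  "edges_count (step1 es) + merged_counts (step1 es) = edges_count es"
  "balanced (step1 es)" "\<forall>e\<in>set (step1 es). hereditarily_balanced e"
proof -
  have nm: "\<forall>e\<in>set (map step1_edge es). \<not> merged e"
    by (auto simp: not_merged_step1_edge)
  have "edges_count (map step1_edge es) + merged_counts (map step1_edge es) = edges_count es"
    by (simp add: comp_def step1_edge_invariant[THEN conjunct1] flip: sum_list_addf)
  then show "edges_count (step1 es) + merged_counts (step1 es) = edges_count es"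
    using edges_count_hmerge_children[OF nm] by (simp add: step1_def)
  show "balanced (step1 es)" "\<forall>e\<in>set (step1 es). hereditarily_balanced e"
    using balanced_hmerge_children[OF nm] hereditarily_balanced_hmerge_children[of "map step1_edge es"]
      step1_edge_invariant by (auto simp: step1_def)
qed

text \<open>Pairing halves the path, rounding up. One more edge survives if the number of edges is
  even and the top edge carries the flag, since the topmost pair is then kept.\<close>

lemma length_vmerge_path:
  "ps \<noteq> [] \<Longrightarrow> 2 * length (vmerge_path b ps) \<le> length ps + 1 + of_bool (snd (last ps))"
  by (induction b ps rule: vmerge_path.induct) (auto split: if_splits)

lemma vmerge_path_shrinks:
  "2 \<le> length ps \<Longrightarrow> \<not> snd (last ps) \<Longrightarrow> length (vmerge_path b ps) < length ps"
  using length_vmerge_path[of ps b] by (cases "ps = []") auto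

lemma edge_count_attach_path:
  "ps \<noteq> [] \<Longrightarrow> edge_count (attach_path ps es) = length ps + edges_count es"
  by (induction ps es rule: attach_path.induct) auto

definition path_flags :: "('a top_tree \<times> bool) list \<Rightarrow> nat" where
  "path_flags ps = length (filter snd ps)"

text \<open>The amortized bound for one iteration, where \<open>e\<close> is the top edge of a maximal path after Step 1. The
  surplus 2 of an edge merged in Step 1 pays for an unmerged edge to a leaf among its siblings; after
  Step 1 there are at most as many of the latter as of the former, unless the edge has no siblings.\<close>

definition path_bound :: "'a edge \<Rightarrow> bool" where
  "path_bound e \<longleftrightarrow> 4 * edge_count (vmerge (max_path e)) + 1 + 2 * of_bool (merged e) \<le>
     3 * edge_count e + 5 * merged_count e + 2 * of_bool (unmerged_leaf e)"

lemma snd_last_max_path: "snd (last (fst (max_path e))) = merged e"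
  by (induction e rule: max_path.induct) (auto split: prod.splits)

lemma edge_count_vmerge:
  "ps \<noteq> [] \<Longrightarrow> edge_count (vmerge (ps, es)) = length (vmerge_path (es = []) ps) + edges_count es"
  by (simp add: vmerge_def edge_count_attach_path)

lemma sum_list_path_bound:
  assumes "\<forall>e\<in>set es. path_bound e"
  shows "4 * edges_count (step2 es) + length es + 2 * length (filter merged es) \<le>
    3 * edges_count es + 5 * merged_counts es + 2 * length (filter unmerged_leaf es)"
  using assms by (induction es) (auto simp: path_bound_def step2_def split: if_splits)

text \<open>In the second alternative the path ends at a branching node. The slack 2 comes from the
  at least two paths that start there, each of which contributes 1 through
  \<open>path_bound\<close>; an edge of the path adds 3, and 5 more if flagged, to both
  sides.\<close>

definition path_invariant :: "'a edge \<Rightarrow> bool" where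
  "path_invariant e \<longleftrightarrow> (case max_path e of (ps, es) \<Rightarrow>
     (es = [] \<and> edge_count e = length ps \<and> merged_count e = path_flags ps \<and> (to_leaf e \<longleftrightarrow> length ps = 1)) \<or>
     (\<not> to_leaf e \<and> 4 * edges_count es + 2 + 3 * length ps + 5 * path_flags ps \<le>
        3 * edge_count e + 5 * merged_count e))"

text \<open>The claims depend on each other: \<open>key\<close> derives the second from the first,
  and the first at a branching node uses the second for all children.\<close>

lemma max_path_bound:
  assumes "hereditarily_balanced e"
  shows "path_invariant e"
    and "path_bound e"
proof -
  \<comment> \<open>Tight for a path of a single unflagged edge: 4 + 1 is paid by 3 and, if the edge
    leads to a leaf, the 2 for an unmerged leaf, otherwise the slack 2 of the invariant.\<close>
  have key: "path_bound e" if e: "path_invariant e" for e :: "'a edge"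
  proof -
    obtain ps es where mp: "max_path e = (ps, es)" by (cases "max_path e")
    have ne: "ps \<noteq> []" and lst: "snd (last ps) = merged e"
      using fst_max_path_nonempty[of e] snd_last_max_path[of e] by (auto simp: mp)
    have len: "1 \<le> length ps" using ne by (cases ps) auto
    have flag: "merged e \<Longrightarrow> 1 \<le> path_flags ps"
      using lst ne last_in_set[OF ne] unfolding path_flags_def
      by (metis (mono_tags, lifting) One_nat_def Suc_leI filter_empty_conv length_greater_0_conv)
    have "length (vmerge_path (es = []) ps) < length ps" if "length ps \<noteq> 1" "\<not> merged e"
      using vmerge_path_shrinks[of ps "es = []"] that len lst by linarith
    moreover have "2 * length (vmerge_path (es = []) ps) \<le> length ps + 1 + of_bool (merged e)"
      using length_vmerge_path[OF ne] lst by simp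
    ultimately show ?thesis
      using e len flag unfolding path_invariant_def path_bound_def mp edge_count_vmerge[OF ne] prod.case
      by (elim disjE conjE; cases "merged e"; cases "length ps = 1"; clarsimp; presburger)
  qed
  show *: "path_invariant e"
    using assms
  proof (induction e rule: max_path.induct)
    case (1 c m e)
    then show ?case
      using fst_max_path_nonempty[of e] by (cases "max_path e") (auto simp: path_invariant_def path_flags_def)
  next
    case ("2_1" c m)
    then show ?case by (simp add: path_invariant_def path_flags_def)
  next
    case ("2_2" c m e1 e2 es)
    let ?es = "e1 # e2 # es"
    have "\<forall>e\<in>set ?es. path_bound e"
      using "2_2" by (intro ballI key) auto
    from sum_list_path_bound[OF this] show ?case
      using "2_2.prems" by (simp add: path_invariant_def path_flags_def step2_def balanced_def)
  qed
  show "path_bound e" by (rule key[OF *])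
qed

lemma length_vmerge_path_le: "length (vmerge_path b ps) \<le> length ps"
  by (induction b ps rule: vmerge_path.induct) auto

text \<open>This crude bound supplements the amortized one, which is weak when Step 1 has merged
  many pairs.\<close>

lemma edge_count_vmerge_max_path: "edge_count (vmerge (max_path e)) \<le> edge_count e"
proof -
  have vm: "edge_count (vmerge (max_path f)) \<le>
      length (fst (max_path f)) + edges_count (snd (max_path f))" for f :: "'a edge"
    using fst_max_path_nonempty[of f] length_vmerge_path_le
    by (cases "max_path f") (simp add: edge_count_vmerge)
  have "length (fst (max_path e)) + edges_count (snd (max_path e)) \<le> edge_count e"
  proof (induction e rule: max_path.induct)
    case (1 c m e)
    then show ?case by (cases "max_path e") simp
  next
    case ("2_2" c m e1 e2 es)
    then have "sum_list (map (\<lambda>e. edge_count (vmerge (max_path e))) (e1 # e2 # es)) \<le>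
        edges_count (e1 # e2 # es)"
      by (intro sum_list_mono) (meson le_trans vm)
    then show ?case by (simp add: comp_def)
  qed simp
  with vm[of e] show ?thesis by linarith
qed

text \<open>Let Step 1 leave \<open>E\<close> edges after \<open>M\<close> merges, so that there
  were \<open>E + M\<close> edges before, and let Step 2 leave \<open>E'\<close>. Adding twice
  \<open>E' \<le> E\<close> to \<open>4 * E' \<le> 3 * E + 5 * M\<close> gives
  \<open>6 * E' \<le> 5 * (E + M)\<close>.\<close>

lemma edges_count_iteration:
  assumes "1 < edges_count es"
  shows "6 * edges_count (step2 (step1 es)) \<le> 5 * edges_count es"
proof -
  let ?fs = "step1 es"
  note inv = step1_invariant[of es]
  have pb: "\<forall>e\<in>set ?fs. path_bound e" using inv(3) max_path_bound(2) by blast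
  have le: "edges_count (step2 ?fs) \<le> edges_count ?fs"
    by (auto simp: step2_def comp_def intro!: sum_list_mono edge_count_vmerge_max_path)
  have "length (filter unmerged_leaf ?fs) \<le> length (filter merged ?fs) \<or>
    (\<exists>e. ?fs = [e] \<and> unmerged_leaf e)"
    using inv(2) by (auto simp: balanced_def le_Suc_eq length_Suc_conv)
  \<comment> \<open>A single unmerged edge to a leaf means one edge and no merge, hence only one
    edge before the iteration.\<close>
  moreover have "\<not> unmerged_leaf e" if "?fs = [e]" for e
    using that inv(1) assms by (cases e) (auto split: if_splits simp: of_bool_def)
  ultimately have "4 * edges_count (step2 ?fs) \<le> 3 * edges_count ?fs + 5 * merged_counts ?fs"
    using sum_list_path_bound[OF pb] by auto
  with le inv(1) show ?thesis by linarith
qed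

section \<open>Growth of the cluster heights\<close>

fun clusters_le :: "nat \<Rightarrow> 'a edge \<Rightarrow> bool" where
  "clusters_le n (Edge c m es) \<longleftrightarrow> top_height c \<le> n \<and> (\<forall>e\<in>set es. clusters_le n e)"

text \<open>The state inside the recursion of Step 1: the edges below have been merged with their
  siblings, the edge itself has not.\<close>

fun clusters_le_below :: "nat \<Rightarrow> 'a edge \<Rightarrow> bool" where
  "clusters_le_below n (Edge c m es) \<longleftrightarrow> top_height c \<le> n \<and> (\<forall>e\<in>set es. clusters_le (Suc n) e)"

lemma clusters_le_hmerge_children:
  "\<forall>e\<in>set es. clusters_le_below n e \<Longrightarrow> \<forall>e\<in>set (hmerge_children es). clusters_le (Suc n) e"
proof (induction es rule: hmerge_children.induct)
  case (1 e f g)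
  then show ?case by (cases e; cases f; cases g) auto
next
  case ("2_1" e f)
  then show ?case by (cases e; cases f) auto
next
  case ("2_2" e f g h es)
  then show ?case by (cases e; cases f) auto
next
  case ("3_2" e)
  then show ?case by (cases e) auto
qed auto

lemma clusters_le_below_step1_edge: "clusters_le n e \<Longrightarrow> clusters_le_below n (step1_edge e)"
proof (induction e rule: step1_edge.induct)
  case (1 c m es)
  then show ?case using clusters_le_hmerge_children[of "map step1_edge es" n] by auto
qed

lemma clusters_le_step1:
  "\<forall>e\<in>set es. clusters_le n e \<Longrightarrow> \<forall>e\<in>set (step1 es). clusters_le (Suc n) e"
  unfolding step1_def
  by (rule clusters_le_hmerge_children) (auto simp: clusters_le_below_step1_edge)

lemma top_height_vmerge_path:
  "\<forall>p\<in>set ps. top_height (fst p) \<le> n \<Longrightarrow>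
   \<forall>p\<in>set (vmerge_path b ps). top_height (fst p) \<le> Suc n"
  by (induction b ps rule: vmerge_path.induct) auto

lemma clusters_le_attach_path:
  "ps \<noteq> [] \<Longrightarrow> \<forall>p\<in>set ps. top_height (fst p) \<le> n \<Longrightarrow> \<forall>e\<in>set es. clusters_le n e \<Longrightarrow>
   clusters_le n (attach_path ps es)"
  by (induction ps es rule: attach_path.induct) auto

lemma clusters_le_vmerge_max_path:
  "clusters_le n e \<Longrightarrow> clusters_le (Suc n) (vmerge (max_path e))"
proof -
  have vm: "clusters_le (Suc n) (vmerge (max_path f))"
    if "\<forall>p\<in>set (fst (max_path f)). top_height (fst p) \<le> n"
      "\<forall>e\<in>set (snd (max_path f)). clusters_le (Suc n) e" for f :: "'a edge"
    using that fst_max_path_nonempty[of f] clusters_le_attach_path[OF _ top_height_vmerge_path]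
    by (cases "max_path f") (auto simp: vmerge_def)
  have "clusters_le n e \<Longrightarrow> (\<forall>p\<in>set (fst (max_path e)). top_height (fst p) \<le> n) \<and>
      (\<forall>f\<in>set (snd (max_path e)). clusters_le (Suc n) f)"
  proof (induction e rule: max_path.induct)
    case (1 c m e)
    then show ?case by (cases "max_path e") auto
  next
    case ("2_2" c m e1 e2 es)
    have "\<forall>f\<in>set (e1 # e2 # es). clusters_le (Suc n) (vmerge (max_path f))"
      using "2_2" by (intro ballI vm) auto
    then show ?case using "2_2.prems" by simp
  qed simp
  then show "clusters_le n e \<Longrightarrow> clusters_le (Suc n) (vmerge (max_path e))" using vm by blast
qed

lemma clusters_le_step2:
  "\<forall>e\<in>set es. clusters_le n e \<Longrightarrow> \<forall>e\<in>set (step2 es). clusters_le (Suc n) e"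
  by (auto simp: step2_def clusters_le_vmerge_max_path)

lemma edges_count_0: "edges_count es = 0 \<longleftrightarrow> es = []"
  by (cases es; cases "hd es") auto

lemma edges_count_initial: "Suc (edges_count (initial_edges T)) = num_nodes T"
  by (induction T rule: initial_edges.induct) (simp add: comp_def cong: map_cong)

lemma clusters_le_initial: "\<forall>e\<in>set (initial_edges T). clusters_le 0 e"
  by (induction T rule: initial_edges.induct) auto

text \<open>The reason is 2 * 5^4 = 1250 \<le> 1296 = 6^4: four reductions by the factor 5/6 at
  least halve the number of edges.\<close>

lemma pow_6_5_bound:
  fixes j n :: nat
  assumes "6 ^ j \<le> 5 ^ j * n"
  shows "2 ^ j \<le> n ^ 4"
proof -
  have "(2 ^ j * 625 ^ j :: nat) = 1250 ^ j" by (simp flip: power_mult_distrib)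
  also have "\<dots> \<le> 1296 ^ j" by (rule power_mono) auto
  also have "\<dots> = (6 ^ j) ^ 4"
    using power_mult[of "6 :: nat" 4 j] power_mult[of "6 :: nat" j 4] by (simp add: mult.commute)
  also have "\<dots> \<le> (5 ^ j * n) ^ 4" using assms by (rule power_mono) auto
  also have "\<dots> = n ^ 4 * 625 ^ j"
    using power_mult[of "5 :: nat" 4 j] power_mult[of "5 :: nat" j 4]
    by (simp add: power_mult_distrib mult.commute)
  finally show ?thesis by simp
qed

text \<open>The factor 8 is four iterations per halving times two levels per iteration.\<close>

theorem top_tree_correct:
  assumes "2 \<le> num_nodes T"
  shows "sem (top_tree T) [] = children T"
    and "real (top_height (top_tree T)) \<le> 8 * log 2 (real (num_nodes T))"
proof -
  let ?M = "edges_count (initial_edges T)"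
  let ?b = "\<lambda>es :: 'a edge list. edges_count es > 1"
  let ?c = "\<lambda>es :: 'a edge list. step2 (step1 es)"
  \<comment> \<open>\<open>j\<close> counts the completed iterations; it is existentially quantified
    because the loop does not store it.\<close>
  let ?I = "\<lambda>es. edges_sem es = children T \<and>
    (\<exists>j. 6 ^ j * edges_count es \<le> 5 ^ j * ?M \<and> (\<forall>e\<in>set es. clusters_le (2 * j) e))"
  let ?Q = "\<lambda>es. edges_count es \<le> 1 \<and> ?I es"
  have "?Q (while ?b ?c (initial_edges T))"
  proof (rule while_rule[where P = ?I and r = "measure edges_count"])
    show "?I (initial_edges T)"
      using clusters_le_initial[of T] by (auto simp: edges_sem_initial intro!: exI[of _ 0])
  next
    fix es assume I: "?I es" and b: "?b es"
    then obtain j where j: "6 ^ j * edges_count es \<le> 5 ^ j * ?M" "\<forall>e\<in>set es. clusters_le (2 * j) e"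
      by blast
    have "6 ^ Suc j * edges_count (?c es) \<le> 6 ^ j * (5 * edges_count es)"
      using edges_count_iteration[OF b] by simp
    also have "\<dots> \<le> 5 ^ Suc j * ?M" using j(1) by simp
    finally have "6 ^ Suc j * edges_count (?c es) \<le> 5 ^ Suc j * ?M" .
    moreover have "\<forall>e\<in>set (?c es). clusters_le (2 * Suc j) e"
      using clusters_le_step2[OF clusters_le_step1[OF j(2)]] by simp
    moreover have "edges_sem (?c es) = children T"
      using I by (simp add: edges_sem_step1 edges_sem_step2)
    ultimately show "?I (?c es)" by blast
    show "(?c es, es) \<in> measure edges_count"
      using edges_count_iteration[OF b] b by (simp add: measure_def)
  next
    show "?Q es" if "?I es" "\<not> ?b es" for es using that by simp
  qed simp
  then obtain es j where es: "while ?b ?c (initial_edges T) = es" "edges_count es \<le> 1"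
    "edges_sem es = children T" "6 ^ j * edges_count es \<le> 5 ^ j * ?M"
    "\<forall>e\<in>set es. clusters_le (2 * j) e" by blast
  have "children T \<noteq> []" using assms by (cases T) auto
  with es(3) have "es \<noteq> []" by auto
  then obtain c m fs es' where e: "es = Edge c m fs # es'" by (metis edge_count.cases list.exhaust)
  with es(2) have "edges_count fs = 0" "edges_count es' = 0" by auto
  then have "fs = []" "es' = []" by (simp_all only: edges_count_0)
  with e have e: "es = [Edge c m []]" by simp
  have top: "top_tree T = c" unfolding top_tree_def es(1) by (simp add: e)
  show "sem (top_tree T) [] = children T" using es(3) by (simp add: top e)
  \<comment> \<open>Exactly one edge is left in the end, which bounds (6/5)^j by the initial number
    of edges.\<close>
  have "(6 :: nat) ^ j \<le> 5 ^ j * num_nodes T"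
    using es(4) edges_count_initial[of T] by (simp add: e trans_le_add2 flip: edges_count_initial)
  then have "(2 :: nat) ^ j \<le> num_nodes T ^ 4" by (rule pow_6_5_bound)
  then have "log 2 (real (2 ^ j)) \<le> log 2 (real (num_nodes T ^ 4))"
    using assms by (intro log_mono) (auto simp flip: of_nat_power)
  then have "real j \<le> 4 * log 2 (real (num_nodes T))"
    using assms by (simp add: log_nat_power)
  moreover have "top_height c \<le> 2 * j" using es(5) by (simp add: e)
  ultimately show "real (top_height (top_tree T)) \<le> 8 * log 2 (real (num_nodes T))"
    by (simp add: top)
qed

section \<open>Preorder numbers\<close>

definition forest_size :: "'a tree list \<Rightarrow> nat" where
  "forest_size ts = sum_list (map num_nodes ts)"

lemma forest_size_simps [simp]:
  "forest_size [] = 0" "forest_size (t # ts) = num_nodes t + forest_size ts"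
  "forest_size (ts @ us) = forest_size ts + forest_size us"
  by (simp_all add: forest_size_def)

lemma num_nodes_Node: "num_nodes (Node a ts) = Suc (forest_size ts)"
  by (simp add: forest_size_def)

declare num_nodes.simps [simp del] num_nodes_Node [simp]

lemma num_nodes_pos [simp]: "0 < num_nodes t"
  by (cases t) simp

lemma forest_size_eq_0_iff [simp]: "forest_size ts = 0 \<longleftrightarrow> ts = []"
  by (cases ts) (auto simp: num_nodes_pos[THEN gr_implies_not0])

text \<open>In preorder, for every node the numbers of its ancestors (from the node itself upwards, followed
  by \<open>up\<close>) and its subtree, where the numbering starts with \<open>off\<close>.\<close>

fun nodes_info :: "nat list \<Rightarrow> nat \<Rightarrow> 'a tree list \<Rightarrow> (nat list \<times> 'a tree) list" where
  "nodes_info up off [] = []"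
| "nodes_info up off (Node a ts # us) =
     (off # up, Node a ts) # nodes_info (off # up) (Suc off) ts @
     nodes_info up (off + num_nodes (Node a ts)) us"

lemma length_nodes_info [simp]: "length (nodes_info up off ts) = forest_size ts"
  by (induction up off ts rule: nodes_info.induct) auto

lemma nodes_info_append:
  "nodes_info up off (ts @ us) = nodes_info up off ts @ nodes_info up (off + forest_size ts) us"
  by (induction up off ts rule: nodes_info.induct) (auto simp: add_ac)

text \<open>\<open>X\<close> consists of the ancestors inside the forest, starting with the node
  itself. They do not come later in preorder, whence the bound on their number; it keeps depths
  within a word and below the default depth limit of the search.\<close>

lemma nodes_info_ancestors:
  "i < forest_size ts \<Longrightarrow>
   \<exists>X. fst (nodes_info up off ts ! i) = X @ up \<and> X \<noteq> [] \<and> hd X = off + i \<and> length X \<le> Suc i"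
proof (induction up off ts arbitrary: i rule: nodes_info.induct)
  case (2 up off a ts us)
  consider "i = 0" | j where "i = Suc j" "j < forest_size ts"
    | j where "i = Suc (forest_size ts + j)" "j < forest_size us"
    using "2.prems" by (cases i) (auto, metis add_diff_inverse_nat add_less_cancel_left)
  then show ?case
  proof cases
    case 1
    then show ?thesis by (intro exI[of _ "[off]"]) auto
  next
    case (2 j)
    then obtain X where "fst (nodes_info (off # up) (Suc off) ts ! j) = X @ off # up"
      "X \<noteq> []" "hd X = Suc off + j" "length X \<le> Suc j"
      using "2.IH"(1) by blast
    with 2 show ?thesis by (intro exI[of _ "X @ [off]"]) (auto simp: nth_append)
  next
    case (3 j)
    then obtain X where "fst (nodes_info up (off + num_nodes (Node a ts)) us ! j) = X @ up"
      "X \<noteq> []" "hd X = off + num_nodes (Node a ts) + j"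
      "length X \<le> Suc j"
      using "2.IH"(2) by blast
    with 3 show ?thesis by (intro exI[of _ X]) (auto simp: nth_append)
  qed
qed auto

fun valid_path :: "'a tree \<Rightarrow> nat list \<Rightarrow> bool" where
  "valid_path t [] \<longleftrightarrow> True"
| "valid_path (Node a ts) (i # p) \<longleftrightarrow> i < length ts \<and> valid_path (ts ! i) p"

text \<open>The preorder number computed from the path alone: each step down passes the parent and
  the subtrees to the left of the path.\<close>

fun path_num :: "'a tree \<Rightarrow> nat list \<Rightarrow> nat" where
  "path_num t [] = 0"
| "path_num (Node a ts) (i # p) = Suc (forest_size (take i ts) + path_num (ts ! i) p)"

lemma set_preorder: "p \<in> set (preorder t) \<longleftrightarrow> valid_path t p"
proof (induction t p rule: valid_path.induct)
  case (1 t)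
  then show ?case by (cases t) auto
next
  case (2 a ts i p)
  then show ?case by (force simp: set_zip)
qed

lemma valid_path_append:
  "valid_path t (p @ q) \<longleftrightarrow> valid_path t p \<and> valid_path (subtree_at t p) q"
  by (induction t p rule: valid_path.induct) auto

lemma path_num_append: "path_num t (p @ q) = path_num t p + path_num (subtree_at t p) q"
  by (induction t p rule: path_num.induct) auto

lemma subtree_at_append: "subtree_at t (p @ q) = subtree_at (subtree_at t p) q"
  by (induction t p rule: subtree_at.induct) auto

definition path_info :: "nat list \<Rightarrow> nat \<Rightarrow> 'a tree \<Rightarrow> nat list \<Rightarrow> nat list \<times> 'a tree" where
  "path_info up off t p =
     (rev (map (\<lambda>j. off + path_num t (take j p)) [0..<Suc (length p)]) @ up, subtree_at t p)"

lemma path_info_Cons: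
  "path_info up off (Node a ts) (i # p) =
   path_info (off # up) (Suc off + forest_size (take i ts)) (ts ! i) p"
  by (simp add: path_info_def map_upt_Suc add_ac del: upt_Suc)

text \<open>Links the queries, which are defined by paths, with the numbering used for clusters:
  both enumerate the tree in the same order, and a path determines the ancestor numbers and the
  subtree.\<close>

lemma nodes_info_paths: "nodes_info up off [t] = map (path_info up off t) (preorder t)"
proof (induction t arbitrary: up off rule: preorder.induct)
  case (1 a ts)
  \<comment> \<open>Generalized to sublists \<open>us\<close> of the children, so that the outer
    induction hypothesis remains applicable in the induction on \<open>us\<close>.\<close>
  have forest: "nodes_info up off us = concat (map2 (\<lambda>i u. map (path_info up
      (off + forest_size (take i us)) u) (preorder u)) [0..<length us] us)"
    if "set us \<subseteq> set ts" for us up off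
    using that
  proof (induction us arbitrary: off)
    case (Cons u us)
    have "nodes_info up off (u # us) = nodes_info up off [u] @ nodes_info up (off + num_nodes u) us"
      using nodes_info_append[of up off "[u]" us] by simp
    also have "nodes_info up off [u] = map (path_info up off u) (preorder u)"
      using Cons.prems 1 by simp
    also have "nodes_info up (off + num_nodes u) us = concat (map2 (\<lambda>i u'. map (path_info up
      (off + num_nodes u + forest_size (take i us)) u') (preorder u')) [0..<length us] us)"
      using Cons by simp
    finally show ?case
      by (simp add: upt_conv_Cons map_Suc_upt[symmetric] zip_map1 comp_def case_prod_unfold add_ac
          del: upt_Suc)
  qed simp
  have "map (path_info up off (Node a ts)) (concat (map2 (\<lambda>i ps. map ((#) i) ps)
      [0..<length ts] (map preorder ts))) =
    concat (map2 (\<lambda>i u. map (path_info (off # up) (Suc off + forest_size (take i ts)) u) (preorder u))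
      [0..<length ts] ts)"
    unfolding map_concat
    by (intro arg_cong[where f = concat] nth_equalityI)
       (auto simp: path_info_Cons comp_def)
  moreover have "path_info up off (Node a ts) [] = (off # up, Node a ts)"
    by (simp add: path_info_def)
  ultimately show ?case
    using forest[of ts "off # up" "Suc off"] by simp
qed

text \<open>If equal numbers mean equal prefixes, two ancestor lists agree exactly as far as the
  paths do. \<open>f\<close> is arbitrary because the induction replaces it by
  \<open>\<lambda>r. f (a # r)\<close>.\<close>

lemma longest_common_prefix_map_take:
  assumes "\<And>i j. f (take i p) = f (take j q) \<Longrightarrow> take i p = take j q"
  shows "longest_common_prefix (map (\<lambda>j. f (take j p)) [0..<Suc (length p)])
      (map (\<lambda>j. f (take j q)) [0..<Suc (length q)]) =
    map (\<lambda>j. f (take j (longest_common_prefix p q)))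
      [0..<Suc (length (longest_common_prefix p q))]"
  using assms
proof (induction p q arbitrary: f rule: longest_common_prefix.induct)
  case (1 a p b q)
  show ?case
  proof (cases "a = b")
    case True
    have "f (a # take i p) = f (a # take j q) \<Longrightarrow> take i p = take j q" for i j
      using 1(2)[of "Suc i" "Suc j"] True by simp
    then show ?thesis
      using 1(1)[of "\<lambda>r. f (a # r)"] True by (simp add: map_upt_Suc del: upt_Suc)
  next
    case False
    then have "f [a] \<noteq> f [b]" using 1(2)[of 1 1] by auto
    with False show ?thesis by (simp add: map_upt_Suc del: upt_Suc)
  qed
qed (auto simp: map_upt_Suc simp del: upt_Suc)

section \<open>The queries expressed through ancestor numbers and subtrees\<close>

context
  fixes T :: "'a tree"
begin

abbreviation "info \<equiv> nodes_info [] 0 [T]"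

lemma length_preorder: "length (preorder T) = num_nodes T"
  using length_nodes_info[of "[]" 0 "[T]"] by (simp add: nodes_info_paths del: length_nodes_info)

lemma info_path_of: "x < num_nodes T \<Longrightarrow> info ! x = path_info [] 0 T (path_of T x)"
  by (simp add: nodes_info_paths length_preorder path_of_def)

lemma valid_path_of: "x < num_nodes T \<Longrightarrow> valid_path T (path_of T x)"
  by (simp add: path_of_def length_preorder flip: set_preorder)

lemma path_num_path_of: "x < num_nodes T \<Longrightarrow> path_num T (path_of T x) = x"
  using nodes_info_ancestors[of x "[T]" "[]" 0] by (auto simp: info_path_of path_info_def)

lemma number_of_eq: "number_of T p = (if valid_path T p then Some (path_num T p) else None)"
proof (cases "valid_path T p")
  case True
  then obtain x where x: "x < num_nodes T" "path_of T x = p"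
    by (metis in_set_conv_nth length_preorder path_of_def set_preorder)
  then have "(THE x. x < num_nodes T \<and> path_of T x = p) = path_num T p"
    by (intro the_equality) (auto simp: path_num_path_of, metis path_num_path_of)
  then show ?thesis using True by (simp add: number_of_def set_preorder)
qed (simp add: number_of_def set_preorder)

lemma q_decompress_info: "x < num_nodes T \<Longrightarrow> q_decompress T x = snd (info ! x)"
  by (simp add: info_path_of path_info_def q_decompress_def)

lemma q_depth_info: "x < num_nodes T \<Longrightarrow> Suc (q_depth T x) = length (fst (info ! x))"
  by (simp add: info_path_of path_info_def q_depth_def)

lemma rev_ancestors_nth:
  "x < num_nodes T \<Longrightarrow> i \<le> length (path_of T x) \<Longrightarrow>
   rev (fst (info ! x)) ! i = path_num T (take i (path_of T x))"
  by (simp add: info_path_of path_info_def del: upt_Suc)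

lemma number_of_take:
  assumes "x < num_nodes T" "i \<le> length (path_of T x)"
  shows "number_of T (take i (path_of T x)) = Some (rev (fst (info ! x)) ! i)"
proof -
  have "valid_path T (take i (path_of T x))"
    using valid_path_of[OF assms(1)] valid_path_append[of T "take i (path_of T x)" "drop i (path_of T x)"]
    by simp
  then show ?thesis using assms by (simp add: number_of_eq rev_ancestors_nth)
qed

text \<open>\<open>last (take d ...)\<close> is the form in which \<open>locate\<close> finds
  ancestors; here \<open>d\<close> is the depth of the ancestor plus 1.\<close>

lemma q_level_ancestor_info:
  assumes "x < num_nodes T"
  shows "q_level_ancestor T x i =
    (if i < length (fst (info ! x))
     then Some (last (take (length (fst (info ! x)) - i) (rev (fst (info ! x))))) else None)"
proof (cases "i \<le> length (path_of T x)")
  case True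
  let ?P = "rev (fst (info ! x))"
  have len: "length ?P = Suc (length (path_of T x))"
    using q_depth_info[OF assms] by (simp add: q_depth_def)
  then have "last (take (length ?P - i) ?P) = ?P ! (length (path_of T x) - i)"
    using True by (subst last_conv_nth) auto
  with True len show ?thesis
    using number_of_take[OF assms, of "length (path_of T x) - i"]
    by (simp add: q_level_ancestor_def Let_def)
next
  case False
  then show ?thesis
    using q_depth_info[OF assms] by (simp add: q_level_ancestor_def q_depth_def Let_def)
qed

lemma q_parent_info:
  assumes "x < num_nodes T"
  shows "q_parent T x = (case tl (fst (info ! x)) of [] \<Rightarrow> None | u # _ \<Rightarrow> Some u)"
proof (cases "path_of T x" rule: rev_cases)
  case Nil
  then show ?thesis using assms by (simp add: q_parent_def info_path_of path_info_def)
next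
  case (snoc p i)
  then have "number_of T p = Some (path_num T p)"
    using valid_path_of[OF assms] by (simp add: number_of_eq valid_path_append)
  with snoc show ?thesis using assms by (simp add: q_parent_def info_path_of path_info_def)
qed

text \<open>A first child directly follows its parent in preorder.\<close>

lemma q_first_child_info:
  assumes "x < num_nodes T"
  shows "q_first_child T x = (if 1 < num_nodes (snd (info ! x)) then Some (Suc x) else None)"
proof -
  obtain a ts where t: "subtree_at T (path_of T x) = Node a ts" by (cases "subtree_at T (path_of T x)")
  then have "snd (info ! x) = Node a ts" using assms by (simp add: info_path_of path_info_def)
  then show ?thesis
    using assms valid_path_of[OF assms] path_num_path_of[OF assms]
    by (simp add: q_first_child_def number_of_eq valid_path_append path_num_append t)
qed

lemma forest_size_take_le: "forest_size (take i ts) \<le> forest_size ts"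
  by (metis append_take_drop_id forest_size_simps(3) le_add1)

text \<open>The first number after the subtree of \<open>x\<close> belongs to the next sibling,
  provided that it still lies in the subtree of the parent. Thus two subtree sizes decide the
  query.\<close>

lemma q_next_sibling_info:
  assumes "x < num_nodes T"
  shows "q_next_sibling T x = (case tl (fst (info ! x)) of [] \<Rightarrow> None
    | u # _ \<Rightarrow> (if x + num_nodes (snd (info ! x)) < u + num_nodes (snd (info ! u))
                then Some (x + num_nodes (snd (info ! x))) else None))"
proof (cases "path_of T x" rule: rev_cases)
  case Nil
  then show ?thesis using assms by (simp add: q_next_sibling_def info_path_of path_info_def)
next
  case (snoc p i)
  obtain a ts where t: "subtree_at T p = Node a ts" by (cases "subtree_at T p")
  from valid_path_of[OF assms] have v: "valid_path T p" "i < length ts"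
    by (simp_all add: snoc valid_path_append t)
  obtain u where u: "u < num_nodes T" "path_of T u = p"
    using v(1) by (metis in_set_conv_nth length_preorder path_of_def set_preorder)
  have pu: "path_num T p = u" using path_num_path_of[OF u(1)] u by simp
  have su: "snd (info ! u) = Node a ts" using u t by (simp add: info_path_of path_info_def)
  have x: "x = u + Suc (forest_size (take i ts))"
    using path_num_path_of[OF assms] by (simp add: snoc path_num_append pu t)
  have sx: "snd (info ! x) = ts ! i"
    using assms t by (simp add: info_path_of path_info_def snoc subtree_at_append)
  have anc: "tl (fst (info ! x)) = u # tl (tl (fst (info ! x)))"
    using assms by (simp add: info_path_of path_info_def snoc pu)
  have take: "forest_size (take (Suc i) ts) = forest_size (take i ts) + num_nodes (ts ! i)"
    using v(2) by (simp add: take_Suc_conv_app_nth)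
  \<comment> \<open>Trees are nonempty, so a further sibling exists exactly if some nodes below the
    parent have not yet been counted.\<close>
  have "Suc i < length ts \<longleftrightarrow> forest_size (take (Suc i) ts) < forest_size ts"
  proof
    assume "Suc i < length ts"
    then have "forest_size (take (Suc i) ts) < forest_size (take (Suc (Suc i)) ts)"
      by (simp add: take_Suc_conv_app_nth[of "Suc i"])
    then show "forest_size (take (Suc i) ts) < forest_size ts"
      using forest_size_take_le[of "Suc (Suc i)" ts] by linarith
  next
    assume "forest_size (take (Suc i) ts) < forest_size ts"
    then show "Suc i < length ts" by (rule contrapos_pp) simp
  qed
  then have "number_of T (p @ [Suc i]) =
    (if x + num_nodes (ts ! i) < u + num_nodes (Node a ts) then Some (x + num_nodes (ts ! i)) else None)"
    using v(1) by (simp add: number_of_eq valid_path_append path_num_append t pu x take)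
  then show ?thesis
    by (subst anc) (simp add: q_next_sibling_def snoc su sx)
qed

lemma q_nca_info:
  assumes "x < num_nodes T" "y < num_nodes T"
  shows "q_nca T x y =
    Some (last (longest_common_prefix (rev (fst (info ! x))) (rev (fst (info ! y)))))"
proof -
  let ?p = "path_of T x" and ?q = "path_of T y"
  let ?f = "\<lambda>p. map (\<lambda>j. path_num T (take j p)) [0..<Suc (length p)]"
  have inj: "take i ?p = take j ?q" if "path_num T (take i ?p) = path_num T (take j ?q)" for i j
  proof -
    have "valid_path T (take i ?p)" "valid_path T (take j ?q)"
      using valid_path_of[OF assms(1)] valid_path_of[OF assms(2)]
      by (metis append_take_drop_id valid_path_append)+
    with that show ?thesis
      by (metis in_set_conv_nth length_preorder path_num_path_of path_of_def set_preorder)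
  qed
  let ?l = "longest_common_prefix ?p ?q"
  have anc: "rev (fst (info ! z)) = map (\<lambda>j. path_num T (take j (path_of T z))) [0..<Suc (length (path_of T z))]"
    if "z < num_nodes T" for z
    using that by (simp add: info_path_of path_info_def)
  have "valid_path T ?l"
    using valid_path_of[OF assms(1)] longest_common_prefix_prefix1[of ?p ?q]
    by (metis prefixE valid_path_append)
  moreover have "longest_common_prefix (rev (fst (info ! x))) (rev (fst (info ! y))) =
      map (\<lambda>j. path_num T (take j ?l)) [0..<Suc (length ?l)]"
    unfolding anc[OF assms(1)] anc[OF assms(2)]
    by (rule longest_common_prefix_map_take) (rule inj)
  ultimately show ?thesis by (simp add: q_nca_def number_of_eq)
qed

end

section \<open>Searching in clusters\<close>

fun csize :: "'a top_tree \<Rightarrow> nat" where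
  "csize (TEdge a b) = 1"
| "csize (TMerge k A B) = csize A + csize B"

text \<open>The number of nodes of the cluster, without its top boundary node, that precede the
  contents of the hole in preorder; the last of them is the bottom boundary node.\<close>

fun pre_size :: "'a top_tree \<Rightarrow> nat" where
  "pre_size (TEdge a b) = 1"
| "pre_size (TMerge k A B) =
     (if vertical k then pre_size A + pre_size B
      else if k = HRight then csize A + pre_size B else pre_size A)"

fun hole_depth :: "'a top_tree \<Rightarrow> nat" where
  "hole_depth (TEdge a b) = 1"
| "hole_depth (TMerge k A B) =
     (if vertical k then hole_depth A + hole_depth B
      else if k = HRight then hole_depth B else hole_depth A)"

fun cheight :: "'a top_tree \<Rightarrow> nat" where
  "cheight (TEdge a b) = 1"
| "cheight (TMerge k A B) =
     (if vertical k then max (cheight A) (hole_depth A + cheight B) else max (cheight A) (cheight B))"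

text \<open>The numbers on the path from the bottom boundary node up to, but excluding, the top
  boundary node, if the first node of the cluster has number \<open>off\<close>.\<close>

fun spine :: "'a top_tree \<Rightarrow> nat \<Rightarrow> nat list" where
  "spine (TEdge a b) off = [off]"
| "spine (TMerge k A B) off =
     (if vertical k then spine B (off + pre_size A) @ spine A off
      else if k = HRight then spine B (off + csize A) else spine A off)"

text \<open>Each cluster of the list fills the hole of its predecessor. In this form the contents of
  a hole can be stored by pointers into the top DAG.\<close>

fun fill :: "'a top_tree list \<Rightarrow> 'a tree list" where
  "fill [] = []"
| "fill (c # K) = sem c (fill K)"

definition forest_height :: "'a tree list \<Rightarrow> nat" where
  "forest_height ts = (if ts = [] then 0 else Suc (Max (height ` set ts)))"

lemma forest_height_simps [simp]:
  "forest_height [] = 0"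
  "forest_height (t # ts) = max (Suc (height t)) (forest_height ts)"
  by (simp_all add: forest_height_def)

lemma forest_height_append [simp]:
  "forest_height (ts @ us) = max (forest_height ts) (forest_height us)"
  by (induction ts) simp_all

lemma height_Node: "height (Node a ts) = forest_height ts"
  by (simp add: forest_height_def)

declare height.simps [simp del] height_Node [simp]

text \<open>Guarantees that the heights computed by the programs fit in a word.\<close>

lemma forest_height_le_size: "forest_height ts \<le> forest_size ts"
proof -
  have "Suc (height t) \<le> num_nodes t" for t :: "'a tree"
  proof (induction t)
    case (Node a ts)
    then have "forest_height us \<le> forest_size us" if "set us \<subseteq> set ts" for us
      using that by (induction us) (fastforce simp: max_def)+
    then show ?case by simp
  qed
  then show ?thesis by (induction ts) (auto simp: max_def intro: le_trans trans_le_add2, meson le_add1 le_trans)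
qed

lemma csize_pos: "0 < csize c"
  by (induction c) auto

lemma pre_size_bounds: "hole_depth c \<le> pre_size c" "pre_size c \<le> csize c" "0 < hole_depth c"
  by (induction c) (auto simp: csize_pos trans_le_add1 trans_le_add2)

lemma cheight_bounds: "hole_depth c \<le> cheight c" "cheight c \<le> csize c"
proof -
  show "cheight c \<le> csize c"
  proof (induction c)
    case (TMerge k A B)
    then show ?case using pre_size_bounds[of A] by auto
  qed simp
  show "hole_depth c \<le> cheight c" by (induction c) (auto simp: le_max_iff_disj)
qed

lemmas cluster_bounds = csize_pos pre_size_bounds cheight_bounds

lemma sem_nonempty [simp]: "sem c h \<noteq> []"
  by (induction c arbitrary: h) auto

lemma forest_size_sem [simp]: "forest_size (sem c h) = csize c + forest_size h"
  by (induction c arbitrary: h) auto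

lemma forest_height_sem [simp]:
  "forest_height (sem c h) = max (cheight c) (hole_depth c + forest_height h)"
proof (induction c arbitrary: h)
  case (TMerge k A B)
  then show ?case using cheight_bounds(1)[of A] cheight_bounds(1)[of B] by (auto simp: max_def)
qed simp

lemma length_spine [simp]: "length (spine c off) = hole_depth c"
  by (induction c arbitrary: off) auto

lemma spine_nonempty [simp]: "spine c off \<noteq> []"
  using length_spine[of c off] pre_size_bounds(3)[of c] by (metis less_irrefl list.size(3))

lemma Suc_hd_spine: "Suc (hd (spine c off)) = off + pre_size c"
  by (induction c arbitrary: off) auto

text \<open>\<open>cluster_nums c off s\<close> are the numbers of the nodes of the cluster \<open>c\<close> other than its top boundary
  node, if its first node has number \<open>off\<close> and \<open>s\<close> nodes lie below the bottom boundary node.\<close>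

definition cluster_nums :: "'a top_tree \<Rightarrow> nat \<Rightarrow> nat \<Rightarrow> nat set" where
  "cluster_nums c off s = {off..<off + csize c + s} - {off + pre_size c..<off + pre_size c + s}"

text \<open>In the last alternative the hole belongs to \<open>A\<close>, and its \<open>s\<close>
  nodes are numbered before those of \<open>B\<close>.\<close>

definition right_start :: "merge_type \<Rightarrow> 'a top_tree \<Rightarrow> nat \<Rightarrow> nat \<Rightarrow> nat" where
  "right_start k A off s = off +
     (if vertical k then pre_size A else if k = HRight then csize A else csize A + s)"

text \<open>The interval includes the contents of the hole of \<open>B\<close>; for a node known to
  be in the merged cluster two comparisons therefore suffice.\<close>

definition in_right :: "merge_type \<Rightarrow> 'a top_tree \<Rightarrow> 'a top_tree \<Rightarrow> nat \<Rightarrow> nat \<Rightarrow> nat \<Rightarrow> bool" where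
  "in_right k A B off s z \<longleftrightarrow> right_start k A off s \<le> z \<and>
     z < right_start k A off s + csize B + (if vertical k \<or> k = HRight then s else 0)"

definition right_fill :: "merge_type \<Rightarrow> 'a top_tree list \<Rightarrow> 'a top_tree list" where
  "right_fill k K = (if vertical k \<or> k = HRight then K else [])"

definition left_fill :: "merge_type \<Rightarrow> 'a top_tree \<Rightarrow> 'a top_tree list \<Rightarrow> 'a top_tree list" where
  "left_fill k B K = (if vertical k then B # K else if k = HRight then [] else K)"

definition right_up :: "merge_type \<Rightarrow> 'a top_tree \<Rightarrow> nat \<Rightarrow> nat list \<Rightarrow> nat list" where
  "right_up k A off up = (if vertical k then spine A off @ up else up)"

abbreviation fill_size :: "'a top_tree list \<Rightarrow> nat" where
  "fill_size K \<equiv> forest_size (fill K)"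

definition entry :: "'a top_tree \<Rightarrow> nat list \<Rightarrow> nat \<Rightarrow> 'a top_tree list \<Rightarrow> nat \<Rightarrow> nat list \<times> 'a tree" where
  "entry c up off K z = nodes_info up off (sem c (fill K)) ! (z - off)"

lemma sem_TMerge_fill:
  "sem (TMerge k A B) (fill K) =
    (if vertical k then sem A (fill (left_fill k B K))
     else sem A (fill (left_fill k B K)) @ sem B (fill (right_fill k K)))"
  by (simp add: left_fill_def right_fill_def)

text \<open>Together with \<open>cluster_nums_left\<close>: a node of the merged cluster belongs to
  exactly one of the parts. The boundary node shared in a vertical merge counts for
  \<open>A\<close>, since the numbers of a cluster omit its top boundary node.\<close>

lemma cluster_nums_right:
  "z \<in> cluster_nums B (right_start k A off (fill_size K)) (fill_size (right_fill k K)) \<longleftrightarrow>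
   z \<in> cluster_nums (TMerge k A B) off (fill_size K) \<and> in_right k A B off (fill_size K) z"
  using cluster_bounds[of A] cluster_bounds[of B]
  by (auto simp: cluster_nums_def right_start_def right_fill_def in_right_def)

lemma cluster_nums_left:
  "z \<in> cluster_nums A off (fill_size (left_fill k B K)) \<longleftrightarrow>
   z \<in> cluster_nums (TMerge k A B) off (fill_size K) \<and> \<not> in_right k A B off (fill_size K) z"
  using cluster_bounds[of A] cluster_bounds[of B]
  by (cases k; simp add: cluster_nums_def right_start_def left_fill_def in_right_def; arith)

text \<open>The hole holds all children of the bottom boundary node, and preorder lists their
  subtrees without interruption. So their entries form one block, preceded by those of the
  \<open>pre_size c\<close> nodes up to the boundary node.\<close>

lemma nodes_info_sem:
  "\<exists>P Q. nodes_info up off (sem c h) = P @ nodes_info (spine c off @ up) (off + pre_size c) h @ Q \<and>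
     length P = pre_size c"
proof (induction c arbitrary: up off h)
  case (TEdge a b)
  then show ?case by (intro exI[of _ "[(off # up, Node b h)]"] exI[of _ "[]"]) simp
next
  case (TMerge k A B)
  consider "vertical k" | "\<not> vertical k" "k = HRight" | "\<not> vertical k" "k \<noteq> HRight" by blast
  then show ?case
  proof cases
    case 1
    obtain P Q where A: "nodes_info up off (sem A (sem B h)) =
        P @ nodes_info (spine A off @ up) (off + pre_size A) (sem B h) @ Q" "length P = pre_size A"
      using TMerge(1) by blast
    obtain P' Q' where B: "nodes_info (spine A off @ up) (off + pre_size A) (sem B h) =
        P' @ nodes_info (spine B (off + pre_size A) @ spine A off @ up) (off + pre_size A + pre_size B) h @ Q'"
      "length P' = pre_size B"
      using TMerge(2) by blast
    show ?thesis
      using 1 A B by (intro exI[of _ "P @ P'"] exI[of _ "Q' @ Q"]) (simp add: add_ac)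
  next
    case 2
    obtain P' Q' where B: "nodes_info up (off + csize A) (sem B h) =
        P' @ nodes_info (spine B (off + csize A) @ up) (off + csize A + pre_size B) h @ Q'"
      "length P' = pre_size B"
      using TMerge(2) by blast
    show ?thesis
      using 2 B by (intro exI[of _ "nodes_info up off (sem A []) @ P'"] exI[of _ "Q'"])
        (simp add: add_ac nodes_info_append)
  next
    case 3
    obtain P Q where A: "nodes_info up off (sem A h) =
        P @ nodes_info (spine A off @ up) (off + pre_size A) h @ Q" "length P = pre_size A"
      using TMerge(1) by blast
    show ?thesis
      using 3 A by (intro exI[of _ P] exI)
        (auto simp: nodes_info_append)
  qed
qed

text \<open>Descending to a child leaves the entry of the wanted node unchanged; only the
  description of the position is adapted. The correctness of the search rests on this.\<close>

lemma entry_TMerge: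
  assumes "z \<in> cluster_nums (TMerge k A B) off (fill_size K)"
  shows "entry (TMerge k A B) up off K z =
    (if in_right k A B off (fill_size K) z
     then entry B (right_up k A off up) (right_start k A off (fill_size K)) (right_fill k K) z
     else entry A up off (left_fill k B K) z)"
proof (cases "vertical k")
  case True
  obtain P Q where A: "nodes_info up off (sem A (sem B (fill K))) =
      P @ nodes_info (spine A off @ up) (off + pre_size A) (sem B (fill K)) @ Q" "length P = pre_size A"
    using nodes_info_sem by blast
  show ?thesis
    using True A(2)
    by (auto simp: entry_def left_fill_def right_fill_def right_up_def right_start_def in_right_def A(1)
        nth_append diff_diff_left)
next
  case False
  then show ?thesis
    using assms cluster_bounds[of A] cluster_bounds[of B]
    by (auto simp: entry_def left_fill_def right_fill_def right_up_def right_start_def in_right_def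
        cluster_nums_def nodes_info_append nth_append diff_diff_left not_less)
qed

lemma set_spine: "set (spine c off) \<subseteq> {off..<off + pre_size c}"
proof (induction c arbitrary: off)
  case (TMerge k A B)
  note A = subsetD[OF TMerge(1)[of off]] and B = subsetD[OF TMerge(2)[of "off + pre_size A"]]
    subsetD[OF TMerge(2)[of "off + csize A"]]
  show ?case by (auto dest: A B)
qed simp

lemma spine_cluster_nums: "set (spine c off) \<subseteq> cluster_nums c off s"
  using set_spine[of c off] cluster_bounds[of c] by (fastforce simp: cluster_nums_def)

text \<open>The ancestors split at the top boundary node: \<open>X\<close> lies within the cluster,
  \<open>up\<close> is common to all its nodes. Hence disjoint clusters have disjoint lists
  \<open>X\<close>, which determines common prefixes.\<close>

lemma fst_entry:
  "z \<in> cluster_nums c off (fill_size K) \<Longrightarrow>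
   \<exists>X. fst (entry c up off K z) = X @ up \<and> X \<noteq> [] \<and> hd X = z \<and> set X \<subseteq> cluster_nums c off (fill_size K)"
proof (induction c arbitrary: up off K)
  case (TEdge a b)
  then show ?case by (auto simp: entry_def cluster_nums_def intro!: exI[of _ "[off]"])
next
  case (TMerge k A B)
  let ?s = "fill_size K"
  show ?case
  proof (cases "in_right k A B off ?s z")
    case True
    then obtain X where "fst (entry B (right_up k A off up) (right_start k A off ?s) (right_fill k K) z) =
        X @ right_up k A off up" "X \<noteq> []" "hd X = z"
        "set X \<subseteq> cluster_nums B (right_start k A off ?s) (fill_size (right_fill k K))"
      using TMerge cluster_nums_right by metis
    moreover have "set (spine A off) \<subseteq> cluster_nums (TMerge k A B) off ?s"
      using spine_cluster_nums[of A off] cluster_nums_left by blast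
    moreover have "cluster_nums B (right_start k A off ?s) (fill_size (right_fill k K)) \<subseteq>
        cluster_nums (TMerge k A B) off ?s"
      by (auto simp: cluster_nums_right)
    ultimately show ?thesis
      using True TMerge.prems cluster_nums_right
      by (intro exI[of _ "X @ (if vertical k then spine A off else [])"])
        (auto simp: entry_TMerge right_up_def)
  next
    case False
    then obtain X where "fst (entry A up off (left_fill k B K) z) = X @ up" "X \<noteq> []" "hd X = z"
        "set X \<subseteq> cluster_nums A off (fill_size (left_fill k B K))"
      using TMerge cluster_nums_left by metis
    with False TMerge.prems show ?thesis
      by (intro exI[of _ X]) (auto simp: entry_TMerge cluster_nums_left)
  qed
qed

lemma hole_cluster_nums: "off + pre_size c - 1 \<in> cluster_nums c off s"
  using cluster_bounds[of c] by (auto simp: cluster_nums_def)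

text \<open>The number just before the hole is that of the bottom boundary node, which replaces the
  nodes below it during the search.\<close>

lemma fst_entry_hole: "fst (entry c up off K (off + pre_size c - 1)) = spine c off @ up"
proof (induction c arbitrary: up off K)
  case (TEdge a b)
  then show ?case by (simp add: entry_def)
next
  case (TMerge k A B)
  note bounds = cluster_bounds[of A] cluster_bounds[of B]
  let ?z = "off + pre_size (TMerge k A B) - 1"
  have z: "?z \<in> cluster_nums (TMerge k A B) off (fill_size K)" by (rule hole_cluster_nums)
  have r: "in_right k A B off (fill_size K) ?z \<longleftrightarrow> vertical k \<or> k = HRight"
    using bounds by (auto simp: in_right_def right_start_def)
  show ?case
  proof (cases "vertical k \<or> k = HRight")
    case True
    then have "?z = right_start k A off (fill_size K) + pre_size B - 1"
      by (auto simp: right_start_def)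
    then show ?thesis
      using True r unfolding entry_TMerge[OF z]
      by (simp only: TMerge if_True) (auto simp: right_up_def right_start_def)
  next
    case False
    then have "?z = off + pre_size A - 1" by simp
    then show ?thesis
      using False r unfolding entry_TMerge[OF z] by (simp only: TMerge if_False) auto
  qed
qed

section \<open>Common prefixes and the search for ancestors\<close>

lemma lcp_append_disjoint:
  "set us \<inter> set zs = {} \<Longrightarrow> longest_common_prefix (ws @ us) zs = longest_common_prefix ws zs"
proof (induction ws zs rule: longest_common_prefix.induct)
  case ("2_1" zs)
  then show ?case by (cases us; cases zs) auto
qed auto

lemma lcp_append_same:
  "longest_common_prefix (us @ xs) (us @ ys) = us @ longest_common_prefix xs ys"
  by (induction us) auto

lemma lcp_commute: "longest_common_prefix xs ys = longest_common_prefix ys xs"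
  by (induction xs ys rule: longest_common_prefix.induct) auto

lemma lcp_same: "longest_common_prefix xs xs = xs"
  using lcp_append_same[of xs "[]" "[]"] by simp

lemma lcp_disjoint: "set us \<inter> set zs = {} \<Longrightarrow> longest_common_prefix us zs = []"
  using lcp_append_disjoint[of us zs "[]"] by simp

text \<open>Packs an optional node number into one word, with 0 for no node.\<close>

definition parent_code :: "nat list \<Rightarrow> nat" where
  "parent_code up = (case up of [] \<Rightarrow> 0 | u # _ \<Rightarrow> Suc u)"

text \<open>The search for the node of depth \<open>d - 1\<close> on the path from the root to the nearest common
  ancestor of \<open>x\<close> and \<open>y\<close>. A node below the bottom boundary node of the cluster where the search
  continues is replaced by this boundary node.\<close>

fun locate :: "'a top_tree \<Rightarrow> nat list \<Rightarrow> nat \<Rightarrow> 'a top_tree list \<Rightarrow> nat \<Rightarrow> nat \<Rightarrow> nat \<Rightarrow>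
    nat \<times> (nat list \<times> 'a \<times> 'a top_tree list) option" where
  "locate (TEdge a b) up off K x y d = (Suc off, Some (up, b, K))"
| "locate (TMerge k A B) up off K x y d =
    (let s = fill_size K; st = right_start k A off s; rx = in_right k A B off s x;
         ry = in_right k A B off s y
     in if rx \<and> ry \<and> (vertical k \<longrightarrow> length up + hole_depth A < d)
        then locate B (right_up k A off up) st (right_fill k K) x y d
        else if vertical k \<or> \<not> rx \<and> \<not> ry
        then locate A up off (left_fill k B K) (if rx then st - 1 else x) (if ry then st - 1 else y) d
        else (parent_code up, None))"

lemma cluster_nums_disjoint:
  fixes A B :: "'a top_tree"
  shows "cluster_nums B (right_start k A off (fill_size K)) (fill_size (right_fill k K)) \<inter>
   cluster_nums A off (fill_size (left_fill k B K)) = {}"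
  by (auto simp: cluster_nums_right cluster_nums_left)

text \<open>The ancestors of \<open>x\<close> inside \<open>B\<close> are not ancestors of
  \<open>y\<close>: those of \<open>y\<close> in \<open>A\<close> belong to a disjoint cluster, and
  those in \<open>up\<close> have smaller numbers. So \<open>x\<close> may be replaced by the bottom
  boundary node of \<open>A\<close>.\<close>

lemma lcp_ancestors_hole:
  fixes x :: nat
  assumes x: "x \<in> cluster_nums (TMerge k A B) off (fill_size K)" "in_right k A B off (fill_size K) x"
    and y: "y \<in> cluster_nums (TMerge k A B) off (fill_size K)" "\<not> in_right k A B off (fill_size K) y"
    and v: "vertical k" and up: "\<forall>u\<in>set up. u < off"
  shows "longest_common_prefix (rev (fst (entry (TMerge k A B) up off K x)))
      (rev (fst (entry (TMerge k A B) up off K y))) =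
    longest_common_prefix (rev (fst (entry A up off (left_fill k B K) (off + pre_size A - 1))))
      (rev (fst (entry A up off (left_fill k B K) y)))"
proof -
  let ?st = "right_start k A off (fill_size K)"
  obtain X where X: "fst (entry (TMerge k A B) up off K x) = X @ spine A off @ up"
      "set X \<subseteq> cluster_nums B ?st (fill_size (right_fill k K))"
    using fst_entry[of x B ?st "right_fill k K"] x v
    by (auto simp: cluster_nums_right entry_TMerge right_up_def)
  obtain Y where Y: "fst (entry (TMerge k A B) up off K y) = Y @ up"
      "set Y \<subseteq> cluster_nums A off (fill_size (left_fill k B K))"
    using fst_entry[of y A off "left_fill k B K"] y v by (auto simp: cluster_nums_left entry_TMerge)
  have "set X \<inter> set Y = {}" using X(2) Y(2) cluster_nums_disjoint by blast
  moreover have "set X \<inter> set up = {}"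
    using X(2) up by (force simp: cluster_nums_def right_start_def)
  ultimately have "set (rev X) \<inter> set (rev (Y @ up)) = {}" by auto
  from lcp_append_disjoint[OF this, of "rev (spine A off @ up)"] X(1) Y(1) show ?thesis
    using y by (simp add: fst_entry_hole entry_TMerge del: One_nat_def)
qed

text \<open>\<open>length up < d\<close> says that the depth limit does not cut off within
  \<open>up\<close>; it is maintained because in a vertical merge the search goes right only if the
  limit lies beyond the bottom boundary node of \<open>A\<close>. The last assumption excludes
  horizontal merges without a node above, where the common top boundary node would not
  exist.\<close>

lemma locate_ancestor:
  assumes "x \<in> cluster_nums c off (fill_size K)" "y \<in> cluster_nums c off (fill_size K)"
    and "\<forall>u\<in>set up. u < off" "length up < d" "up = [] \<longrightarrow> length (sem c (fill K)) = 1"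
  shows "fst (locate c up off K x y d) =
    Suc (last (take d (longest_common_prefix (rev (fst (entry c up off K x))) (rev (fst (entry c up off K y))))))"
  using assms
proof (induction c arbitrary: up off K x y)
  case (TEdge a b)
  then have "x = off" "y = off" by (auto simp: cluster_nums_def)
  then show ?case using TEdge.prems by (simp add: entry_def lcp_same)
next
  case (TMerge k A B)
  let ?s = "fill_size K"
  let ?st = "right_start k A off ?s"
  let ?M = "TMerge k A B"
  let ?r = "in_right k A B off ?s"
  let ?lcp = "\<lambda>c up off K x y. longest_common_prefix (rev (fst (entry c up off K x))) (rev (fst (entry c up off K y)))"
  note prems = TMerge.prems
  note e = entry_TMerge[OF prems(1), of up] entry_TMerge[OF prems(2), of up]
  have upA: "up = [] \<longrightarrow> length (sem A (fill (left_fill k B K))) = 1" if "vertical k"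
    using prems(5) that by (simp add: left_fill_def)
  \<comment> \<open>Both parts of a horizontal merge yield at least one tree, which contradicts a
    forest of a single tree.\<close>
  have up_ne: "up \<noteq> []" if "\<not> vertical k"
  proof
    assume "up = []"
    with prems(5) that have "length (sem A (fill (left_fill k B K))) + length (sem B (fill (right_fill k K))) = 1"
      by (simp only: sem_TMerge_fill if_False length_append simp_thms)
    then show False
      using sem_nonempty[of A "fill (left_fill k B K)"] sem_nonempty[of B "fill (right_fill k K)"]
      by (metis One_nat_def add_is_1 length_0_conv)
  qed
  have upB: "\<forall>u\<in>set (right_up k A off up). u < ?st"
    using prems(3) set_spine[of A off] by (fastforce simp: right_up_def right_start_def)
  have neB: "right_up k A off up \<noteq> []" using up_ne by (auto simp: right_up_def)
  have hole: "?st - 1 = off + pre_size A - 1" if "vertical k" using that by (simp add: right_start_def)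
  have holeA: "off + pre_size A - 1 \<in> cluster_nums A off s" for s by (rule hole_cluster_nums)
  consider (right) "?r x" "?r y" "vertical k \<longrightarrow> length up + hole_depth A < d"
    | (cut) "?r x" "?r y" "vertical k" "d \<le> length up + hole_depth A"
    | (left) "\<not> ?r x" "\<not> ?r y"
    | (split) "?r x \<longleftrightarrow> \<not> ?r y" "\<not> vertical k"
    | (xy) "?r x" "\<not> ?r y" "vertical k"
    | (yx) "\<not> ?r x" "?r y" "vertical k"
    by fastforce
  then show ?case
  proof cases
    case right
    have "fst (locate B (right_up k A off up) ?st (right_fill k K) x y d) =
      Suc (last (take d (?lcp B (right_up k A off up) ?st (right_fill k K) x y)))"
      using right prems upB neB
      by (intro TMerge.IH(2)) (auto simp: cluster_nums_right right_up_def)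
    with right show ?thesis by (simp add: Let_def e)
  next
    \<comment> \<open>Both nodes lie in \<open>B\<close>, but the wanted ancestor is at most as deep
      as the bottom boundary node of \<open>A\<close>, so \<open>take d\<close> discards everything
      inside \<open>B\<close>.\<close>
    case cut
    obtain X where X: "fst (entry ?M up off K x) = X @ spine A off @ up"
      using fst_entry[of x B ?st "right_fill k K"] cut prems(1)
      by (auto simp: cluster_nums_right entry_TMerge right_up_def)
    obtain Y where Y: "fst (entry ?M up off K y) = Y @ spine A off @ up"
      using fst_entry[of y B ?st "right_fill k K"] cut prems(2)
      by (auto simp: cluster_nums_right entry_TMerge right_up_def)
    have "fst (locate A up off (left_fill k B K) (?st - 1) (?st - 1) d) =
      Suc (last (take d (?lcp A up off (left_fill k B K) (?st - 1) (?st - 1))))"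
      using cut prems upA holeA hole by (intro TMerge.IH(1)) auto
    also have "\<dots> = Suc (last (take d (rev (spine A off @ up))))"
      using hole cut(3) fst_entry_hole[of A up off] by (simp add: lcp_same)
    also have "\<dots> = Suc (last (take d (?lcp ?M up off K x y)))"
      using cut(4) lcp_append_same[of "rev (spine A off @ up)"] by (simp add: X Y)
    finally show ?thesis using cut by (simp add: Let_def)
  next
    case left
    have "up = [] \<longrightarrow> length (sem A (fill (left_fill k B K))) = 1" using upA up_ne by blast
    then have "fst (locate A up off (left_fill k B K) x y d) =
      Suc (last (take d (?lcp A up off (left_fill k B K) x y)))"
      using left prems by (intro TMerge.IH(1)) (auto simp: cluster_nums_left)
    with left show ?thesis by (simp add: Let_def e)
  next
    \<comment> \<open>The two clusters share only their top boundary node, which is therefore the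
      nearest common ancestor.\<close>
    case split
    have "\<exists>X Y. fst (entry ?M up off K x) = X @ up \<and> fst (entry ?M up off K y) = Y @ up \<and> set X \<inter> set Y = {}"
    proof -
      have *: "\<exists>X Y. fst (entry ?M up off K x) = X @ up \<and> fst (entry ?M up off K y) = Y @ up \<and> set X \<inter> set Y = {}"
        if "?r x" "\<not> ?r y" "x \<in> cluster_nums ?M off ?s" "y \<in> cluster_nums ?M off ?s" for x y
        using that split fst_entry[of x B ?st "right_fill k K" up] fst_entry[of y A off "left_fill k B K" up]
        by (fastforce simp: cluster_nums_right cluster_nums_left entry_TMerge right_up_def)
      show ?thesis using *[of x y] *[of y x] split prems(1,2) by blast
    qed
    then obtain X Y where XY: "fst (entry ?M up off K x) = X @ up" "fst (entry ?M up off K y) = Y @ up"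
      "set X \<inter> set Y = {}" by blast
    then have "?lcp ?M up off K x y = rev up" by (simp add: lcp_append_same lcp_disjoint)
    moreover have "parent_code up = Suc (last (rev up))"
      using up_ne[OF split(2)] by (cases up) (auto simp: parent_code_def)
    ultimately show ?thesis using split prems(4) by (auto simp: Let_def)
  next
    case xy
    have "fst (locate A up off (left_fill k B K) (?st - 1) y d) =
      Suc (last (take d (?lcp A up off (left_fill k B K) (?st - 1) y)))"
      using xy prems upA holeA hole
      by (intro TMerge.IH(1)) (auto simp: cluster_nums_left[of y] simp del: One_nat_def)
    with xy prems show ?thesis by (simp add: Let_def lcp_ancestors_hole hole del: One_nat_def)
  next
    case yx
    have "fst (locate A up off (left_fill k B K) x (?st - 1) d) =
      Suc (last (take d (?lcp A up off (left_fill k B K) x (?st - 1))))"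
      using yx prems upA holeA hole
      by (intro TMerge.IH(1)) (auto simp: cluster_nums_left[of x] simp del: One_nat_def)
    also have "\<dots> = Suc (last (take d (?lcp ?M up off K y x)))"
      using yx prems by (simp add: lcp_ancestors_hole hole lcp_commute[of "rev (fst (entry A _ _ _ x))"]
          del: One_nat_def)
    finally show ?thesis
      using yx by (simp add: Let_def lcp_commute[of "rev (fst (entry (TMerge k A B) _ _ _ x))"])
  qed
qed

text \<open>The returned position is that of the found node \<open>z\<close>, which may differ from
  \<open>x\<close> and \<open>y\<close>; so its ancestors, label and subtree can be read
  off.\<close>

lemma locate_entry:
  assumes "x \<in> cluster_nums c off (fill_size K)" "y \<in> cluster_nums c off (fill_size K)"
    and "locate c up off K x y d = (Suc z, Some (up', b, K'))"
  shows "z \<in> cluster_nums c off (fill_size K)" "entry c up off K z = (z # up', Node b (fill K'))"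
  using assms
proof (induction c arbitrary: up off K x y)
  case (TEdge a b)
  { case 1 then show ?case by (auto simp: cluster_nums_def) }
  { case 2 then show ?case by (auto simp: entry_def) }
next
  case (TMerge k A B)
  have hole: "right_start k A off (fill_size K) - 1 \<in> cluster_nums A off s" if "vertical k"
    for off s and K :: "'a top_tree list"
    using that hole_cluster_nums[of off A s] by (simp add: right_start_def)
  have *: "(z \<in> cluster_nums B (right_start k A off (fill_size K)) (fill_size (right_fill k K)) \<and>
        entry B (right_up k A off up) (right_start k A off (fill_size K)) (right_fill k K) z =
          (z # up', Node b (fill K'))) \<or>
      (z \<in> cluster_nums A off (fill_size (left_fill k B K)) \<and>
        entry A up off (left_fill k B K) z = (z # up', Node b (fill K')))"
    if x: "x \<in> cluster_nums (TMerge k A B) off (fill_size K)"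
      and y: "y \<in> cluster_nums (TMerge k A B) off (fill_size K)"
      and l: "locate (TMerge k A B) up off K x y d = (Suc z, Some (up', b, K'))"
    for up off K x y
  proof -
    let ?r = "in_right k A B off (fill_size K)"
    let ?st = "right_start k A off (fill_size K)"
    show ?thesis
    proof (cases "?r x \<and> ?r y \<and> (vertical k \<longrightarrow> length up + hole_depth A < d)")
      case True
      with l have "locate B (right_up k A off up) ?st (right_fill k K) x y d = (Suc z, Some (up', b, K'))"
        by (simp add: Let_def)
      moreover have "x \<in> cluster_nums B ?st (fill_size (right_fill k K))"
        "y \<in> cluster_nums B ?st (fill_size (right_fill k K))"
        using x y True by (simp_all add: cluster_nums_right)
      ultimately show ?thesis using TMerge.IH(3,4) by blast
    next
      case False
      let ?x = "if ?r x then ?st - 1 else x" and ?y = "if ?r y then ?st - 1 else y"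
      from False l have c: "vertical k \<or> \<not> ?r x \<and> \<not> ?r y"
        and "locate A up off (left_fill k B K) ?x ?y d = (Suc z, Some (up', b, K'))"
        unfolding locate.simps Let_def by (auto split: if_split_asm)
      moreover have "?x \<in> cluster_nums A off (fill_size (left_fill k B K))"
        "?y \<in> cluster_nums A off (fill_size (left_fill k B K))"
        using x y c hole by (auto simp: cluster_nums_left[of x] cluster_nums_left[of y] simp del: One_nat_def)
      ultimately show ?thesis using TMerge.IH(1,2) by blast
    qed
  qed
  { case 1 from *[OF this] show ?case by (auto simp: cluster_nums_left cluster_nums_right) }
  { case 2 from *[OF this] show ?case by (auto simp: cluster_nums_left cluster_nums_right entry_TMerge) }
qed

text \<open>The search stops before reaching an edge only when it separates \<open>x\<close> from
  \<open>y\<close>.\<close>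

lemma locate_None: "locate c up off K x x d \<noteq> (z, None)"
  by (induction c arbitrary: up off K x) (auto simp: Let_def)

section \<open>A structured language for the word RAM\<close>

datatype var = VX | VY | VD | VC | VKind | VOff | VBelow | VHeight | VDepth | VUp | VFill | VHeap | VRes
  | VSt | VEn | VRx | VRy | VE | VS

text \<open>\<open>start\<close> passes the arguments in registers 0 and 1, hence the numbers of
  \<open>VX\<close> and \<open>VY\<close>.\<close>

primrec reg_of :: "var \<Rightarrow> nat" where
  "reg_of VX = 0" | "reg_of VY = 1" | "reg_of VD = 2" | "reg_of VC = 3" | "reg_of VKind = 4"
| "reg_of VOff = 5" | "reg_of VBelow = 6" | "reg_of VHeight = 7" | "reg_of VDepth = 8" | "reg_of VUp = 9"
| "reg_of VFill = 10" | "reg_of VHeap = 11" | "reg_of VRes = 12" | "reg_of VSt = 13" | "reg_of VEn = 14"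
| "reg_of VRx = 15" | "reg_of VRy = 16" | "reg_of VE = 17" | "reg_of VS = 18"

text \<open>Registers from here on hold intermediate results; any number above those of the
  variables would do.\<close>

definition temp :: nat where "temp = 20"

lemma reg_of_less: "reg_of v < temp"
  by (cases v) (simp_all add: temp_def)

lemma reg_of_eq_iff [simp]: "reg_of u = reg_of v \<longleftrightarrow> u = v"
  by (cases u; cases v; simp)

datatype exp = Num nat | Var var | Mem exp | Plus exp exp | Minus exp exp | Times exp exp
  | Lt exp exp | Eq exp exp

datatype com = Assign var exp | Write exp exp | Out exp | Seq com com | Cond exp com com | While exp com

fun val :: "exp \<Rightarrow> (var \<Rightarrow> nat) \<Rightarrow> (nat \<Rightarrow> nat) \<Rightarrow> nat" where
  "val (Num k) \<sigma> m = k"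
| "val (Var v) \<sigma> m = \<sigma> v"
| "val (Mem e) \<sigma> m = m (val e \<sigma> m)"
| "val (Plus e f) \<sigma> m = val e \<sigma> m + val f \<sigma> m"
| "val (Minus e f) \<sigma> m = val e \<sigma> m - val f \<sigma> m"
| "val (Times e f) \<sigma> m = val e \<sigma> m * val f \<sigma> m"
| "val (Lt e f) \<sigma> m = of_bool (val e \<sigma> m < val f \<sigma> m)"
| "val (Eq e f) \<sigma> m = of_bool (val e \<sigma> m = val f \<sigma> m)"

text \<open>No overflow occurs in the evaluation.\<close>

fun safe :: "nat \<Rightarrow> exp \<Rightarrow> (var \<Rightarrow> nat) \<Rightarrow> (nat \<Rightarrow> nat) \<Rightarrow> bool" where
  "safe w (Num k) \<sigma> m \<longleftrightarrow> k < 2 ^ w"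
| "safe w (Var v) \<sigma> m \<longleftrightarrow> True"
| "safe w (Mem e) \<sigma> m \<longleftrightarrow> safe w e \<sigma> m"
| "safe w (Plus e f) \<sigma> m \<longleftrightarrow> safe w e \<sigma> m \<and> safe w f \<sigma> m \<and> val e \<sigma> m + val f \<sigma> m < 2 ^ w"
| "safe w (Minus e f) \<sigma> m \<longleftrightarrow> safe w e \<sigma> m \<and> safe w f \<sigma> m \<and> val f \<sigma> m \<le> val e \<sigma> m \<and> val e \<sigma> m < 2 ^ w"
| "safe w (Times e f) \<sigma> m \<longleftrightarrow> safe w e \<sigma> m \<and> safe w f \<sigma> m \<and> val e \<sigma> m * val f \<sigma> m < 2 ^ w"
| "safe w (Lt e f) \<sigma> m \<longleftrightarrow> safe w e \<sigma> m \<and> safe w f \<sigma> m"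
| "safe w (Eq e f) \<sigma> m \<longleftrightarrow> safe w e \<sigma> m \<and> safe w f \<sigma> m"

type_synonym pred = "(var \<Rightarrow> nat) \<Rightarrow> (nat \<Rightarrow> nat) \<Rightarrow> nat list \<Rightarrow> nat \<Rightarrow> bool"

text \<open>Weakest preconditions for total correctness without overflow. The last argument of the predicates
  counts the loop iterations; up to a factor depending on the program, this is the running time.\<close>

primrec wp :: "nat \<Rightarrow> com \<Rightarrow> pred \<Rightarrow> pred" where
  "wp w (Assign v e) = (\<lambda>Q \<sigma> m out t. safe w e \<sigma> m \<and> Q (\<sigma>(v := val e \<sigma> m)) m out t)"
| "wp w (Write e f) = (\<lambda>Q \<sigma> m out t. safe w e \<sigma> m \<and> safe w f \<sigma> m \<and>
     Q \<sigma> (m(val e \<sigma> m := val f \<sigma> m)) out t)"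
| "wp w (Out e) = (\<lambda>Q \<sigma> m out t. safe w e \<sigma> m \<and> Q \<sigma> m (out @ [val e \<sigma> m]) t)"
| "wp w (Seq c d) = (\<lambda>Q. wp w c (wp w d Q))"
| "wp w (Cond e c d) = (\<lambda>Q \<sigma> m out t. safe w e \<sigma> m \<and>
     (if val e \<sigma> m \<noteq> 0 then wp w c Q \<sigma> m out t else wp w d Q \<sigma> m out t))"
| "wp w (While e c) = (\<lambda>Q. lfp (\<lambda>X \<sigma> m out t. safe w e \<sigma> m \<and>
     (if val e \<sigma> m \<noteq> 0 then wp w c X \<sigma> m out (Suc t) else Q \<sigma> m out t)))"

lemma wp_mono: "Q \<le> R \<Longrightarrow> wp w c Q \<le> wp w c R"
proof (induction c arbitrary: Q R)
  case (Seq c d)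
  from Seq.IH(1)[OF Seq.IH(2)[OF Seq.prems]] show ?case by simp
next
  case (Cond e c d)
  then have "wp w c Q \<le> wp w c R" "wp w d Q \<le> wp w d R" by auto
  then show ?case by (auto simp: le_fun_def)
next
  case (While e c)
  then show ?case
    unfolding wp.simps by (intro lfp_mono) (auto simp: le_fun_def)
qed (auto simp: le_fun_def)

text \<open>The unfolding rule. Loops are later treated by induction on the current cluster or on
  the pending work, for which this rule takes the place of one with invariants.\<close>

lemma wp_While:
  "wp w (While e c) Q \<sigma> m out t \<longleftrightarrow> safe w e \<sigma> m \<and>
    (if val e \<sigma> m \<noteq> 0 then wp w c (wp w (While e c) Q) \<sigma> m out (Suc t) else Q \<sigma> m out t)"
proof -
  let ?F = "\<lambda>X \<sigma> m out t. safe w e \<sigma> m \<and>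
     (if val e \<sigma> m \<noteq> 0 then wp w c X \<sigma> m out (Suc t) else Q \<sigma> m out t)"
  have "mono ?F"
  proof (rule monoI)
    fix X Y :: pred assume "X \<le> Y"
    from wp_mono[OF this, of w c] show "?F X \<le> ?F Y" by (simp add: le_fun_def)
  qed
  from fun_cong[OF fun_cong[OF fun_cong[OF fun_cong[OF lfp_unfold[OF this]]]], of \<sigma> m out t]
  show ?thesis unfolding wp.simps .
qed

declare wp.simps(6) [simp del]

text \<open>The registers from \<open>r\<close> on serve as a stack. The machine has no move
  instruction, so a register is copied by combining it with 0; \<open>BitOr\<close> does this
  exactly for any contents, as it does not reduce modulo \<open>2 ^ w\<close>.\<close>

fun compile_exp :: "exp \<Rightarrow> nat \<Rightarrow> instr list" where
  "compile_exp (Num k) r = [Const r k]"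
| "compile_exp (Var v) r = [Const r 0, Op BitOr r r (reg_of v)]"
| "compile_exp (Mem e) r = compile_exp e r @ [Load r r]"
| "compile_exp (Plus e f) r = compile_exp e r @ compile_exp f (Suc r) @ [Op Add r r (Suc r)]"
| "compile_exp (Minus e f) r = compile_exp e r @ compile_exp f (Suc r) @ [Op Sub r r (Suc r)]"
| "compile_exp (Times e f) r = compile_exp e r @ compile_exp f (Suc r) @ [Op Mul r r (Suc r)]"
| "compile_exp (Lt e f) r = compile_exp e r @ compile_exp f (Suc r) @ [Op Less r r (Suc r)]"
| "compile_exp (Eq e f) r = compile_exp e r @ compile_exp f (Suc r) @ [Op Equal r r (Suc r)]"

fun compile :: "nat \<Rightarrow> com \<Rightarrow> instr list" where
  "compile b (Assign v e) = compile_exp e temp @ [Const (reg_of v) 0, Op BitOr (reg_of v) (reg_of v) temp]"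
| "compile b (Write e f) = compile_exp e temp @ compile_exp f (Suc temp) @ [Store temp (Suc temp)]"
| "compile b (Out e) = compile_exp e temp @ [Output temp]"
| "compile b (Seq c d) = (let p = compile b c in p @ compile (b + length p) d)"
| "compile b (Cond e c d) =
     (let p = compile_exp e temp; b1 = b + length p + 1; q = compile b1 c; b2 = b1 + length q + 1;
          r = compile b2 d
      in p @ [JumpZero temp b2] @ q @ [Jump (b2 + length r)] @ r)"
| "compile b (While e c) =
     (let p = compile_exp e temp; b1 = b + length p + 1; q = compile b1 c
      in p @ [JumpZero temp (b1 + length q + 1)] @ q @ [Jump b])"

section \<open>Correctness and running time of compiled programs\<close>

fun code_at :: "program \<Rightarrow> nat \<Rightarrow> instr list \<Rightarrow> bool" where
  "code_at P b [] \<longleftrightarrow> b \<le> length P"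
| "code_at P b (i # p) \<longleftrightarrow> b < length P \<and> P ! b = i \<and> code_at P (Suc b) p"

lemma code_at_append: "code_at P b (p @ q) \<longleftrightarrow> code_at P b p \<and> code_at P (b + length p) q"
proof -
  have le: "code_at P b q \<Longrightarrow> b \<le> length P" for b q by (cases q) auto
  show ?thesis by (induction p arbitrary: b) (auto dest: le)
qed

lemma code_at_self: "code_at (p @ q) (length p) q"
proof (induction q arbitrary: p)
  case (Cons i q)
  from Cons[of "p @ [i]"] show ?case by simp
qed simp

lemma step_code_at: "pc s < length P \<and> P ! pc s = i \<Longrightarrow> step w P s = exec w i s"
  by (simp add: step_def halted_def)

lemma funpow_step_add: "(step w P ^^ (m + n)) s = (step w P ^^ n) ((step w P ^^ m) s)"
  by (subst add.commute) (simp only: funpow_add comp_apply)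

definition computes :: "nat \<Rightarrow> program \<Rightarrow> config \<Rightarrow> nat \<Rightarrow> nat \<Rightarrow> nat \<Rightarrow> bool" where
  "computes w P s n r k \<longleftrightarrow> (let s' = (step w P ^^ n) s in
     pc s' = pc s + n \<and> regs s' r = k \<and> (\<forall>q<r. regs s' q = regs s q) \<and> mem s' = mem s \<and> outp s' = outp s)"

lemma computes_binop:
  assumes "computes w P s n r k" "computes w P ((step w P ^^ n) s) n' (Suc r) k'"
    and "code_at P (pc s + (n + n')) [Op f r r (Suc r)]" "eval_binop w f k k' = l"
  shows "computes w P s (n + n' + 1) r l"
proof -
  let ?s = "(step w P ^^ n') ((step w P ^^ n) s)"
  have "pc ?s = pc s + (n + n')" using assms(1,2) by (simp add: computes_def Let_def)
  then have "step w P ?s = exec w (Op f r r (Suc r)) ?s"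
    using assms(3) by (intro step_code_at) simp
  moreover have "(step w P ^^ (n + n' + 1)) s = step w P ?s"
    by (simp add: funpow_step_add)
  ultimately show ?thesis
    using assms(1,2,4) by (auto simp: computes_def Let_def)
qed

lemma computes_compile_exp:
  assumes "0 < w" "safe w e \<sigma> m" "code_at P (pc s) (compile_exp e r)" "temp \<le> r"
    and "\<forall>v. regs s (reg_of v) = \<sigma> v" "mem s = m"
  shows "computes w P s (length (compile_exp e r)) r (val e \<sigma> m)"
proof -
  \<comment> \<open>Generalized over target register and configuration, since the second operand is
    evaluated from a later configuration into the next register.\<close>
  define ok where "ok e \<longleftrightarrow> (\<forall>r (s :: config). safe w e \<sigma> m \<longrightarrow> code_at P (pc s) (compile_exp e r) \<longrightarrow> temp \<le> r \<longrightarrow>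
    (\<forall>v. regs s (reg_of v) = \<sigma> v) \<longrightarrow> mem s = m \<longrightarrow>
    computes w P s (length (compile_exp e r)) r (val e \<sigma> m))" for e
  have binop: "ok h"
    if e: "ok e" and f: "ok f" and safe: "safe w h \<sigma> m \<Longrightarrow> safe w e \<sigma> m \<and> safe w f \<sigma> m"
      and code: "\<And>r. compile_exp h r = compile_exp e r @ compile_exp f (Suc r) @ [Op g r r (Suc r)]"
      and eval: "safe w h \<sigma> m \<Longrightarrow> eval_binop w g (val e \<sigma> m) (val f \<sigma> m) = val h \<sigma> m"
    for e f g h
    unfolding ok_def
  proof (intro allI impI)
    fix r and s :: config
    assume h: "safe w h \<sigma> m" "code_at P (pc s) (compile_exp h r)" "temp \<le> r"
      "\<forall>v. regs s (reg_of v) = \<sigma> v" "mem s = m"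
    let ?n = "length (compile_exp e r)"
    let ?n' = "length (compile_exp f (Suc r))"
    let ?s = "(step w P ^^ ?n) s"
    have E: "computes w P s ?n r (val e \<sigma> m)"
      using e h safe by (simp add: ok_def code code_at_append)
    have "regs ?s (reg_of v) = \<sigma> v" for v
      using E h(3,4) reg_of_less[of v] by (simp add: computes_def Let_def)
    then have F: "computes w P ?s ?n' (Suc r) (val f \<sigma> m)"
      using E f h safe by (simp add: ok_def code code_at_append computes_def Let_def)
    show "computes w P s (length (compile_exp h r)) r (val h \<sigma> m)"
      using computes_binop[OF E F] h eval by (simp add: code code_at_append add_ac)
  qed
  have "ok e"
  proof (induction e)
    case (Num k)
    have "step w P s = exec w (Const r k) s" if "pc s < length P" "P ! pc s = Const r k" for r s
      using that by (intro step_code_at) simp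
    then show ?case by (simp add: ok_def computes_def)
  next
    case (Var v)
    show ?case
      unfolding ok_def
    proof (intro allI impI)
      fix r and s :: config
      assume h: "code_at P (pc s) (compile_exp (Var v) r)" "temp \<le> r" "\<forall>v. regs s (reg_of v) = \<sigma> v" "mem s = m"
      then have "reg_of v \<noteq> r" using reg_of_less[of v] by linarith
      let ?s = "exec w (Const r 0) s"
      have "step w P s = ?s" using h by (intro step_code_at) simp
      moreover have "step w P ?s = exec w (Op BitOr r r (reg_of v)) ?s"
        using h by (intro step_code_at) simp
      ultimately show "computes w P s (length (compile_exp (Var v) r)) r (val (Var v) \<sigma> m)"
        using h \<open>reg_of v \<noteq> r\<close> by (simp add: computes_def numeral_2_eq_2)
    qed
  next
    case (Mem e)
    show ?case
      unfolding ok_def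
    proof (intro allI impI)
      fix r and s :: config
      assume h: "safe w (Mem e) \<sigma> m" "code_at P (pc s) (compile_exp (Mem e) r)" "temp \<le> r"
        "\<forall>v. regs s (reg_of v) = \<sigma> v" "mem s = m"
      let ?n = "length (compile_exp e r)"
      let ?s = "(step w P ^^ ?n) s"
      have c: "computes w P s ?n r (val e \<sigma> m)" using Mem h by (simp add: ok_def code_at_append)
      then have "step w P ?s = exec w (Load r r) ?s"
        using h by (intro step_code_at) (simp add: code_at_append computes_def Let_def)
      with c h show "computes w P s (length (compile_exp (Mem e) r)) r (val (Mem e) \<sigma> m)"
        by (auto simp: computes_def Let_def)
    qed
  next
    case (Plus e f)
    show ?case by (rule binop[OF Plus, where g = Add]) auto
  next
    case (Minus e f)
    have sub: "(x + 2 ^ w - y) mod 2 ^ w = x - y" if "y \<le> x" "x < 2 ^ w" for x y :: nat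
    proof -
      have "x + 2 ^ w - y = x - y + 2 ^ w" using that by simp
      then show ?thesis using that by (simp only: mod_add_self2) (simp add: less_imp_diff_less)
    qed
    show ?case by (rule binop[OF Minus, where g = Sub]) (simp_all add: sub)
  next
    case (Times e f)
    show ?case by (rule binop[OF Times, where g = Mul]) auto
  next
    case (Lt e f)
    show ?case by (rule binop[OF Lt, where g = Less]) (use assms(1) in auto)
  next
    case (Eq e f)
    show ?case by (rule binop[OF Eq, where g = Equal]) (use assms(1) in auto)
  qed
  with assms show ?thesis by (simp add: ok_def)
qed

definition represents :: "config \<Rightarrow> nat \<Rightarrow> (var \<Rightarrow> nat) \<Rightarrow> (nat \<Rightarrow> nat) \<Rightarrow> nat list \<Rightarrow> bool" where
  "represents s b \<sigma> m out \<longleftrightarrow> pc s = b \<and> (\<forall>v. regs s (reg_of v) = \<sigma> v) \<and> mem s = m \<and> outp s = out"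

lemma represents_compile_exp:
  assumes "0 < w" "represents s b \<sigma> m out" "safe w e \<sigma> m" "code_at P b (compile_exp e r)" "temp \<le> r"
  shows "represents ((step w P ^^ length (compile_exp e r)) s) (b + length (compile_exp e r)) \<sigma> m out"
    and "regs ((step w P ^^ length (compile_exp e r)) s) r = val e \<sigma> m"
    and "q < r \<Longrightarrow> regs ((step w P ^^ length (compile_exp e r)) s) q = regs s q"
proof -
  have c: "computes w P s (length (compile_exp e r)) r (val e \<sigma> m)"
    using assms by (intro computes_compile_exp) (auto simp: represents_def)
  then show "regs ((step w P ^^ length (compile_exp e r)) s) r = val e \<sigma> m"
    "q < r \<Longrightarrow> regs ((step w P ^^ length (compile_exp e r)) s) q = regs s q"
    by (simp_all add: computes_def Let_def)
  have "reg_of v < r" for v using reg_of_less[of v] assms(5) by linarith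
  with c assms(2) show "represents ((step w P ^^ length (compile_exp e r)) s) (b + length (compile_exp e r)) \<sigma> m out"
    by (simp add: computes_def Let_def represents_def)
qed

lemma step_represents: "represents s b \<sigma> m out \<Longrightarrow> b < length P \<and> P ! b = i \<Longrightarrow> step w P s = exec w i s"
  by (intro step_code_at) (simp add: represents_def)

text \<open>Every instruction of a program is executed at most once per loop iteration, and once more.\<close>

definition reaches :: "nat \<Rightarrow> program \<Rightarrow> config \<Rightarrow> nat \<Rightarrow> nat \<Rightarrow> pred \<Rightarrow> nat \<Rightarrow> bool" where
  "reaches w P s len b Q t \<longleftrightarrow> (\<exists>n i \<sigma> m out. represents ((step w P ^^ n) s) b \<sigma> m out \<and>
     Q \<sigma> m out (t + i) \<and> n \<le> Suc i * len)"

lemma reachesI: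
  "represents ((step w P ^^ n) s) b \<sigma> m out \<Longrightarrow> Q \<sigma> m out (t + i) \<Longrightarrow> n \<le> Suc i * len \<Longrightarrow>
   reaches w P s len b Q t"
  unfolding reaches_def by blast

text \<open>Induction on the command. The bounds add up because
  \<open>Suc i * l + Suc i' * l' \<le> Suc (i + i') * (l + l')\<close>; a loop pays for each pass
  with one more iteration in the count.\<close>

lemma wp_sound:
  assumes "0 < w"
  shows "wp w c Q \<sigma> m out t \<Longrightarrow> represents s b \<sigma> m out \<Longrightarrow> code_at P b (compile b c) \<Longrightarrow>
    reaches w P s (length (compile b c)) (b + length (compile b c)) Q t"
proof (induction c arbitrary: Q \<sigma> m out t s b)
  case (Assign v e)
  let ?n = "length (compile_exp e temp)"
  let ?s = "(step w P ^^ ?n) s"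
  note e = represents_compile_exp[OF assms Assign(2), of e P temp]
  have code: "code_at P b (compile_exp e temp)" "code_at P (b + ?n) [Const (reg_of v) 0, Op BitOr (reg_of v) (reg_of v) temp]"
    using Assign by (simp_all add: code_at_append)
  let ?s' = "exec w (Op BitOr (reg_of v) (reg_of v) temp) (exec w (Const (reg_of v) 0) ?s)"
  have 1: "step w P ?s = exec w (Const (reg_of v) 0) ?s"
    using e code Assign.prems by (intro step_represents) auto
  have 2: "step w P (exec w (Const (reg_of v) 0) ?s) = ?s'"
    using e(1) code Assign by (intro step_code_at) (auto simp: represents_def)
  have "(step w P ^^ (?n + 2)) s = ?s'"
    by (simp only: funpow_step_add numeral_2_eq_2 funpow.simps comp_apply id_apply 1 2)
  moreover have "represents ?s' (b + (?n + 2)) (\<sigma>(v := val e \<sigma> m)) m out"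
    using e code(1) Assign reg_of_less[of v] by (auto simp: represents_def)
  ultimately have r: "represents ((step w P ^^ (?n + 2)) s) (b + (?n + 2)) (\<sigma>(v := val e \<sigma> m)) m out"
    by (simp only:)
  have len: "length (compile b (Assign v e)) = ?n + 2" by simp
  show ?case
    unfolding len by (rule reachesI[OF r, where i = 0]) (use Assign.prems(1) in \<open>simp_all add: fun_upd_def\<close>)
next
  case (Write e f)
  let ?n = "length (compile_exp e temp)" and ?n' = "length (compile_exp f (Suc temp))"
  let ?s = "(step w P ^^ ?n) s"
  let ?s' = "(step w P ^^ ?n') ?s"
  have code: "code_at P b (compile_exp e temp)" "code_at P (b + ?n) (compile_exp f (Suc temp))"
     "code_at P (b + ?n + ?n') [Store temp (Suc temp)]"
    using Write by (simp_all add: code_at_append add_ac)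
  note e = represents_compile_exp[OF assms Write(2) _ code(1)]
  note f = represents_compile_exp[OF assms e(1) _ code(2)]
  have "step w P ?s' = exec w (Store temp (Suc temp)) ?s'"
    using f(1) code Write by (intro step_represents) auto
  then have "(step w P ^^ (?n + ?n' + 1)) s = exec w (Store temp (Suc temp)) ?s'"
    by (simp only: funpow_step_add One_nat_def funpow.simps comp_apply id_apply)
  moreover have "represents (exec w (Store temp (Suc temp)) ?s') (b + (?n + ?n' + 1)) \<sigma> (m(val e \<sigma> m := val f \<sigma> m)) out"
    using e(2) f Write by (auto simp: represents_def)
  ultimately have r: "represents ((step w P ^^ (?n + ?n' + 1)) s) (b + (?n + ?n' + 1)) \<sigma>
      (m(val e \<sigma> m := val f \<sigma> m)) out"
    by (simp only:)
  have len: "length (compile b (Write e f)) = ?n + ?n' + 1" by simp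
  show ?case
    unfolding len by (rule reachesI[OF r, where i = 0]) (use Write.prems(1) in \<open>simp_all add: fun_upd_def\<close>)
next
  case (Out e)
  let ?n = "length (compile_exp e temp)"
  let ?s = "(step w P ^^ ?n) s"
  have code: "code_at P b (compile_exp e temp)" "code_at P (b + ?n) [Output temp]"
    using Out by (simp_all add: code_at_append)
  note e = represents_compile_exp[OF assms Out(2) _ code(1)]
  have "step w P ?s = exec w (Output temp) ?s"
    using e code Out by (intro step_represents) auto
  then have "(step w P ^^ (?n + 1)) s = exec w (Output temp) ?s"
    by (simp only: funpow_step_add One_nat_def funpow.simps comp_apply id_apply)
  moreover have "represents (exec w (Output temp) ?s) (b + (?n + 1)) \<sigma> m (out @ [val e \<sigma> m])"
    using e Out by (auto simp: represents_def)
  ultimately have r: "represents ((step w P ^^ (?n + 1)) s) (b + (?n + 1)) \<sigma> m (out @ [val e \<sigma> m])"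
    by (simp only:)
  have len: "length (compile b (Out e)) = ?n + 1" by simp
  show ?case
    unfolding len by (rule reachesI[OF r, where i = 0]) (use Out.prems(1) in simp_all)
next
  case (Seq c d)
  let ?lc = "length (compile b c)" and ?ld = "length (compile (b + length (compile b c)) d)"
  have code: "code_at P b (compile b c)" "code_at P (b + ?lc) (compile (b + ?lc) d)"
    using Seq.prems by (simp_all add: code_at_append Let_def)
  have "reaches w P s ?lc (b + ?lc) (wp w d Q) t"
    using Seq code by simp
  then obtain n i \<sigma>' m' out' where n: "represents ((step w P ^^ n) s) (b + ?lc) \<sigma>' m' out'"
    "wp w d Q \<sigma>' m' out' (t + i)" "n \<le> Suc i * ?lc"
    by (auto simp: reaches_def)
  from Seq.IH(2)[OF n(2,1) code(2)]
  obtain n' i' \<sigma>'' m'' out'' where n':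
    "represents ((step w P ^^ n') ((step w P ^^ n) s)) (b + ?lc + ?ld) \<sigma>'' m'' out''"
    "Q \<sigma>'' m'' out'' (t + i + i')" "n' \<le> Suc i' * ?ld"
    by (auto simp: reaches_def)
  have "n + n' \<le> Suc (i + i') * (?lc + ?ld)"
    using n(3) n'(3) by (simp add: algebra_simps)
  moreover have "represents ((step w P ^^ (n + n')) s) (b + (?lc + ?ld)) \<sigma>'' m'' out''"
    using n'(1) by (simp only: funpow_step_add add.assoc)
  moreover have "length (compile b (Seq c d)) = ?lc + ?ld" by (simp add: Let_def)
  ultimately show ?case using n'(2) by (simp only: reachesI add.assoc)
next
  case (Cond e c d)
  let ?n = "length (compile_exp e temp)"
  let ?b1 = "b + ?n + 1"
  let ?lc = "length (compile ?b1 c)"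
  let ?b2 = "?b1 + ?lc + 1"
  let ?ld = "length (compile ?b2 d)"
  let ?L = "?n + 1 + ?lc + 1 + ?ld"
  let ?s = "(step w P ^^ ?n) s"
  have len: "length (compile b (Cond e c d)) = ?L" by (simp add: Let_def)
  have code: "code_at P b (compile_exp e temp)" "code_at P (b + ?n) [JumpZero temp ?b2]"
    "code_at P ?b1 (compile ?b1 c)" "code_at P (?b1 + ?lc) [Jump (?b2 + ?ld)]" "code_at P ?b2 (compile ?b2 d)"
    using Cond.prems by (simp_all add: code_at_append Let_def add_ac)
  note e = represents_compile_exp[OF assms Cond.prems(2) _ code(1)]
  have safe: "safe w e \<sigma> m" using Cond.prems by simp
  let ?s' = "exec w (JumpZero temp ?b2) ?s"
  have "step w P ?s = ?s'"
    using e safe code by (intro step_represents) auto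
  then have s': "(step w P ^^ (?n + 1)) s = ?s'"
    by (simp only: funpow_step_add One_nat_def funpow.simps comp_apply id_apply)
  show ?case
  proof (cases "val e \<sigma> m = 0")
    case True
    have "represents ?s' ?b2 \<sigma> m out" using e safe True by (auto simp: represents_def)
    from Cond.IH(2)[OF _ this code(5), of Q t] Cond.prems(1) True
    obtain n i \<sigma>' m' out' where n: "represents ((step w P ^^ n) ?s') (?b2 + ?ld) \<sigma>' m' out'"
      "Q \<sigma>' m' out' (t + i)" "n \<le> Suc i * ?ld"
      by (auto simp: reaches_def)
    have "represents ((step w P ^^ (?n + 1 + n)) s) (b + ?L) \<sigma>' m' out'"
      using n(1) unfolding funpow_step_add[where m = "?n + 1"] s' by (simp add: add_ac)
    moreover have "?n + 1 + n \<le> Suc i * ?L" using n(3) by (simp add: algebra_simps)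
    ultimately show ?thesis using n(2) unfolding reaches_def len by blast
  next
    case False
    have "represents ?s' ?b1 \<sigma> m out" using e safe False by (auto simp: represents_def)
    from Cond.IH(1)[OF _ this code(3), of Q t] Cond.prems(1) False
    obtain n i \<sigma>' m' out' where n: "represents ((step w P ^^ n) ?s') (?b1 + ?lc) \<sigma>' m' out'"
      "Q \<sigma>' m' out' (t + i)" "n \<le> Suc i * ?lc"
      by (auto simp: reaches_def)
    have "step w P ((step w P ^^ n) ?s') = exec w (Jump (?b2 + ?ld)) ((step w P ^^ n) ?s')"
      using n(1) code(4) by (intro step_represents) auto
    then have "represents ((step w P ^^ (?n + 1 + (n + 1))) s) (b + ?L) \<sigma>' m' out'"
      using n(1) unfolding funpow_step_add[where m = "?n + 1"] funpow_step_add[where m = n] s'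
      by (simp add: represents_def add_ac)
    moreover have "?n + 1 + (n + 1) \<le> Suc i * ?L" using n(3) by (simp add: algebra_simps)
    ultimately show ?thesis using n(2) unfolding reaches_def len by blast
  qed
next
  case (While e c)
  let ?n = "length (compile_exp e temp)"
  let ?b1 = "b + ?n + 1"
  let ?lc = "length (compile ?b1 c)"
  let ?L = "?n + 1 + ?lc + 1"
  have len: "length (compile b (While e c)) = ?L" by (simp add: Let_def)
  have code: "code_at P b (compile_exp e temp)" "code_at P (b + ?n) [JumpZero temp (b + ?L)]"
    "code_at P ?b1 (compile ?b1 c)" "code_at P (?b1 + ?lc) [Jump b]"
    using While.prems by (simp_all add: code_at_append Let_def add_ac)
  \<comment> \<open>\<open>R\<close> is closed under one unfolding of the loop, so the least fixed
    point lies below it. This replaces an induction on the number of passes.\<close>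
  define R :: pred where "R = (\<lambda>\<sigma> m out t. \<forall>s. represents s b \<sigma> m out \<longrightarrow> reaches w P s ?L (b + ?L) Q t)"
  have "lfp (\<lambda>X \<sigma> m out t. safe w e \<sigma> m \<and>
     (if val e \<sigma> m \<noteq> 0 then wp w c X \<sigma> m out (Suc t) else Q \<sigma> m out t)) \<le> R"
  proof (intro lfp_lowerbound le_funI le_boolI)
    fix \<sigma> m out t
    assume a: "safe w e \<sigma> m \<and> (if val e \<sigma> m \<noteq> 0 then wp w c R \<sigma> m out (Suc t) else Q \<sigma> m out t)"
    show "R \<sigma> m out t"
      unfolding R_def
    proof (intro allI impI)
      fix s assume s: "represents s b \<sigma> m out"
      let ?s = "(step w P ^^ ?n) s"
      let ?s' = "exec w (JumpZero temp (b + ?L)) ?s"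
      note e = represents_compile_exp[OF assms s _ code(1)]
      have "step w P ?s = ?s'"
        using e a code by (intro step_represents) auto
      then have s': "(step w P ^^ (?n + 1)) s = ?s'"
        by (simp only: funpow_step_add One_nat_def funpow.simps comp_apply id_apply)
      show "reaches w P s ?L (b + ?L) Q t"
      proof (cases "val e \<sigma> m = 0")
        case True
        have "represents ?s' (b + ?L) \<sigma> m out" using e a True by (auto simp: represents_def)
        then have r: "represents ((step w P ^^ (?n + 1)) s) (b + ?L) \<sigma> m out" by (simp only: s')
        show ?thesis by (rule reachesI[OF r, where i = 0]) (use a True in simp_all)
      next
        case False
        have "represents ?s' ?b1 \<sigma> m out" using e a False by (auto simp: represents_def)
        from While.IH[OF _ this code(3), of R "Suc t"] a False
        obtain n i \<sigma>' m' out' where n: "represents ((step w P ^^ n) ?s') (?b1 + ?lc) \<sigma>' m' out'"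
          "R \<sigma>' m' out' (Suc t + i)" "n \<le> Suc i * ?lc"
          by (auto simp: reaches_def)
        let ?s'' = "exec w (Jump b) ((step w P ^^ n) ?s')"
        have "step w P ((step w P ^^ n) ?s') = ?s''"
          using n(1) code(4) by (intro step_represents) auto
        then have s'': "(step w P ^^ (?n + 1 + (n + 1))) s = ?s''"
          unfolding funpow_step_add[where m = "?n + 1"] funpow_step_add[where m = n] s' by simp
        have "represents ?s'' b \<sigma>' m' out'" using n(1) by (simp add: represents_def)
        with n(2) obtain n' i' \<sigma>'' m'' out'' where n': "represents ((step w P ^^ n') ?s'') (b + ?L) \<sigma>'' m'' out''"
          "Q \<sigma>'' m'' out'' (Suc t + i + i')" "n' \<le> Suc i' * ?L"
          unfolding R_def reaches_def by blast
        have "represents ((step w P ^^ (?n + 1 + (n + 1) + n')) s) (b + ?L) \<sigma>'' m'' out''"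
          using n'(1) unfolding funpow_step_add[where m = "?n + 1 + (n + 1)"] s'' .
        moreover have "?n + 1 + (n + 1) + n' \<le> Suc (Suc (i + i')) * ?L"
          using n(3) n'(3) by (simp add: algebra_simps)
        moreover have "Q \<sigma>'' m'' out'' (t + Suc (i + i'))" using n'(2) by (simp add: add.assoc)
        ultimately show ?thesis unfolding reaches_def by blast
      qed
    qed
  qed
  with While.prems(1) have "R \<sigma> m out t" by (auto simp: wp.simps(6) le_fun_def)
  with While.prems(2) show ?case unfolding R_def len by blast
qed

definition initial_vars :: "nat list \<Rightarrow> var \<Rightarrow> nat" where
  "initial_vars args v = (if reg_of v < length args then args ! reg_of v else 0)"

lemma answersI:
  assumes "0 < w"
    and "\<And>m. \<forall>a < length D. m a = D ! a \<Longrightarrow>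
      wp w c (\<lambda>\<sigma> m' out t. out = ans \<and> t \<le> N \<and> (\<forall>a < length D. m' a = D ! a)) (initial_vars args) m [] 0"
    and "real (Suc N * length (compile 0 c)) \<le> \<tau>"
  shows "answers w D (compile 0 c) args \<tau> ans"
  unfolding answers_def
proof (intro allI impI)
  fix m :: "nat \<Rightarrow> nat"
  let ?P = "compile 0 c"
  assume "(\<forall>a. m a < 2 ^ w) \<and> (\<forall>a < length D. m a = D ! a)"
  then have "wp w c (\<lambda>\<sigma> m' out t. out = ans \<and> t \<le> N \<and> (\<forall>a < length D. m' a = D ! a)) (initial_vars args) m [] 0"
    by (intro assms(2)) auto
  moreover have "represents (start args m) 0 (initial_vars args) m []"
    by (simp add: represents_def start_def initial_vars_def)
  moreover have "code_at ?P 0 ?P" using code_at_self[of "[]" ?P] by simp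
  ultimately have "reaches w ?P (start args m) (length ?P) (length ?P)
      (\<lambda>\<sigma> m' out t. out = ans \<and> t \<le> N \<and> (\<forall>a < length D. m' a = D ! a)) 0"
    using wp_sound[OF assms(1), of c _ "initial_vars args" m "[]" 0 "start args m" 0 ?P] by simp
  then obtain n i \<sigma> m' where n: "represents ((step w ?P ^^ n) (start args m)) (length ?P) \<sigma> m' ans"
    "i \<le> N" "\<forall>a < length D. m' a = D ! a" "n \<le> Suc i * length ?P"
    unfolding reaches_def by auto
  have "n \<le> Suc N * length ?P" using n(2,4) by (meson Suc_le_mono le_trans mult_le_mono1)
  then have "real n \<le> \<tau>" using assms(3) by linarith
  with n show "\<exists>t. real t \<le> \<tau> \<and> (let s = (step w ?P ^^ t) (start args m)
      in halted ?P s \<and> outp s = ans \<and> (\<forall>a < length D. mem s a = D ! a))"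
    by (intro exI[of _ n]) (simp add: represents_def halted_def Let_def)
qed

section \<open>The query programs\<close>

notation Assign (infix "::=" 62) and Seq (infixr ";;" 60)

abbreviation "fld i \<equiv> Mem (Plus (Var VC) (Num i))"

text \<open>The vertex of the top DAG at the address in \<open>VC\<close> is described by eight words:
  its kind (0 for an edge, 1 for a vertical merge, 2 for \<^const>\<open>HRight\<close>, 3 for the other merges),
  the addresses of its children \<open>A\<close> and \<open>B\<close> (or the label of the lower endpoint), the number of nodes
  of \<open>A\<close> that precede those of \<open>B\<close>, the size of \<open>B\<close>, the depths of the bottom boundary nodes of \<open>A\<close>
  and \<open>B\<close>, and the height of \<open>B\<close>.\<close>

fun kind :: "'a top_tree \<Rightarrow> nat" where
  "kind (TEdge a b) = 0"
| "kind (TMerge k A B) = (if vertical k then 1 else if k = HRight then 2 else 3)"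

fun vertex_words :: "(nat top_tree \<Rightarrow> nat) \<Rightarrow> nat top_tree \<Rightarrow> nat list" where
  "vertex_words addr (TEdge a b) = [0, b, 0, 0, 0, 0, 0, 0]"
| "vertex_words addr (TMerge k A B) =
     [kind (TMerge k A B), addr A, addr B, if vertical k then pre_size A else csize A,
      csize B, hole_depth A, hole_depth B, cheight B]"

text \<open>The variables \<open>VOff\<close>, \<open>VBelow\<close>, \<open>VHeight\<close>, \<open>VDepth\<close>, \<open>VUp\<close>, \<open>VFill\<close> describe the position of the
  current cluster: the number of its first node, size and height of the forest below its bottom
  boundary node, depth and number (plus 1) of its top boundary node, and the list of clusters that
  fill its hole.\<close>

definition select :: com where
  "select =
    VSt ::= Plus (Var VOff) (Plus (fld 3) (Times (Eq (Var VKind) (Num 3)) (Var VBelow)));;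
    VEn ::= Plus (Var VSt) (Plus (fld 4) (Times (Lt (Var VKind) (Num 3)) (Var VBelow)));;
    VRx ::= Times (Lt (Var VSt) (Plus (Var VX) (Num 1))) (Lt (Var VX) (Var VEn));;
    VRy ::= Times (Lt (Var VSt) (Plus (Var VY) (Num 1))) (Lt (Var VY) (Var VEn));;
    VE ::= Times (Times (Var VRx) (Var VRy))
             (Plus (Lt (Num 1) (Var VKind))
               (Times (Eq (Var VKind) (Num 1)) (Lt (Plus (Var VDepth) (fld 5)) (Var VD))))"

text \<open>The argument is the kind of horizontal merge in which the hole belongs to the other
  child, so that the chosen child has an empty hole. Assigning to \<open>VE\<close> does nothing
  here, as \<open>select\<close> computes it anew.\<close>

definition clear_fill :: "nat \<Rightarrow> com" where
  "clear_fill k = Cond (Eq (Var VKind) (Num k))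
    (VBelow ::= Num 0;; VHeight ::= Num 0;; VFill ::= Num 0) (VE ::= Num 0)"

definition go_right :: com where
  "go_right =
    Cond (Eq (Var VKind) (Num 1)) (VDepth ::= Plus (Var VDepth) (fld 5);; VUp ::= Var VSt) (clear_fill 3);;
    VOff ::= Var VSt;;
    VC ::= fld 2;;
    VKind ::= Mem (Var VC)"

text \<open>Chooses between two values by arithmetic instead of a branch. Both values are evaluated
  in any case, so both must be safe.\<close>

definition blend :: "exp \<Rightarrow> exp \<Rightarrow> exp \<Rightarrow> exp" where
  "blend r e f = Plus (Times r e) (Times (Minus (Num 1) r) f)"

text \<open>For a vertical merge in which the search continues in \<open>A\<close>: \<open>B\<close>
  becomes the head of the list in the hole, and \<open>VSt - 1\<close> is the bottom boundary node
  of \<open>A\<close>. A list cell takes two fresh words, so older lists remain valid.\<close>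

definition push_fill :: com where
  "push_fill =
    VX ::= blend (Var VRx) (Minus (Var VSt) (Num 1)) (Var VX);;
    VY ::= blend (Var VRy) (Minus (Var VSt) (Num 1)) (Var VY);;
    VE ::= Lt (fld 7) (Plus (fld 6) (Var VHeight));;
    VHeight ::= blend (Var VE) (Plus (fld 6) (Var VHeight)) (fld 7);;
    VBelow ::= Plus (Var VBelow) (fld 4);;
    Write (Var VHeap) (fld 2);;
    Write (Plus (Var VHeap) (Num 1)) (Var VFill);;
    VFill ::= Var VHeap;;
    VHeap ::= Plus (Var VHeap) (Num 2)"

definition go_left :: com where
  "go_left =
    Cond (Eq (Var VKind) (Num 1)) push_fill (clear_fill 2);;
    VC ::= fld 1;;
    VKind ::= Mem (Var VC)"

definition descend_body :: com where
  "descend_body =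
    select;;
    Cond (Var VE) go_right
      (Cond (Plus (Eq (Var VKind) (Num 1)) (Eq (Plus (Var VRx) (Var VRy)) (Num 0))) go_left
        (VRes ::= Var VUp;; VKind ::= Num 0))"

definition descend :: com where
  "descend =
    VC ::= Mem (Num 1);; VKind ::= Mem (Var VC);;
    VOff ::= Num 0;; VBelow ::= Num 0;; VHeight ::= Num 0;; VDepth ::= Num 0;; VUp ::= Num 0;;
    VFill ::= Num 0;; VRes ::= Num 0;; VHeap ::= Mem (Num 0);;
    While (Var VKind) descend_body"

text \<open>The header words are the first free address, the address of the root, and
  \<open>n + 1\<close>, a depth limit that shortens no ancestor list. The constant 64 leaves
  generous room for the cells and tasks on the heap and for all sums that are formed.\<close>

locale dag =
  fixes w n :: nat and D :: "nat list" and addr :: "nat top_tree \<Rightarrow> nat"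
    and V :: "nat top_tree set" and root :: "nat top_tree"
  assumes children_in: "TMerge k A B \<in> V \<Longrightarrow> A \<in> V \<and> B \<in> V"
    and addr: "c \<in> V \<Longrightarrow> 0 < addr c \<and> addr c + 8 \<le> length D"
    and vertex_words: "c \<in> V \<Longrightarrow> i < 8 \<Longrightarrow> D ! (addr c + i) = vertex_words addr c ! i"
    and header: "3 \<le> length D" "D ! 0 = length D" "D ! 1 = addr root" "D ! 2 = Suc n"
    and root: "root \<in> V" "csize root = n"
    and word_size: "length D + 64 * n + 64 < 2 ^ w"
begin

section \<open>Memory contents and correctness of the search program\<close>

definition intact :: "(nat \<Rightarrow> nat) \<Rightarrow> bool" where
  "intact m \<longleftrightarrow> (\<forall>a < length D. m a = D ! a)"

lemma intact_upd: "intact m \<Longrightarrow> length D \<le> a \<Longrightarrow> intact (m(a := v))"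
  by (simp add: intact_def)

lemma intact_vertex: "intact m \<Longrightarrow> c \<in> V \<Longrightarrow> i < 8 \<Longrightarrow> m (addr c + i) = vertex_words addr c ! i"
  using addr[of c] vertex_words[of c i] by (simp add: intact_def)

lemma intact_TEdge:
  assumes "intact m" "TEdge a b \<in> V"
  shows "m (addr (TEdge a b)) = 0" "m (Suc (addr (TEdge a b))) = b"
  using intact_vertex[OF assms, of 0] intact_vertex[OF assms, of 1] by simp_all

lemma intact_TMerge:
  assumes "intact m" "TMerge k A B \<in> V"
  shows "m (addr (TMerge k A B)) = kind (TMerge k A B)"
    "m (addr (TMerge k A B) + 1) = addr A"
    "m (Suc (addr (TMerge k A B))) = addr A"
    "m (addr (TMerge k A B) + 2) = addr B"
    "m (Suc (Suc (addr (TMerge k A B)))) = addr B"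
    "m (addr (TMerge k A B) + 3) = (if vertical k then pre_size A else csize A)"
    "m (addr (TMerge k A B) + 4) = csize B"
    "m (addr (TMerge k A B) + 5) = hole_depth A"
    "m (addr (TMerge k A B) + 6) = hole_depth B"
    "m (addr (TMerge k A B) + 7) = cheight B"
  using intact_vertex[OF assms, of 0] intact_vertex[OF assms, of 1] intact_vertex[OF assms, of 2]
    intact_vertex[OF assms, of 3] intact_vertex[OF assms, of 4] intact_vertex[OF assms, of 5]
    intact_vertex[OF assms, of 6] intact_vertex[OF assms, of 7]
  by (simp_all del: kind.simps)

lemma intact_kind: "intact m \<Longrightarrow> c \<in> V \<Longrightarrow> m (addr c) = kind c"
  using intact_vertex[of m c 0] by (cases c) simp_all

text \<open>Lists end with address 0, and all their cells lie below \<open>hp\<close>, so that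
  writing at \<open>hp\<close> or above does not touch them.\<close>

fun chain :: "(nat \<Rightarrow> nat) \<Rightarrow> nat \<Rightarrow> nat \<Rightarrow> nat top_tree list \<Rightarrow> bool" where
  "chain m hp p [] \<longleftrightarrow> p = 0"
| "chain m hp p (c # K) \<longleftrightarrow>
     0 < p \<and> p + 2 \<le> hp \<and> c \<in> V \<and> m p = addr c \<and> chain m hp (m (Suc p)) K"

lemma chain_upd: "chain m hp p K \<Longrightarrow> hp \<le> a \<Longrightarrow> chain (m(a := v)) hp p K"
  by (induction K arbitrary: p) auto

lemma chain_mono: "chain m hp p K \<Longrightarrow> hp \<le> hp' \<Longrightarrow> chain m hp' p K"
  by (induction K arbitrary: p) auto

definition position :: "nat list \<Rightarrow> nat \<Rightarrow> nat top_tree list \<Rightarrow> (var \<Rightarrow> nat) \<Rightarrow> (nat \<Rightarrow> nat) \<Rightarrow> bool" where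
  "position up off K \<sigma> m \<longleftrightarrow> intact m \<and> \<sigma> VOff = off \<and> \<sigma> VBelow = fill_size K \<and>
     \<sigma> VHeight = forest_height (fill K) \<and> \<sigma> VDepth = length up \<and> \<sigma> VUp = parent_code up \<and>
     length D \<le> \<sigma> VHeap \<and> chain m (\<sigma> VHeap) (\<sigma> VFill) K"

text \<open>The last conjunct bounds the heap: pushing a cell of two words removes \<open>B\<close>,
  of size at least 1, from the current cluster. \<open>VS\<close> stays fixed, so that a value can
  survive the search there.\<close>

definition searching ::
  "nat top_tree \<Rightarrow> nat list \<Rightarrow> nat \<Rightarrow> nat top_tree list \<Rightarrow> nat \<Rightarrow> nat \<Rightarrow> nat \<Rightarrow> nat \<Rightarrow> (var \<Rightarrow> nat) \<Rightarrow> (nat \<Rightarrow> nat) \<Rightarrow> bool"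
where
  "searching c up off K x y d s \<sigma> m \<longleftrightarrow> position up off K \<sigma> m \<and> c \<in> V \<and> \<sigma> VC = addr c \<and>
     \<sigma> VKind = kind c \<and> \<sigma> VX = x \<and> \<sigma> VY = y \<and> \<sigma> VD = d \<and> \<sigma> VRes = 0 \<and> \<sigma> VS = s \<and>
     off + csize c + fill_size K \<le> n \<and> length up \<le> off \<and> parent_code up \<le> off \<and> x < n \<and> y < n \<and>
     \<sigma> VHeap + 2 * csize c \<le> length D + 2 * n"

definition located :: "nat \<Rightarrow> nat \<times> (nat list \<times> nat \<times> nat top_tree list) option \<Rightarrow> (var \<Rightarrow> nat) \<Rightarrow> (nat \<Rightarrow> nat) \<Rightarrow> bool" where
  "located s r \<sigma> m \<longleftrightarrow> intact m \<and> \<sigma> VS = s \<and> (case r of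
     (z, None) \<Rightarrow> \<sigma> VRes = z
   | (z, Some (up, b, K)) \<Rightarrow> \<sigma> VRes = 0 \<and> Suc (\<sigma> VOff) = z \<and> position up (\<sigma> VOff) K \<sigma> m \<and>
       0 < \<sigma> VC \<and> \<sigma> VC + 8 \<le> length D \<and> m (Suc (\<sigma> VC)) = b \<and>
       (\<exists>a. TEdge a b \<in> V \<and> \<sigma> VC = addr (TEdge a b)) \<and>
       Suc (\<sigma> VOff) + fill_size K \<le> n \<and> length up \<le> \<sigma> VOff \<and> \<sigma> VUp \<le> \<sigma> VOff \<and>
       \<sigma> VHeap \<le> length D + 2 * n)"

lemma wp_assign:
  "safe w e \<sigma> m \<Longrightarrow> val e \<sigma> m = k \<Longrightarrow> Q (\<sigma>(v := k)) m out t \<Longrightarrow> wp w (v ::= e) Q \<sigma> m out t"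
  by simp

lemma wp_select:
  assumes "searching (TMerge k A B) up off K x y d s \<sigma> m"
    and "Q (\<sigma>(VSt := right_start k A off (fill_size K),
        VEn := right_start k A off (fill_size K) + csize B + (if vertical k \<or> k = HRight then fill_size K else 0),
        VRx := of_bool (in_right k A B off (fill_size K) x),
        VRy := of_bool (in_right k A B off (fill_size K) y),
        VE := of_bool (in_right k A B off (fill_size K) x \<and> in_right k A B off (fill_size K) y \<and>
          (vertical k \<longrightarrow> length up + hole_depth A < d)))) m out t"
  shows "wp w select Q \<sigma> m out t"
proof -
  let ?c = "TMerge k A B"
  let ?st = "right_start k A off (fill_size K)"
  let ?en = "?st + csize B + (if vertical k \<or> k = HRight then fill_size K else 0)"
  note s = assms(1)[unfolded searching_def position_def]
  have c: "?c \<in> V" and m: "intact m" and C: "\<sigma> VC = addr ?c" using s by auto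
  have b: "addr ?c + 8 < 2 ^ w" "(64 :: nat) < 2 ^ w" using addr[OF c] word_size by auto
  have n: "n + n + 64 < 2 ^ w" using word_size by simp
  have en: "?en \<le> n" using s pre_size_bounds(2)[of A] by (auto simp: right_start_def)
  have d: "hole_depth A \<le> n" using s pre_size_bounds[of A] by auto
  note fld = intact_TMerge[OF m c]
  show ?thesis
    unfolding select_def wp.simps(4)
  proof (intro wp_assign)
    show "Q (\<sigma>(VSt := ?st, VEn := ?en, VRx := of_bool (in_right k A B off (fill_size K) x),
        VRy := of_bool (in_right k A B off (fill_size K) y),
        VE := of_bool (in_right k A B off (fill_size K) x \<and> in_right k A B off (fill_size K) y \<and>
          (vertical k \<longrightarrow> length up + hole_depth A < d)))) m out t"
      by (rule assms(2))
    let ?s0 = "\<sigma>(VSt := ?st, VEn := ?en, VRx := of_bool (in_right k A B off (fill_size K) x),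
        VRy := of_bool (in_right k A B off (fill_size K) y))"
    let ?e = "Times (Times (Var VRx) (Var VRy)) (Plus (Lt (Num 1) (Var VKind))
               (Times (Eq (Var VKind) (Num 1)) (Lt (Plus (Var VDepth) (fld 5)) (Var VD))))"
    show "safe w ?e ?s0 m"
      using s b n d by (simp add: fld C)
    show "val ?e ?s0 m = of_bool (in_right k A B off (fill_size K) x \<and> in_right k A B off (fill_size K) y \<and>
          (vertical k \<longrightarrow> length up + hole_depth A < d))"
      using s by (simp add: fld C)
    let ?s1 = "\<sigma>(VSt := ?st, VEn := ?en, VRx := of_bool (in_right k A B off (fill_size K) x))"
    let ?e = "Times (Lt (Var VSt) (Plus (Var VY) (Num 1))) (Lt (Var VY) (Var VEn))"
    show "safe w ?e ?s1 m"
      using s b n by simp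
    show "val ?e ?s1 m = of_bool (in_right k A B off (fill_size K) y)"
      using s by (simp add: in_right_def less_Suc_eq_le)
    let ?s2 = "\<sigma>(VSt := ?st, VEn := ?en)"
    let ?e = "Times (Lt (Var VSt) (Plus (Var VX) (Num 1))) (Lt (Var VX) (Var VEn))"
    show "safe w ?e ?s2 m"
      using s b n by simp
    show "val ?e ?s2 m = of_bool (in_right k A B off (fill_size K) x)"
      using s by (simp add: in_right_def less_Suc_eq_le)
    let ?e = "Plus (Var VSt) (Plus (fld 4) (Times (Lt (Var VKind) (Num 3)) (Var VBelow)))"
    show val: "val ?e (\<sigma>(VSt := ?st)) m = ?en"
      using s by (simp add: fld C)
    show "safe w ?e (\<sigma>(VSt := ?st)) m"
      using s b n en val by (simp add: fld C)
    let ?e = "Plus (Var VOff) (Plus (fld 3) (Times (Eq (Var VKind) (Num 3)) (Var VBelow)))"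
    show val: "val ?e \<sigma> m = ?st"
      using s by (simp add: fld C right_start_def)
    show "safe w ?e \<sigma> m"
      using s b n en val by (simp add: fld C)
  qed
qed

text \<open>Justifies assigning \<open>VSt\<close> to \<open>VUp\<close> in \<open>go_right\<close>:
  in a vertical merge the first number of \<open>B\<close> is one more than that of its top boundary
  node, just as \<open>parent_code\<close> demands.\<close>

lemma parent_code_spine: "parent_code (spine c off @ up) = off + pre_size c"
  using Suc_hd_spine[of c off] spine_nonempty[of c off]
  by (cases "spine c off") (auto simp: parent_code_def)

lemma wp_go_right:
  assumes "searching (TMerge k A B) up off K x y d s \<sigma> m"
    and "\<sigma> VSt = right_start k A off (fill_size K)"
    and Q: "\<And>\<sigma>'. searching B (right_up k A off up) (right_start k A off (fill_size K)) (right_fill k K) x y d s \<sigma>' m \<Longrightarrow>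
      Q \<sigma>' m out t"
  shows "wp w go_right Q \<sigma> m out t"
proof -
  let ?c = "TMerge k A B"
  note s = assms(1)[unfolded searching_def position_def] assms(2)
  have c: "?c \<in> V" "B \<in> V" and m: "intact m" and C: "\<sigma> VC = addr ?c"
    using s children_in[of k A B] by auto
  have b: "addr ?c + 8 < 2 ^ w" "(64 :: nat) < 2 ^ w" using addr[OF c(1)] word_size by auto
  note fld = intact_TMerge[OF m c(1)] intact_kind[OF m c(2)]
  note bounds = pre_size_bounds[of A] csize_pos[of A]
  have d: "length up + hole_depth A < 2 ^ w" using s word_size bounds by auto
  consider "vertical k" | "\<not> vertical k" "k = HRight" | "\<not> vertical k" "k \<noteq> HRight" by blast
  then show ?thesis
  proof cases
    case 1
    with s b d show ?thesis
      apply (simp add: go_right_def fld C)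
      apply (rule Q)
      using bounds
      apply (simp add: searching_def position_def c right_start_def right_up_def right_fill_def parent_code_spine)
      done
  next
    case 2
    with s b d show ?thesis
      apply (simp add: go_right_def clear_fill_def fld fld[unfolded 2(2)] C)
      apply (rule Q)
      using bounds
      apply (simp add: fld[unfolded 2(2)] searching_def position_def c right_start_def right_up_def right_fill_def parent_code_spine)
      done
  next
    case 3
    with s b d show ?thesis
      apply (simp add: go_right_def clear_fill_def fld C)
      apply (rule Q)
      using bounds
      apply (simp add: searching_def position_def c right_start_def right_up_def right_fill_def parent_code_spine)
      done
  qed
qed

lemma wp_push_fill:
  assumes "searching (TMerge k A B) up off K x y d s \<sigma> m" "vertical k"
    and "\<sigma> VSt = right_start k A off (fill_size K)"
    and "\<sigma> VRx = of_bool rx" "\<sigma> VRy = of_bool ry"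
    and Q: "\<And>\<sigma>' m'. position up off (B # K) \<sigma>' m' \<Longrightarrow> \<sigma>' VC = addr (TMerge k A B) \<Longrightarrow>
      \<sigma>' VX = (if rx then right_start k A off (fill_size K) - 1 else x) \<Longrightarrow>
      \<sigma>' VY = (if ry then right_start k A off (fill_size K) - 1 else y) \<Longrightarrow>
      \<sigma>' VD = d \<Longrightarrow> \<sigma>' VRes = 0 \<Longrightarrow> \<sigma>' VS = s \<Longrightarrow> \<sigma>' VHeap = \<sigma> VHeap + 2 \<Longrightarrow>
      Q \<sigma>' m' out t"
  shows "wp w push_fill Q \<sigma> m out t"
proof -
  let ?c = "TMerge k A B"
  note s = assms(1)[unfolded searching_def position_def] assms(2-5)
  have c: "?c \<in> V" "A \<in> V" "B \<in> V" and m: "intact m" and C: "\<sigma> VC = addr ?c"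
    using s children_in[of k A B] by auto
  have b: "addr ?c + 8 < 2 ^ w" "(64 :: nat) < 2 ^ w" using addr[OF c(1)] word_size by auto
  note fld = intact_TMerge[OF m c(1)]
  note bounds = cluster_bounds[of A] cluster_bounds[of B]
  have hp: "length D \<le> \<sigma> VHeap" "\<sigma> VHeap + 2 \<le> length D + 2 * n" using s bounds by auto
  let ?m = "m(\<sigma> VHeap := addr B, Suc (\<sigma> VHeap) := \<sigma> VFill)"
  have m': "intact (m(\<sigma> VHeap := addr B))" "intact ?m"
    using m hp by (auto intro!: intact_upd)
  have ch: "chain m (\<sigma> VHeap) (\<sigma> VFill) K" using s by auto
  have chain: "chain ?m (Suc (Suc (\<sigma> VHeap))) (\<sigma> VHeap) (B # K)"
    using hp(1) header(1) c(3) chain_mono[OF chain_upd[OF chain_upd[OF ch]]] by simp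
  have h: "hole_depth B + forest_height (fill K) \<le> n" "cheight B \<le> n" "fill_size K + csize B \<le> n"
    using s bounds forest_height_le_size[of "fill K"] by auto
  have st: "right_start k A off (fill_size K) = off + pre_size A" using s by (simp add: right_start_def)
  have n: "n + n + length D + 64 < 2 ^ w" using word_size by simp
  let ?x = "if rx then right_start k A off (fill_size K) - 1 else x"
  let ?y = "if ry then right_start k A off (fill_size K) - 1 else y"
  let ?h = "max (cheight B) (hole_depth B + forest_height (fill K))"
  let ?v = "\<sigma>(VX := ?x, VY := ?y, VE := of_bool (cheight B < hole_depth B + forest_height (fill K)),
    VHeight := ?h, VBelow := csize B + fill_size K)"
  define v where "v = ?v"
  have v: "v VX = ?x" "v VY = ?y" "v VHeight = ?h" "v VBelow = csize B + fill_size K" "v VC = addr ?c"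
    "v VOff = off" "v VDepth = length up" "v VUp = parent_code up" "v VHeap = \<sigma> VHeap" "v VFill = \<sigma> VFill"
    "v VD = d" "v VRes = 0" "v VS = s"
    using s by (simp_all add: v_def)
  show ?thesis
    unfolding push_fill_def wp.simps(4)
  proof (intro wp_assign)
    let ?e = "blend (Var VRx) (Minus (Var VSt) (Num 1)) (Var VX)"
    show "safe w ?e \<sigma> m" using s n bounds st by (cases rx) (auto simp: blend_def)
    show "val ?e \<sigma> m = ?x" using s by (simp add: blend_def)
    let ?e = "blend (Var VRy) (Minus (Var VSt) (Num 1)) (Var VY)"
    show "safe w ?e (\<sigma>(VX := ?x)) m" using s n bounds st by (cases ry) (auto simp: blend_def)
    show "val ?e (\<sigma>(VX := ?x)) m = ?y" using s by (simp add: blend_def)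
    let ?s = "\<sigma>(VX := ?x, VY := ?y)"
    let ?e = "Lt (fld 7) (Plus (fld 6) (Var VHeight))"
    show "safe w ?e ?s m" using s n b h by (simp add: fld C)
    show "val ?e ?s m = of_bool (cheight B < hole_depth B + forest_height (fill K))"
      using s by (simp add: fld C)
    let ?s = "\<sigma>(VX := ?x, VY := ?y, VE := of_bool (cheight B < hole_depth B + forest_height (fill K)))"
    let ?e = "blend (Var VE) (Plus (fld 6) (Var VHeight)) (fld 7)"
    show "safe w ?e ?s m"
      using s n b h by (cases "cheight B < hole_depth B + forest_height (fill K)") (simp_all add: blend_def fld C)
    show "val ?e ?s m = ?h"
      using s by (simp add: blend_def fld C max_def)
    let ?s = "\<sigma>(VX := ?x, VY := ?y, VE := of_bool (cheight B < hole_depth B + forest_height (fill K)), VHeight := ?h)"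
    let ?e = "Plus (Var VBelow) (fld 4)"
    show "safe w ?e ?s m" using s n b h by (simp add: fld C)
    show "val ?e ?s m = csize B + fill_size K" using s by (simp add: fld C)
    show "wp w (Write (Var VHeap) (fld 2)) (wp w (Write (Plus (Var VHeap) (Num 1)) (Var VFill))
      (wp w (VFill ::= Var VHeap) (wp w (VHeap ::= Plus (Var VHeap) (Num 2)) Q))) ?v m out t"
      unfolding v_def[symmetric]
      using b n hp
      apply (simp add: fld v)
      apply (rule Q)
      using hp m' chain
      apply (simp_all add: position_def v)
      done
  qed
qed

lemma wp_go_left:
  assumes "searching (TMerge k A B) up off K x y d s \<sigma> m"
    and "\<sigma> VSt = right_start k A off (fill_size K)"
    and "\<sigma> VRx = of_bool (in_right k A B off (fill_size K) x)"
    and "\<sigma> VRy = of_bool (in_right k A B off (fill_size K) y)"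
    and br: "vertical k \<or> \<not> in_right k A B off (fill_size K) x \<and> \<not> in_right k A B off (fill_size K) y"
    and Q: "\<And>\<sigma>' m'. searching A up off (left_fill k B K)
        (if in_right k A B off (fill_size K) x then right_start k A off (fill_size K) - 1 else x)
        (if in_right k A B off (fill_size K) y then right_start k A off (fill_size K) - 1 else y) d s \<sigma>' m' \<Longrightarrow>
      Q \<sigma>' m' out t"
  shows "wp w go_left Q \<sigma> m out t"
proof -
  let ?c = "TMerge k A B"
  note s = assms(1)[unfolded searching_def position_def] assms(2-5)
  have c: "?c \<in> V" "A \<in> V" and m: "intact m" and C: "\<sigma> VC = addr ?c"
    using s children_in[of k A B] by auto
  have b: "addr ?c + 8 < 2 ^ w" "(64 :: nat) < 2 ^ w" using addr[OF c(1)] word_size by auto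
  note fld = intact_TMerge[OF m c(1)] intact_kind[OF m c(2)]
  note bounds = pre_size_bounds[of A] csize_pos[of A] csize_pos[of B]
  have st: "vertical k \<Longrightarrow> right_start k A off (fill_size K) = off + pre_size A" by (simp add: right_start_def)
  consider "vertical k" | "\<not> vertical k" "k = HRight" | "\<not> vertical k" "k \<noteq> HRight" by blast
  then show ?thesis
  proof cases
    case 1
    have hn: "off + pre_size A - Suc 0 < n" using s bounds by auto
    have "wp w push_fill (wp w (VC ::= fld 1) (wp w (VKind ::= Mem (Var VC)) Q)) \<sigma> m out t"
    proof (rule wp_push_fill[OF assms(1) 1 assms(2-4)])
      fix \<sigma>' m'
      assume a: "position up off (B # K) \<sigma>' m'" "\<sigma>' VC = addr (TMerge k A B)"
        "\<sigma>' VX = (if in_right k A B off (fill_size K) x then right_start k A off (fill_size K) - 1 else x)"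
        "\<sigma>' VY = (if in_right k A B off (fill_size K) y then right_start k A off (fill_size K) - 1 else y)"
        "\<sigma>' VD = d" "\<sigma>' VRes = 0" "\<sigma>' VS = s" "\<sigma>' VHeap = \<sigma> VHeap + 2"
      then have "intact m'" by (simp add: position_def)
      note fld' = intact_TMerge[OF this c(1)] intact_kind[OF this c(2)]
      show "wp w (VC ::= fld 1) (wp w (VKind ::= Mem (Var VC)) Q) \<sigma>' m' out t"
        using b a(2)
        apply (simp add: fld')
        apply (rule Q)
        using a s bounds st[OF 1] 1 hn
        apply (simp add: searching_def position_def left_fill_def c)
        done
    qed
    with 1 s b show ?thesis by (simp add: go_left_def)
  next
    case 2
    with s b br show ?thesis
      apply (simp add: go_left_def clear_fill_def fld fld[unfolded 2(2)] C)
      apply (rule Q)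
      using bounds
      apply (simp add: fld[unfolded 2(2)] searching_def position_def c left_fill_def)
      done
  next
    case 3
    with s b br show ?thesis
      apply (simp add: go_left_def clear_fill_def fld C)
      apply (rule Q)
      using bounds
      apply (simp add: searching_def position_def c left_fill_def)
      done
  qed
qed

end

context dag
begin

text \<open>Each iteration descends to a child or ends the loop, so the height of the cluster bounds
  their number.\<close>

lemma wp_descend_loop:
  assumes "searching c up off K x y d s \<sigma> m"
    and "\<And>\<sigma>' m' t'. located s (locate c up off K x y d) \<sigma>' m' \<Longrightarrow> t' \<le> t + top_height c \<Longrightarrow> Q \<sigma>' m' out t'"
  shows "wp w (While (Var VKind) descend_body) Q \<sigma> m out t"
  using assms
proof (induction c arbitrary: up off K x y \<sigma> m t)
  case (TEdge a b)
  note s = TEdge(1)[unfolded searching_def position_def]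
  have e: "TEdge a b \<in> V" and m: "intact m" using s by auto
  have "Q \<sigma> m out t"
    using s addr[OF e] intact_TEdge[OF m e]
    by (intro TEdge(2)) (auto simp: located_def position_def)
  then show ?case using s by (subst wp_While) simp
next
  case (TMerge k A B)
  note s = TMerge.prems(1)
  let ?s = "fill_size K"
  let ?rx = "in_right k A B off ?s x" and ?ry = "in_right k A B off ?s y"
  let ?go = "?rx \<and> ?ry \<and> (vertical k \<longrightarrow> length up + hole_depth A < d)"
  let ?W = "wp w (While (Var VKind) descend_body) Q"
  have kind: "\<sigma> VKind \<noteq> 0" using s by (auto simp: searching_def)
  let ?\<sigma> = "\<sigma>(VSt := right_start k A off ?s,
        VEn := right_start k A off ?s + csize B + (if vertical k \<or> k = HRight then ?s else 0),
        VRx := of_bool ?rx, VRy := of_bool ?ry, VE := of_bool ?go)"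
  define v where "v = ?\<sigma>"
  have v: "searching (TMerge k A B) up off K x y d s v m" "v VSt = right_start k A off ?s"
    "v VRx = of_bool ?rx" "v VRy = of_bool ?ry" "v VE = of_bool ?go"
    using s unfolding v_def by (simp_all add: searching_def position_def)
  have b: "(64 :: nat) < 2 ^ w" using word_size by simp
  have "wp w (Cond (Var VE) go_right
      (Cond (Plus (Eq (Var VKind) (Num 1)) (Eq (Plus (Var VRx) (Var VRy)) (Num 0))) go_left
        (VRes ::= Var VUp;; VKind ::= Num 0))) ?W v m out (Suc t)"
  proof (cases ?go)
    case True
    have "wp w go_right ?W v m out (Suc t)"
    proof (rule wp_go_right[OF v(1,2)])
      fix \<sigma>' assume a: "searching B (right_up k A off up) (right_start k A off ?s) (right_fill k K) x y d s \<sigma>' m"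
      from True have l: "locate (TMerge k A B) up off K x y d =
          locate B (right_up k A off up) (right_start k A off ?s) (right_fill k K) x y d"
        by (simp add: Let_def)
      show "?W \<sigma>' m out (Suc t)"
        by (rule TMerge.IH(2)[OF a], rule TMerge.prems(2), unfold l) auto
    qed
    with True v(5) show ?thesis by simp
  next
    case False
    show ?thesis
    proof (cases "vertical k \<or> \<not> ?rx \<and> \<not> ?ry")
      case left: True
      have "wp w go_left ?W v m out (Suc t)"
      proof (rule wp_go_left[OF v(1-4) left])
        fix \<sigma>' m' assume a: "searching A up off (left_fill k B K) (if ?rx then right_start k A off ?s - 1 else x)
            (if ?ry then right_start k A off ?s - 1 else y) d s \<sigma>' m'"
        from False left have l: "locate (TMerge k A B) up off K x y d =
            locate A up off (left_fill k B K) (if ?rx then right_start k A off ?s - 1 else x)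
            (if ?ry then right_start k A off ?s - 1 else y) d"
          unfolding locate.simps Let_def by (simp only: if_False if_True)
        show "?W \<sigma>' m' out (Suc t)"
          by (rule TMerge.IH(1)[OF a], rule TMerge.prems(2), unfold l) auto
      qed
      moreover have "v VKind = kind (TMerge k A B)" using v(1) by (simp add: searching_def)
      ultimately show ?thesis
        using False left v(3-5) b by (cases ?rx; cases ?ry) auto
    next
      case split: False
      have l: "locate (TMerge k A B) up off K x y d = (parent_code up, None)"
        using False split unfolding locate.simps Let_def by (simp only: if_False)
      have "located s (locate (TMerge k A B) up off K x y d) (v(VRes := v VUp, VKind := 0)) m"
        using v(1) unfolding l by (simp add: located_def searching_def position_def)
      then have "Q (v(VRes := v VUp, VKind := 0)) m out (Suc t)"
        by (rule TMerge.prems(2)) simp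
      then have "?W (v(VRes := v VUp, VKind := 0)) m out (Suc t)"
        by (subst wp_While) simp
      moreover have "v VKind = kind (TMerge k A B)" using v(1) by (simp add: searching_def)
      ultimately show ?thesis
        using False split v(3-5) b by (cases ?rx; cases ?ry) auto
    qed
  qed
  then have "wp w descend_body ?W \<sigma> m out (Suc t)"
    unfolding descend_body_def wp.simps(4) v_def by (rule wp_select[OF s])
  with kind show ?case by (subst wp_While) simp
qed

lemma wp_descend:
  assumes "intact m" "\<sigma> VX < n" "\<sigma> VY < n"
    and "\<And>\<sigma>' m' t'. located (\<sigma> VS) (locate root [] 0 [] (\<sigma> VX) (\<sigma> VY) (\<sigma> VD)) \<sigma>' m' \<Longrightarrow>
      t' \<le> t + top_height root \<Longrightarrow> Q \<sigma>' m' out t'"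
  shows "wp w descend Q \<sigma> m out t"
proof -
  have b: "(64 :: nat) < 2 ^ w" using word_size by simp
  have h: "m 0 = length D" "m 1 = addr root" "m (Suc 0) = addr root"
    using assms(1) header(2,3) header(1)[THEN less_le_trans[rotated], of 0] header(1)[THEN less_le_trans[rotated], of 1]
    by (auto simp: intact_def)
  have "searching root [] 0 [] (\<sigma> VX) (\<sigma> VY) (\<sigma> VD) (\<sigma> VS)
    (\<sigma>(VC := addr root, VKind := kind root, VOff := 0, VBelow := 0, VHeight := 0, VDepth := 0, VUp := 0,
       VFill := 0, VRes := 0, VHeap := length D)) m"
    using assms root by (simp add: searching_def position_def parent_code_def)
  then have "wp w (While (Var VKind) descend_body) Q
    (\<sigma>(VC := addr root, VKind := kind root, VOff := 0, VBelow := 0, VHeight := 0, VDepth := 0, VUp := 0,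
       VFill := 0, VRes := 0, VHeap := length D)) m out t"
    using assms(4) by (rule wp_descend_loop)
  then show ?thesis using b h root(1) intact_kind[OF assms(1) root(1)] by (simp add: descend_def)
qed

end

locale represented_tree = dag +
  fixes T :: "nat tree"
  assumes sem_root: "sem root [] = [T]"
begin

lemma n_eq: "n = num_nodes T"
  using forest_size_sem[of root "[]"] root(2) by (simp add: sem_root)

lemma entry_root: "entry root [] 0 [] z = info T ! z"
  by (simp add: entry_def sem_root)

lemma cluster_nums_root: "z \<in> cluster_nums root 0 (fill_size []) \<longleftrightarrow> z < n"
  by (auto simp: cluster_nums_def root)

lemma locate_root:
  assumes "x < n" "y < n" "0 < d"
  shows "fst (locate root [] 0 [] x y d) =
    Suc (last (take d (longest_common_prefix (rev (fst (info T ! x))) (rev (fst (info T ! y))))))"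
  using locate_ancestor[of x root 0 "[]" y "[]" d] assms by (simp add: cluster_nums_root[simplified] entry_root sem_root)

lemma ancestors:
  assumes "x < n"
  shows "fst (info T ! x) \<noteq> []" "hd (fst (info T ! x)) = x" "length (fst (info T ! x)) \<le> n"
  using nodes_info_ancestors[of x "[T]" "[]" 0] assms n_eq by auto

lemma locate_root_self:
  assumes "x < n" "0 < d"
  obtains z up b K where "locate root [] 0 [] x x d = (Suc z, Some (up, b, K))"
    "z = last (take d (rev (fst (info T ! x))))" "z < n" "info T ! z = (z # up, Node b (fill K))"
proof -
  let ?z = "last (take d (rev (fst (info T ! x))))"
  have fst: "fst (locate root [] 0 [] x x d) = Suc ?z"
    using locate_root[of x x d] assms by (simp add: lcp_same)
  then obtain up b K where l: "locate root [] 0 [] x x d = (Suc ?z, Some (up, b, K))"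
    using locate_None[of root "[]" 0 "[]" x d "Suc ?z"] by (cases "locate root [] 0 [] x x d") auto
  have "x \<in> cluster_nums root 0 (fill_size [])" using assms by (simp only: cluster_nums_root)
  from locate_entry[OF this this l] show ?thesis
    using l by (intro that) (simp_all only: cluster_nums_root entry_root)
qed

definition found :: "nat \<Rightarrow> nat list \<Rightarrow> nat \<Rightarrow> nat top_tree list \<Rightarrow> (var \<Rightarrow> nat) \<Rightarrow> (nat \<Rightarrow> nat) \<Rightarrow> bool" where
  "found x up b K \<sigma> m \<longleftrightarrow> info T ! x = (x # up, Node b (fill K)) \<and> position up x K \<sigma> m \<and> x < n \<and>
     \<sigma> VRes = 0 \<and> \<sigma> VC + 8 \<le> length D \<and> m (Suc (\<sigma> VC)) = b \<and>
     (\<exists>a. TEdge a b \<in> V \<and> \<sigma> VC = addr (TEdge a b)) \<and>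
     Suc x + fill_size K \<le> n \<and> length up \<le> x \<and> \<sigma> VUp \<le> x \<and> \<sigma> VHeap \<le> length D + 2 * n"

lemma wp_descend_self:
  assumes "intact m" "\<sigma> VX = x" "\<sigma> VY = x" "x < n" "0 < \<sigma> VD"
    and Q: "\<And>z up b K \<sigma>' m' t'. z = last (take (\<sigma> VD) (rev (fst (info T ! x)))) \<Longrightarrow> found z up b K \<sigma>' m' \<Longrightarrow>
      \<sigma>' VS = \<sigma> VS \<Longrightarrow> t' \<le> t + top_height root \<Longrightarrow> Q \<sigma>' m' out t'"
  shows "wp w descend Q \<sigma> m out t"
proof (rule wp_descend)
  show "intact m" "\<sigma> VX < n" "\<sigma> VY < n" using assms by simp_all
  fix \<sigma>' m' t'
  assume l: "located (\<sigma> VS) (locate root [] 0 [] (\<sigma> VX) (\<sigma> VY) (\<sigma> VD)) \<sigma>' m'" and t: "t' \<le> t + top_height root"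
  obtain z up b K where z: "locate root [] 0 [] x x (\<sigma> VD) = (Suc z, Some (up, b, K))"
    "z = last (take (\<sigma> VD) (rev (fst (info T ! x))))" "z < n" "info T ! z = (z # up, Node b (fill K))"
    using locate_root_self[OF assms(4,5)] .
  have "found z up b K \<sigma>' m'" "\<sigma>' VS = \<sigma> VS"
    using l z assms(2,3) by (auto simp: found_def located_def)
  then show "Q \<sigma>' m' out t'" using z(2) t Q by blast
qed

end

text \<open>With both targets equal to \<open>x\<close> and \<open>n + 1\<close> as depth limit, the
  search arrives at \<open>x\<close> itself.\<close>

definition search :: com where
  "search = VY ::= Var VX;; VD ::= Mem (Num 2);; descend"

definition skip :: com where
  "skip = VE ::= Num 0"

text \<open>Pending tasks form a stack of linked triples: the address of a cluster, or 0 for closing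
  a node; the list that fills its hole; the rest of the stack.\<close>

definition push_task :: "exp \<Rightarrow> exp \<Rightarrow> com" where
  "push_task e f =
    Write (Var VHeap) e;; Write (Plus (Var VHeap) (Num 1)) f;; Write (Plus (Var VHeap) (Num 2)) (Var VS);;
    VS ::= Var VHeap;; VHeap ::= Plus (Var VHeap) (Num 3)"

text \<open>In a horizontal merge \<open>B\<close> is pushed before \<open>A\<close>, so that
  \<open>A\<close> is written first. In a vertical merge \<open>B\<close> joins the list in the hole
  of \<open>A\<close>, and one task suffices.\<close>

definition emit_merge :: com where
  "emit_merge =
    VX ::= fld 1;; VY ::= fld 2;;
    Cond (Eq (Var VKind) (Num 1))
      (Write (Var VHeap) (Var VY);; Write (Plus (Var VHeap) (Num 1)) (Var VFill);;
       VFill ::= Var VHeap;; VHeap ::= Plus (Var VHeap) (Num 2))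
      (Cond (Eq (Var VKind) (Num 2)) (push_task (Var VY) (Var VFill);; VFill ::= Num 0)
         (push_task (Var VY) (Num 0)));;
    push_task (Var VX) (Var VFill)"

text \<open>The lower endpoint is opened at once; its children, if any, and then its closing are
  left as tasks.\<close>

definition emit_edge :: com where
  "emit_edge =
    Out (Num 1);; Out (fld 1);; push_task (Num 0) (Num 0);;
    Cond (Var VFill)
      (VX ::= Mem (Var VFill);; VY ::= Mem (Plus (Var VFill) (Num 1));; push_task (Var VX) (Var VY))
      skip"

definition emit_body :: com where
  "emit_body =
    VC ::= Mem (Var VS);; VFill ::= Mem (Plus (Var VS) (Num 1));; VS ::= Mem (Plus (Var VS) (Num 2));;
    Cond (Var VC) (VKind ::= Mem (Var VC);; Cond (Var VKind) emit_merge emit_edge) (Out (Num 0))"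

text \<open>The edge found by the search, with the list in its hole, yields exactly the subtree of
  the given node.\<close>

definition emit :: com where
  "emit = VS ::= Num 0;; push_task (Var VC) (Var VFill);; While (Var VS) emit_body"

text \<open>\<open>NextSibling\<close> keeps the candidate number in \<open>VS\<close> while a
  second search determines where the subtree of the parent ends. \<open>LevelAncestor\<close>
  obtains the depth from a first search and the depth limit of the second one from it.\<close>

fun query_com :: "query \<Rightarrow> com" where
  "query_com Access = search;; Out (fld 1)"
| "query_com Depth = search;; Out (Var VDepth)"
| "query_com Height = search;; Out (Var VHeight)"
| "query_com Size = search;; Out (Plus (Var VBelow) (Num 1))"
| "query_com Parent = search;; Cond (Var VUp) (Out (Minus (Var VUp) (Num 1))) skip"
| "query_com Firstchild = search;; Cond (Var VBelow) (Out (Plus (Var VOff) (Num 1))) skip"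
| "query_com NextSibling = search;;
     Cond (Var VUp)
       (VS ::= Plus (Var VOff) (Plus (Var VBelow) (Num 1));; VX ::= Minus (Var VUp) (Num 1);; search;;
        Cond (Lt (Var VS) (Plus (Var VOff) (Plus (Var VBelow) (Num 1)))) (Out (Var VS)) skip)
       skip"
| "query_com LevelAncestor = VS ::= Var VY;; search;;
     Cond (Lt (Var VS) (Plus (Var VDepth) (Num 1)))
       (VX ::= Var VOff;; VY ::= Var VOff;; VD ::= Minus (Plus (Var VDepth) (Num 1)) (Var VS);; descend;;
        Out (Var VOff))
       skip"
| "query_com NCA = VD ::= Mem (Num 2);; descend;; Cond (Var VRes) (Out (Minus (Var VRes) (Num 1))) (Out (Var VOff))"
| "query_com Decompress = search;; emit"

context represented_tree
begin

section \<open>Correctness of the queries answered by searching\<close>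

lemma wp_search:
  assumes "intact m" "\<sigma> VX = x" "x < n"
    and Q: "\<And>up b K \<sigma>' m' t'. found x up b K \<sigma>' m' \<Longrightarrow> \<sigma>' VS = \<sigma> VS \<Longrightarrow>
      t' \<le> t + top_height root \<Longrightarrow> Q \<sigma>' m' out t'"
  shows "wp w search Q \<sigma> m out t"
proof -
  let ?\<sigma> = "\<sigma>(VY := x, VD := Suc n)"
  have m2: "m 2 = Suc n" using assms(1) header by (auto simp: intact_def)
  have b: "(64 :: nat) < 2 ^ w" using word_size by simp
  \<comment> \<open>An ancestor list has at most \<open>n\<close> entries, so the limit
    \<open>n + 1\<close> does not shorten it.\<close>
  have x: "last (take (Suc n) (rev (fst (info T ! x)))) = x"
    using ancestors[OF assms(3)] by (simp add: last_rev)
  have "wp w descend Q ?\<sigma> m out t"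
  proof (rule wp_descend_self[OF assms(1), where x = x])
    fix z up b K \<sigma>' m' t'
    assume z: "z = last (take (?\<sigma> VD) (rev (fst (info T ! x))))" "found z up b K \<sigma>' m'"
      and "\<sigma>' VS = ?\<sigma> VS" "t' \<le> t + top_height root"
    moreover have "z = x" using z(1) x by simp
    ultimately show "Q \<sigma>' m' out t'" by (intro Q) auto
  qed (use assms in auto)
  then show ?thesis using m2 b assms(2) by (simp add: search_def)
qed

abbreviation (input) post :: "nat list \<Rightarrow> nat \<Rightarrow> pred" where
  "post ans N \<equiv> \<lambda>\<sigma> m out t. out = ans \<and> t \<le> N \<and> intact m"

lemma initial_vars_simps [simp]:
  "initial_vars [x] VX = x" "initial_vars [x, y] VX = x" "initial_vars [x, y] VY = y"
  by (simp_all add: initial_vars_def)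

lemma small: "(64 :: nat) < 2 ^ w" "length D + 64 < 2 ^ w" "n + n + 64 < 2 ^ w"
  using word_size by simp_all

lemma found_info:
  assumes "found x up b K \<sigma> m"
  shows "info T ! x = (x # up, Node b (fill K))" "x < num_nodes T"
proof -
  show "info T ! x = (x # up, Node b (fill K))" using assms by (simp add: found_def)
  have "x < n" using assms by (simp add: found_def)
  then show "x < num_nodes T" using n_eq by simp
qed

lemma wp_simple_query:
  assumes "intact m" "x < n" "top_height root \<le> N"
    and "\<And>up b K \<sigma>' m' t'. found x up b K \<sigma>' m' \<Longrightarrow> t' \<le> N \<Longrightarrow> wp w c (post ans N) \<sigma>' m' [] t'"
  shows "wp w (search;; c) (post ans N) (initial_vars [x]) m [] 0"
  unfolding wp.simps(4)
  by (rule wp_search[OF assms(1), of _ x]) (use assms in auto)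

lemma wp_Access:
  assumes "intact m" "x < n" "top_height root \<le> N"
  shows "wp w (query_com Access) (post [q_access T x] N) (initial_vars [x]) m [] 0"
  unfolding query_com.simps
proof (rule wp_simple_query[OF assms])
  fix up b K \<sigma> m' t assume f: "found x up b K \<sigma> m'" and t: "t \<le> N"
  from found_info[OF f] f t show "wp w (Out (fld 1)) (post [q_access T x] N) \<sigma> m' [] t"
    using small by (simp add: found_def position_def q_access_def q_decompress_info)
qed

lemma wp_Depth:
  assumes "intact m" "x < n" "top_height root \<le> N"
  shows "wp w (query_com Depth) (post [q_depth T x] N) (initial_vars [x]) m [] 0"
  unfolding query_com.simps
proof (rule wp_simple_query[OF assms])
  fix up b K \<sigma> m' t assume f: "found x up b K \<sigma> m'" and t: "t \<le> N"
  from found_info[OF f] have "q_depth T x = length up" using q_depth_info[of x T] by simp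
  with f t show "wp w (Out (Var VDepth)) (post [q_depth T x] N) \<sigma> m' [] t"
    by (simp add: found_def position_def)
qed

lemma wp_Height:
  assumes "intact m" "x < n" "top_height root \<le> N"
  shows "wp w (query_com Height) (post [q_height T x] N) (initial_vars [x]) m [] 0"
  unfolding query_com.simps
proof (rule wp_simple_query[OF assms])
  fix up b K \<sigma> m' t assume f: "found x up b K \<sigma> m'" and t: "t \<le> N"
  from found_info[OF f] f t show "wp w (Out (Var VHeight)) (post [q_height T x] N) \<sigma> m' [] t"
    by (simp add: found_def position_def q_height_def q_decompress_info)
qed

lemma wp_Size:
  assumes "intact m" "x < n" "top_height root \<le> N"
  shows "wp w (query_com Size) (post [q_size T x] N) (initial_vars [x]) m [] 0"
  unfolding query_com.simps
proof (rule wp_simple_query[OF assms])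
  fix up b K \<sigma> m' t assume f: "found x up b K \<sigma> m'" and t: "t \<le> N"
  from found_info[OF f] f t show "wp w (Out (Plus (Var VBelow) (Num 1))) (post [q_size T x] N) \<sigma> m' [] t"
    using small by (simp add: found_def position_def q_size_def q_decompress_info)
qed

lemma wp_Parent:
  assumes "intact m" "x < n" "top_height root \<le> N"
  shows "wp w (query_com Parent) (post (node_words (q_parent T x)) N) (initial_vars [x]) m [] 0"
  unfolding query_com.simps
proof (rule wp_simple_query[OF assms])
  fix up b K \<sigma> m' t assume f: "found x up b K \<sigma> m'" and t: "t \<le> N"
  from found_info[OF f] f t
  show "wp w (Cond (Var VUp) (Out (Minus (Var VUp) (Num 1))) skip) (post (node_words (q_parent T x)) N) \<sigma> m' [] t"
    using small
    by (cases up) (simp_all add: found_def position_def q_parent_info parent_code_def skip_def)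
qed

lemma wp_Firstchild:
  assumes "intact m" "x < n" "top_height root \<le> N"
  shows "wp w (query_com Firstchild) (post (node_words (q_first_child T x)) N) (initial_vars [x]) m [] 0"
  unfolding query_com.simps
proof (rule wp_simple_query[OF assms])
  fix up b K \<sigma> m' t assume f: "found x up b K \<sigma> m'" and t: "t \<le> N"
  from found_info[OF f] f t
  show "wp w (Cond (Var VBelow) (Out (Plus (Var VOff) (Num 1))) skip) (post (node_words (q_first_child T x)) N) \<sigma> m' [] t"
    using small
    by (cases "fill K = []") (simp_all add: found_def position_def q_first_child_info skip_def)
qed

lemma wp_NextSibling:
  assumes "intact m" "x < n" "2 * top_height root \<le> N"
  shows "wp w (query_com NextSibling) (post (node_words (q_next_sibling T x)) N) (initial_vars [x]) m [] 0"
  unfolding query_com.simps wp.simps(4)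
proof (rule wp_search[OF assms(1) _ assms(2)])
  show "initial_vars [x] VX = x" by simp
  fix up b K \<sigma> m' t assume f: "found x up b K \<sigma> m'" and t: "t \<le> 0 + top_height root"
  let ?Q = "post (node_words (q_next_sibling T x)) N"
  let ?c = "Cond (Lt (Var VS) (Plus (Var VOff) (Plus (Var VBelow) (Num 1)))) (Out (Var VS)) skip"
  let ?e = "Suc (x + fill_size K)"
  show "wp w (Cond (Var VUp)
       (VS ::= Plus (Var VOff) (Plus (Var VBelow) (Num 1));; VX ::= Minus (Var VUp) (Num 1);; search;; ?c) skip)
     ?Q \<sigma> m' [] t"
  proof (cases up)
    case Nil
    with found_info[OF f] f t show ?thesis
      using small assms(3) by (simp add: found_def position_def q_next_sibling_info parent_code_def skip_def)
  next
    case (Cons u us)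
    have u: "u < n" "\<sigma> VUp = Suc u" "intact m'"
      using f by (auto simp: found_def position_def Cons parent_code_def)
    have "wp w search (wp w ?c ?Q) (\<sigma>(VS := ?e, VX := u)) m' [] t"
    proof (rule wp_search[OF u(3) _ u(1)])
      fix up' b' K' \<sigma>' m'' t'
      assume g: "found u up' b' K' \<sigma>' m''" and s: "\<sigma>' VS = (\<sigma>(VS := ?e, VX := u)) VS"
        and t': "t' \<le> t + top_height root"
      from found_info[OF f] found_info(1)[OF g]
      have q: "q_next_sibling T x = (if ?e < u + Suc (fill_size K') then Some ?e else None)"
        by (simp add: q_next_sibling_info Cons)
      show "wp w ?c ?Q \<sigma>' m'' [] t'"
        using small t t' assms(3) g s unfolding q by (simp add: found_def position_def skip_def)
    qed simp
    moreover have "\<sigma> VOff = x" "\<sigma> VBelow = fill_size K" "?e \<le> n"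
      using f by (simp_all add: found_def position_def)
    ultimately show ?thesis
      using u(1,2) small by (simp del: wp.simps(3,5) add: wp.simps(5)[where e = "Var VUp"])
  qed
qed

lemma wp_LevelAncestor:
  assumes "intact m" "x < n" "2 * top_height root \<le> N" "i < 2 ^ w"
  shows "wp w (query_com LevelAncestor) (post (node_words (q_level_ancestor T x i)) N) (initial_vars [x, i]) m [] 0"
proof -
  let ?Q = "post (node_words (q_level_ancestor T x i)) N"
  let ?c = "VX ::= Var VOff;; VY ::= Var VOff;; VD ::= Minus (Plus (Var VDepth) (Num 1)) (Var VS);; descend;;
        Out (Var VOff)"
  have "wp w search (wp w (Cond (Lt (Var VS) (Plus (Var VDepth) (Num 1))) ?c skip) ?Q)
      ((initial_vars [x, i])(VS := i)) m [] 0"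
  proof (rule wp_search[OF assms(1) _ assms(2)])
    fix up b K \<sigma> m' t assume f: "found x up b K \<sigma> m'" and s: "\<sigma> VS = ((initial_vars [x, i])(VS := i)) VS"
      and t: "t \<le> 0 + top_height root"
    from found_info[OF f] have q: "q_level_ancestor T x i =
        (if i < Suc (length up) then Some (last (take (Suc (length up) - i) (rev (fst (info T ! x))))) else None)"
      by (simp add: q_level_ancestor_info)
    let ?\<sigma> = "\<sigma>(VX := x, VY := x, VD := Suc (length up) - i)"
    have "wp w descend (wp w (Out (Var VOff)) ?Q) ?\<sigma> m' [] t" if "i < Suc (length up)"
    proof (rule wp_descend_self[of _ _ x])
      fix z up' b' K' \<sigma>' m'' t'
      assume z: "z = last (take (?\<sigma> VD) (rev (fst (info T ! x))))" "found z up' b' K' \<sigma>' m''"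
        and t': "t' \<le> t + top_height root"
      then show "wp w (Out (Var VOff)) ?Q \<sigma>' m'' [] t'"
        using that t assms(3) by (simp add: q found_def position_def)
    qed (use f that in \<open>auto simp: found_def position_def\<close>)
    then show "wp w (Cond (Lt (Var VS) (Plus (Var VDepth) (Num 1))) ?c skip) ?Q \<sigma> m' [] t"
      using f s small t assms(3) q
      by (cases "i < Suc (length up)") (simp_all add: found_def position_def skip_def)
  qed (use assms in simp_all)
  then show ?thesis by simp
qed

lemma wp_NCA:
  assumes "intact m" "x < n" "y < n" "top_height root \<le> N"
  shows "wp w (query_com NCA) (post (node_words (q_nca T x y)) N) (initial_vars [x, y]) m [] 0"
proof -
  let ?Q = "post (node_words (q_nca T x y)) N"
  let ?c = "Cond (Var VRes) (Out (Minus (Var VRes) (Num 1))) (Out (Var VOff))"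
  let ?lcp = "longest_common_prefix (rev (fst (info T ! x))) (rev (fst (info T ! y)))"
  have m2: "m 2 = Suc n" using assms(1) header by (auto simp: intact_def)
  have "length ?lcp \<le> n"
    using prefix_length_le[OF longest_common_prefix_prefix1, of "rev (fst (info T ! x))" "rev (fst (info T ! y))"]
      ancestors(3)[OF assms(2)] by simp
  then have l: "fst (locate root [] 0 [] x y (Suc n)) = Suc (last ?lcp)"
    using locate_root[OF assms(2,3), of "Suc n"] by simp
  have q: "q_nca T x y = Some (last ?lcp)"
    using q_nca_info[of x T y] assms(2,3) n_eq by simp
  \<comment> \<open>Ensures that \<open>VRes\<close> holds a proper word, as the subtraction in
    \<open>?c\<close> requires.\<close>
  have less: "last ?lcp < n"
  proof -
    have "x \<in> cluster_nums root 0 (fill_size [])" using assms(2) by (simp only: cluster_nums_root)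
    from fst_entry[OF this, of "[]"] have "\<forall>u\<in>set (fst (info T ! x)). u \<in> cluster_nums root 0 (fill_size [])"
      by (auto simp: entry_root)
    then have "\<forall>u\<in>set (rev (fst (info T ! x))). u < n" by (simp only: cluster_nums_root set_rev)
    \<comment> \<open>Both lists start with the root, so their common prefix is not empty.\<close>
    moreover have "\<exists>us. rev (fst (info T ! z)) = 0 # us" if "z < n" for z
      using that n_eq by (simp add: info_path_of path_info_def map_upt_Suc del: upt_Suc)
    from this[OF assms(2)] this[OF assms(3)] have "?lcp \<noteq> []" by auto
    then have "last ?lcp \<in> set (rev (fst (info T ! x)))"
      by (rule subsetD[OF set_mono_prefix[OF longest_common_prefix_prefix1] last_in_set])
    ultimately show ?thesis by blast
  qed
  have "wp w descend (wp w ?c ?Q) ((initial_vars [x, y])(VD := Suc n)) m [] 0"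
  proof (rule wp_descend[OF assms(1)])
    fix \<sigma> m' t
    let ?v = "(initial_vars [x, y])(VD := Suc n)"
    assume a: "located (?v VS) (locate root [] 0 [] (?v VX) (?v VY) (?v VD)) \<sigma> m'" and t: "t \<le> 0 + top_height root"
    obtain r where "locate root [] 0 [] x y (Suc n) = (Suc (last ?lcp), r)"
      using l by (cases "locate root [] 0 [] x y (Suc n)") auto
    with a have "if r = None then \<sigma> VRes = Suc (last ?lcp) else \<sigma> VRes = 0 \<and> \<sigma> VOff = last ?lcp" "intact m'"
      by (auto simp: located_def split: option.splits)
    then show "wp w ?c ?Q \<sigma> m' [] t"
      using small less t assms(4) q by (auto split: if_splits)
  qed (use assms in simp_all)
  then show ?thesis using m2 small by simp
qed

end

section \<open>Decompression\<close>

abbreviation forest_words :: "nat tree list \<Rightarrow> nat list" where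
  "forest_words ts \<equiv> concat (map tree_words ts)"

text \<open>A task is to close a node, or to write a cluster with the clusters that fill its hole.\<close>

type_synonym task = "(nat top_tree \<times> nat top_tree list) option"

fun task_words :: "task \<Rightarrow> nat list" where
  "task_words None = [0]"
| "task_words (Some (c, K)) = forest_words (sem c (fill K))"

text \<open>The number of loop iterations spent on a cluster: one for each merge, and two for each
  edge, whose lower endpoint is opened and closed.\<close>

fun cluster_work :: "'a top_tree \<Rightarrow> nat" where
  "cluster_work (TEdge a b) = 2"
| "cluster_work (TMerge k A B) = Suc (cluster_work A + cluster_work B)"

fun task_work :: "task \<Rightarrow> nat" where
  "task_work None = 1"
| "task_work (Some (c, K)) = cluster_work c + sum_list (map cluster_work K)"

text \<open>A cluster of \<open>e\<close> edges results from \<open>e - 1\<close> merges, so the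
  work is \<open>3 * e - 1\<close>.\<close>

lemma cluster_work_le: "Suc (cluster_work c) \<le> 3 * csize c"
  by (induction c) auto

lemma fill_work_le: "sum_list (map cluster_work K) \<le> 3 * fill_size K"
proof (induction K)
  case (Cons c K)
  then show ?case using cluster_work_le[of c] by simp
qed simp

section \<open>Correctness of the output loop\<close>

context dag
begin

fun task_at :: "(nat \<Rightarrow> nat) \<Rightarrow> nat \<Rightarrow> nat \<Rightarrow> nat \<Rightarrow> task \<Rightarrow> bool" where
  "task_at m hp a p None \<longleftrightarrow> a = 0"
| "task_at m hp a p (Some (c, K)) \<longleftrightarrow> c \<in> V \<and> a = addr c \<and> chain m hp p K"

fun tasks :: "(nat \<Rightarrow> nat) \<Rightarrow> nat \<Rightarrow> nat \<Rightarrow> task list \<Rightarrow> bool" where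
  "tasks m hp s [] \<longleftrightarrow> s = 0"
| "tasks m hp s (\<tau> # S) \<longleftrightarrow> 0 < s \<and> s + 3 \<le> hp \<and> task_at m hp (m s) (m (s + 1)) \<tau> \<and> tasks m hp (m (s + 2)) S"

lemma task_at_upd: "task_at m hp a p \<tau> \<Longrightarrow> hp \<le> b \<Longrightarrow> task_at (m(b := v)) hp a p \<tau>"
  by (cases \<tau>) (auto intro: chain_upd)

lemma task_at_mono: "task_at m hp a p \<tau> \<Longrightarrow> hp \<le> hp' \<Longrightarrow> task_at m hp' a p \<tau>"
  by (cases \<tau>) (auto intro: chain_mono)

lemma tasks_upd: "tasks m hp s S \<Longrightarrow> hp \<le> b \<Longrightarrow> tasks (m(b := v)) hp s S"
  by (induction S arbitrary: s) (auto intro: task_at_upd)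

lemma tasks_mono: "tasks m hp s S \<Longrightarrow> hp \<le> hp' \<Longrightarrow> tasks m hp' s S"
  by (induction S arbitrary: s) (auto intro: task_at_mono)

definition emitting :: "task list \<Rightarrow> (var \<Rightarrow> nat) \<Rightarrow> (nat \<Rightarrow> nat) \<Rightarrow> bool" where
  "emitting S \<sigma> m \<longleftrightarrow> intact m \<and> length D \<le> \<sigma> VHeap \<and> tasks m (\<sigma> VHeap) (\<sigma> VS) S"

lemma wp_push_task:
  assumes "emitting S \<sigma> m" "\<sigma> VHeap + 3 < 2 ^ w"
    and e: "\<And>m. safe w e \<sigma> m" "\<And>m. val e \<sigma> m = a" and f: "\<And>m. safe w f \<sigma> m" "\<And>m. val f \<sigma> m = p"
    and \<tau>: "task_at m (\<sigma> VHeap) a p \<tau>"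
    and Q: "\<And>m'. emitting (\<tau> # S) (\<sigma>(VS := \<sigma> VHeap, VHeap := \<sigma> VHeap + 3)) m' \<Longrightarrow>
      (\<And>q K. chain m (\<sigma> VHeap) q K \<Longrightarrow> chain m' (\<sigma> VHeap + 3) q K) \<Longrightarrow>
      Q (\<sigma>(VS := \<sigma> VHeap, VHeap := \<sigma> VHeap + 3)) m' out t"
  shows "wp w (push_task e f) Q \<sigma> m out t"
proof -
  let ?h = "\<sigma> VHeap"
  let ?m = "m(?h := a, Suc ?h := p, Suc (Suc ?h) := \<sigma> VS)"
  have b: "(64 :: nat) < 2 ^ w" using word_size by simp
  have h: "0 < ?h" "length D \<le> ?h" using assms(1) header(1) by (auto simp: emitting_def)
  have up: "chain ?m (?h + 3) q K" if "chain m ?h q K" for q K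
    by (rule chain_mono[OF chain_upd[OF chain_upd[OF chain_upd[OF that]]]]) auto
  have "intact ?m" using assms(1) by (auto simp: emitting_def intro!: intact_upd)
  moreover have "tasks ?m (?h + 3) (\<sigma> VS) S"
    by (rule tasks_mono[OF tasks_upd[OF tasks_upd[OF tasks_upd]]]) (use assms(1) in \<open>auto simp: emitting_def\<close>)
  moreover have "task_at ?m (?h + 3) a p \<tau>"
    by (rule task_at_mono[OF task_at_upd[OF task_at_upd[OF task_at_upd[OF \<tau>]]]]) auto
  ultimately have "emitting (\<tau> # S) (\<sigma>(VS := ?h, VHeap := ?h + 3)) ?m"
    using h by (simp add: emitting_def)
  from Q[OF this up] show ?thesis
    using b assms(2) by (simp add: push_task_def e f)
qed

text \<open>The task is replaced by tasks with the same output and one unit of work less. Six words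
  suffice for two tasks of three words, or for a list cell and a task.\<close>

lemma wp_emit_merge:
  assumes "emitting S \<sigma> m" "\<sigma> VHeap + 6 < 2 ^ w" "TMerge k A B \<in> V"
    and "\<sigma> VC = addr (TMerge k A B)" "\<sigma> VKind = kind (TMerge k A B)" "chain m (\<sigma> VHeap) (\<sigma> VFill) K"
    and Q: "\<And>\<sigma>' m' S'. emitting (S' @ S) \<sigma>' m' \<Longrightarrow>
      concat (map task_words S') = task_words (Some (TMerge k A B, K)) \<Longrightarrow>
      Suc (sum_list (map task_work S')) = task_work (Some (TMerge k A B, K)) \<Longrightarrow>
      \<sigma>' VHeap \<le> \<sigma> VHeap + 6 \<Longrightarrow> Q \<sigma>' m' out t"
  shows "wp w emit_merge Q \<sigma> m out t"
proof -
  let ?c = "TMerge k A B"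
  have c: "A \<in> V" "B \<in> V" using children_in[OF assms(3)] by auto
  have m: "intact m" "length D \<le> \<sigma> VHeap" "tasks m (\<sigma> VHeap) (\<sigma> VS) S"
    using assms(1) by (simp_all add: emitting_def)
  note fld = intact_TMerge[OF m(1) assms(3)]
  have b: "(64 :: nat) < 2 ^ w" "addr ?c + 8 < 2 ^ w" using word_size addr[OF assms(3)] by auto
  have hp: "0 < \<sigma> VHeap" using m(2) header(1) by linarith
  define v where "v = \<sigma>(VX := addr A, VY := addr B)"
  have v: "v VX = addr A" "v VY = addr B" "v VHeap = \<sigma> VHeap" "v VFill = \<sigma> VFill" "v VS = \<sigma> VS"
    "v VKind = kind ?c" "emitting S v m"
    using assms by (simp_all add: v_def emitting_def)
  let ?P = "wp w (push_task (Var VX) (Var VFill)) Q"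
  have goal: "wp w emit_merge Q \<sigma> m out t"
    if "wp w (Cond (Eq (Var VKind) (Num 1))
      (Write (Var VHeap) (Var VY);; Write (Plus (Var VHeap) (Num 1)) (Var VFill);;
       VFill ::= Var VHeap;; VHeap ::= Plus (Var VHeap) (Num 2))
      (Cond (Eq (Var VKind) (Num 2)) (push_task (Var VY) (Var VFill);; VFill ::= Num 0)
         (push_task (Var VY) (Num 0)))) ?P v m out t"
    using that b assms(4) unfolding emit_merge_def wp.simps(4)[of _ _ "Seq _ _"] wp.simps(4)[of _ "Cond _ _ _"] v_def
    by (simp add: fld del: wp.simps(4,5))
  consider "vertical k" | "\<not> vertical k" "k = HRight" | "\<not> vertical k" "k \<noteq> HRight" by blast
  then show ?thesis
  proof cases
    case 1
    let ?h = "\<sigma> VHeap"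
    let ?m = "m(?h := addr B, Suc ?h := \<sigma> VFill)"
    let ?v = "v(VFill := ?h, VHeap := ?h + 2)"
    have em: "emitting S ?v ?m"
      using m v by (auto simp: emitting_def intro!: intact_upd tasks_mono[OF tasks_upd[OF tasks_upd]])
    have "chain ?m (?h + 2) (\<sigma> VFill) K"
      by (rule chain_mono[OF chain_upd[OF chain_upd[OF assms(6)]]]) auto
    then have ch: "chain ?m (?v VHeap) ?h (B # K)" using hp c by simp
    have "?P ?v ?m out t"
    proof (rule wp_push_task[OF em])
      show "task_at ?m (?v VHeap) (addr A) ?h (Some (A, B # K))" using ch c by simp
      fix m' assume e: "emitting (Some (A, B # K) # S) (?v(VS := ?v VHeap, VHeap := ?v VHeap + 3)) m'"
      show "Q (?v(VS := ?v VHeap, VHeap := ?v VHeap + 3)) m' out t"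
        by (rule Q[of "[Some (A, B # K)]"]) (use e 1 in simp_all)
    qed (use assms(2) v in simp_all)
    then show ?thesis using 1 b v assms(2) by (intro goal) simp
  next
    case 2
    have "wp w (push_task (Var VY) (Var VFill)) (wp w (VFill ::= Num 0) ?P) v m out t"
    proof (rule wp_push_task[OF v(7)])
      show "task_at m (v VHeap) (addr B) (\<sigma> VFill) (Some (B, K))" using assms(6) c v by simp
      fix m' 
      let ?v = "v(VS := v VHeap, VHeap := v VHeap + 3)"
      assume e: "emitting (Some (B, K) # S) ?v m'"
      then have e: "emitting (Some (B, K) # S) (?v(VFill := 0)) m'" by (simp add: emitting_def)
      have "?P (?v(VFill := 0)) m' out t"
      proof (rule wp_push_task[OF e])
        let ?v' = "?v(VFill := 0)"
        show "task_at m' (?v' VHeap) (addr A) 0 (Some (A, []))" using c by simp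
        fix m'' assume e: "emitting (Some (A, []) # Some (B, K) # S) (?v'(VS := ?v' VHeap, VHeap := ?v' VHeap + 3)) m''"
        show "Q (?v'(VS := ?v' VHeap, VHeap := ?v' VHeap + 3)) m'' out t"
          by (rule Q[of "[Some (A, []), Some (B, K)]"]) (use e 2 v in simp_all)
      qed (use assms(2) v in simp_all)
      then show "wp w (VFill ::= Num 0) ?P ?v m' out t" by simp
    qed (use assms(2) v in simp_all)
    then show ?thesis using 2 b v by (intro goal) simp
  next
    case 3
    have "wp w (push_task (Var VY) (Num 0)) ?P v m out t"
    proof (rule wp_push_task[OF v(7)])
      show "task_at m (v VHeap) (addr B) 0 (Some (B, []))" using c v by simp
      fix m' 
      let ?v = "v(VS := v VHeap, VHeap := v VHeap + 3)"
      assume e: "emitting (Some (B, []) # S) ?v m'"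
        and ch: "\<And>q K. chain m (v VHeap) q K \<Longrightarrow> chain m' (v VHeap + 3) q K"
      show "?P ?v m' out t"
      proof (rule wp_push_task[OF e])
        show "task_at m' (?v VHeap) (addr A) (\<sigma> VFill) (Some (A, K))" using c ch assms(6) v by simp
        fix m'' assume e: "emitting (Some (A, K) # Some (B, []) # S) (?v(VS := ?v VHeap, VHeap := ?v VHeap + 3)) m''"
        show "Q (?v(VS := ?v VHeap, VHeap := ?v VHeap + 3)) m'' out t"
          by (rule Q[of "[Some (A, K), Some (B, [])]"]) (use e 3 v in simp_all)
      qed (use assms(2) v in simp_all)
    qed (use assms(2) v in simp_all)
    then show ?thesis using 3 b v by (intro goal) simp
  qed
qed

lemma wp_emit_edge:
  assumes "emitting S \<sigma> m" "\<sigma> VHeap + 6 < 2 ^ w" "TEdge a l \<in> V"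
    and "\<sigma> VC = addr (TEdge a l)" "chain m (\<sigma> VHeap) (\<sigma> VFill) K"
    and Q: "\<And>\<sigma>' m' S'. emitting (S' @ S) \<sigma>' m' \<Longrightarrow>
      [1, l] @ concat (map task_words S') = task_words (Some (TEdge a l, K)) \<Longrightarrow>
      Suc (sum_list (map task_work S')) = task_work (Some (TEdge a l, K)) \<Longrightarrow>
      \<sigma>' VHeap \<le> \<sigma> VHeap + 6 \<Longrightarrow> Q \<sigma>' m' (out @ [1, l]) t"
  shows "wp w emit_edge Q \<sigma> m out t"
proof -
  let ?c = "TEdge a l"
  have m: "intact m" "length D \<le> \<sigma> VHeap" "tasks m (\<sigma> VHeap) (\<sigma> VS) S"
    using assms(1) by (simp_all add: emitting_def)
  note fld = intact_TEdge[OF m(1) assms(3)]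
  have b: "(64 :: nat) < 2 ^ w" "addr ?c + 8 < 2 ^ w" using word_size addr[OF assms(3)] by auto
  let ?C = "Cond (Var VFill) (VX ::= Mem (Var VFill);; VY ::= Mem (Plus (Var VFill) (Num 1));; push_task (Var VX) (Var VY))
      skip"
  have "wp w (push_task (Num 0) (Num 0)) (wp w ?C Q) \<sigma> m (out @ [1, l]) t"
  proof (rule wp_push_task[OF assms(1)])
    show "task_at m (\<sigma> VHeap) 0 0 None" by simp
    let ?v = "\<sigma>(VS := \<sigma> VHeap, VHeap := \<sigma> VHeap + 3)"
    fix m'
    assume e: "emitting (None # S) ?v m'"
        and ch: "\<And>q K. chain m (\<sigma> VHeap) q K \<Longrightarrow> chain m' (\<sigma> VHeap + 3) q K"
    show "wp w ?C Q ?v m' (out @ [1, l]) t"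
    proof (cases K)
      case Nil
      then have "\<sigma> VFill = 0" using assms(5) by simp
      moreover have "emitting (None # S) (?v(VE := 0)) m'" using e by (simp add: emitting_def)
      then have "Q (?v(VE := 0)) m' (out @ [1, l]) t"
        by (intro Q[of "[None]"]) (simp_all add: Nil)
      ultimately show ?thesis by (simp add: skip_def)
    next
      case (Cons d K')
      let ?v' = "?v(VX := addr d, VY := m' (Suc (\<sigma> VFill)))"
      from ch[OF assms(5)] have d: "0 < \<sigma> VFill" "m' (\<sigma> VFill) = addr d" "d \<in> V"
        "chain m' (\<sigma> VHeap + 3) (m' (Suc (\<sigma> VFill))) K'" "\<sigma> VFill + 2 \<le> \<sigma> VHeap + 3"
        by (simp_all add: Cons)
      have e': "emitting (None # S) ?v' m'" using e by (simp add: emitting_def)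
      have "wp w (push_task (Var VX) (Var VY)) Q ?v' m' (out @ [1, l]) t"
      proof (rule wp_push_task[OF e'])
        show "task_at m' (?v' VHeap) (addr d) (m' (Suc (\<sigma> VFill))) (Some (d, K'))" using d by simp
        fix m'' assume e: "emitting (Some (d, K') # None # S) (?v'(VS := ?v' VHeap, VHeap := ?v' VHeap + 3)) m''"
        show "Q (?v'(VS := ?v' VHeap, VHeap := ?v' VHeap + 3)) m'' (out @ [1, l]) t"
          by (rule Q[of "[Some (d, K'), None]"]) (use e in \<open>simp_all add: Cons\<close>)
      qed (use assms(2) in simp_all)
      then show ?thesis using d b assms(2) by simp
    qed
  qed (use assms(2) in simp_all)
  then show ?thesis using b assms(4) by (simp add: emit_edge_def fld)
qed

text \<open>Induction on the remaining work. Each iteration lowers it by 1 and uses at most six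
  words of the heap, which explains the bound on the addresses.\<close>

lemma wp_emit_loop:
  assumes "emitting S \<sigma> m" "\<sigma> VHeap + 6 * sum_list (map task_work S) + 6 < 2 ^ w"
    and "\<And>\<sigma>' m' t'. intact m' \<Longrightarrow> t' \<le> t + sum_list (map task_work S) \<Longrightarrow>
      Q \<sigma>' m' (out @ concat (map task_words S)) t'"
  shows "wp w (While (Var VS) emit_body) Q \<sigma> m out t"
  using assms
proof (induction "sum_list (map task_work S)" arbitrary: S \<sigma> m out t rule: less_induct)
  case less
  show ?case
  proof (cases S)
    case Nil
    with less.prems(1) have "\<sigma> VS = 0" "intact m" by (simp_all add: emitting_def)
    with less.prems(3)[of m t \<sigma>] Nil show ?thesis by (subst wp_While) simp
  next
    case (Cons \<tau> S')
    have b: "(64 :: nat) < 2 ^ w" using word_size by simp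
    define W where "W = wp w (While (Var VS) emit_body) Q"
    let ?v = "\<sigma>(VC := m (\<sigma> VS), VFill := m (\<sigma> VS + 1), VS := m (\<sigma> VS + 2))"
    from less.prems(1) have s: "0 < \<sigma> VS" "\<sigma> VS + 3 \<le> \<sigma> VHeap"
      "task_at m (\<sigma> VHeap) (m (\<sigma> VS)) (m (\<sigma> VS + 1)) \<tau>" "emitting S' ?v m" "intact m"
      by (simp_all add: Cons emitting_def)
    have IH: "W \<sigma>' m' out' (Suc t)"
      if "emitting (R @ S') \<sigma>' m'" "out' @ concat (map task_words R) = out @ task_words \<tau>"
        "Suc (sum_list (map task_work R)) = task_work \<tau>" "\<sigma>' VHeap \<le> \<sigma> VHeap + 6" for R \<sigma>' m' out'
      unfolding W_def
    proof (rule less.hyps[of "R @ S'"])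
      show "sum_list (map task_work (R @ S')) < sum_list (map task_work S)" using that(3) by (simp add: Cons)
      show "\<sigma>' VHeap + 6 * sum_list (map task_work (R @ S')) + 6 < 2 ^ w"
        using that(3,4) less.prems(2) by (simp add: Cons)
      fix \<sigma>'' m'' t' assume "intact m''" "t' \<le> Suc t + sum_list (map task_work (R @ S'))"
      then have "Q \<sigma>'' m'' (out @ concat (map task_words S)) t'"
        using that(3) by (intro less.prems(3)) (auto simp: Cons)
      moreover have "out @ concat (map task_words S) = out' @ concat (map task_words (R @ S'))"
        using that(2) by (simp add: Cons flip: append_assoc)
      ultimately show "Q \<sigma>'' m'' (out' @ concat (map task_words (R @ S'))) t'" by simp
    qed (rule that(1))
    have "wp w (Cond (Var VC) (VKind ::= Mem (Var VC);; Cond (Var VKind) emit_merge emit_edge) (Out (Num 0)))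
      W ?v m out (Suc t)"
    proof (cases \<tau>)
      case None
      then have "W ?v m (out @ [0]) (Suc t)"
        using s(4) by (intro IH[of "[]"]) simp_all
      with s(3) b None show ?thesis by simp
    next
      case (Some cK)
      obtain c K where cK: "cK = (c, K)" by fastforce
      let ?v' = "?v(VKind := kind c)"
      have c: "c \<in> V" "m (\<sigma> VS) = addr c" "chain m (\<sigma> VHeap) (m (\<sigma> VS + 1)) K"
        using s(3) by (simp_all add: Some cK)
      have e: "emitting S' ?v' m" using s(4) by (simp add: emitting_def)
      have "wp w (Cond (Var VKind) emit_merge emit_edge) W ?v' m out (Suc t)"
      proof (cases c)
        case (TEdge a l)
        have "wp w emit_edge W ?v' m out (Suc t)"
        proof (rule wp_emit_edge[OF e])
          show "chain m (?v' VHeap) (?v' VFill) K" using c by simp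
          show "TEdge a l \<in> V" "?v' VC = addr (TEdge a l)" using c TEdge by simp_all
          fix \<sigma>' m' R assume "emitting (R @ S') \<sigma>' m'"
            "[1, l] @ concat (map task_words R) = task_words (Some (TEdge a l, K))"
            "Suc (sum_list (map task_work R)) = task_work (Some (TEdge a l, K))" "\<sigma>' VHeap \<le> ?v' VHeap + 6"
          then show "W \<sigma>' m' (out @ [1, l]) (Suc t)"
            by (intro IH[of R]) (simp_all add: Some cK TEdge)
        qed (use less.prems(2) in simp)
        then show ?thesis by (simp add: TEdge)
      next
        case (TMerge k A B)
        have "wp w emit_merge W ?v' m out (Suc t)"
        proof (rule wp_emit_merge[OF e])
          show "chain m (?v' VHeap) (?v' VFill) K" using c by simp
          show "TMerge k A B \<in> V" "?v' VC = addr (TMerge k A B)" "?v' VKind = kind (TMerge k A B)"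
            using c TMerge by simp_all
          fix \<sigma>' m' R assume "emitting (R @ S') \<sigma>' m'"
            "concat (map task_words R) = task_words (Some (TMerge k A B, K))"
            "Suc (sum_list (map task_work R)) = task_work (Some (TMerge k A B, K))" "\<sigma>' VHeap \<le> ?v' VHeap + 6"
          then show "W \<sigma>' m' out (Suc t)"
            by (intro IH[of R]) (simp_all add: Some cK TMerge)
        qed (use less.prems(2) in simp)
        then show ?thesis by (simp add: TMerge)
      qed
      then show ?thesis using addr[OF c(1)] c intact_kind[OF s(5) c(1)] by (cases "kind c = 0") simp_all
    qed
    then have "wp w emit_body W \<sigma> m out (Suc t)"
      using s(1,2) b less.prems(2) by (simp add: emit_body_def del: wp.simps(5))
    then show ?thesis
      using s(1) unfolding W_def by (subst wp_While) simp
  qed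
qed

end

context represented_tree
begin

lemma wp_Decompress:
  assumes "intact m" "x < n" "top_height root + 3 * num_nodes (q_decompress T x) \<le> N"
  shows "wp w (query_com Decompress) (post (tree_words (q_decompress T x)) N) (initial_vars [x]) m [] 0"
  unfolding query_com.simps wp.simps(4)
proof (rule wp_search[OF assms(1) _ assms(2)])
  show "initial_vars [x] VX = x" by simp
  let ?Q = "post (tree_words (q_decompress T x)) N"
  fix up b K \<sigma> m' t assume f: "found x up b K \<sigma> m'" and t: "t \<le> 0 + top_height root"
  from f obtain a where a: "TEdge a b \<in> V" "\<sigma> VC = addr (TEdge a b)" by (auto simp: found_def)
  have q: "q_decompress T x = Node b (fill K)"
    using found_info[OF f] by (simp add: q_decompress_info)
  have bounds: "\<sigma> VHeap \<le> length D + 2 * n" "Suc x + fill_size K \<le> n" "length D \<le> \<sigma> VHeap"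
    "chain m' (\<sigma> VHeap) (\<sigma> VFill) K" "intact m'"
    using f by (simp_all add: found_def position_def)
  let ?\<tau> = "Some (TEdge a b, K) :: task"
  \<comment> \<open>The edge above \<open>x\<close> takes 2, the clusters below at most 3 per
    node.\<close>
  have work: "task_work ?\<tau> \<le> 3 * num_nodes (q_decompress T x)" using fill_work_le[of K] by (simp add: q)
  let ?\<sigma> = "\<sigma>(VS := 0)"
  have e: "emitting [] ?\<sigma> m'" using bounds by (simp add: emitting_def)
  have "wp w (push_task (Var VC) (Var VFill)) (wp w (While (Var VS) emit_body) ?Q) ?\<sigma> m' [] t"
  proof (rule wp_push_task[OF e])
    show "task_at m' (?\<sigma> VHeap) (addr (TEdge a b)) (\<sigma> VFill) ?\<tau>" using a bounds by simp
    fix m'' assume e: "emitting [?\<tau>] (?\<sigma>(VS := ?\<sigma> VHeap, VHeap := ?\<sigma> VHeap + 3)) m''"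
    show "wp w (While (Var VS) emit_body) ?Q (?\<sigma>(VS := ?\<sigma> VHeap, VHeap := ?\<sigma> VHeap + 3)) m'' [] t"
    proof (rule wp_emit_loop[OF e])
      show "(?\<sigma>(VS := ?\<sigma> VHeap, VHeap := ?\<sigma> VHeap + 3)) VHeap + 6 * sum_list (map task_work [?\<tau>]) + 6 < 2 ^ w"
        using bounds(1,2) fill_work_le[of K] word_size by simp
      fix \<sigma>' m''' t' assume "intact m'''" "t' \<le> t + sum_list (map task_work [?\<tau>])"
      then show "?Q \<sigma>' m''' ([] @ concat (map task_words [?\<tau>])) t'"
        using t work assms(3) by (simp add: q)
    qed
  qed (use a bounds word_size in simp_all)
  then show "wp w emit ?Q \<sigma> m' [] t" by (simp add: emit_def)
qed

end

section \<open>The representation\<close>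

lemma finite_rooted_subtrees: "finite (rooted_subtrees c)"
  by (induction c) auto

lemma rooted_subtrees_self: "c \<in> rooted_subtrees c"
  by (cases c) auto

lemma rooted_subtrees_children:
  "TMerge k A B \<in> rooted_subtrees c \<Longrightarrow> A \<in> rooted_subtrees c \<and> B \<in> rooted_subtrees c"
  by (induction c) (auto simp: rooted_subtrees_self)

text \<open>A binary tree with \<open>l\<close> leaves has \<open>2 * l - 1\<close> nodes, and
  sharing can only reduce their number. So the addresses in the representation are linear in the
  size of the tree and fit in a word.\<close>

lemma card_rooted_subtrees: "Suc (card (rooted_subtrees c)) \<le> 2 * csize c"
proof (induction c)
  case (TMerge k A B)
  have "card (rooted_subtrees (TMerge k A B)) \<le> Suc (card (rooted_subtrees A \<union> rooted_subtrees B))"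
    by (simp add: card_insert_if finite_rooted_subtrees)
  also have "\<dots> \<le> Suc (card (rooted_subtrees A) + card (rooted_subtrees B))"
    by (simp add: card_Un_le)
  finally show ?case using TMerge by simp
qed simp

lemma csize_rooted_subtrees: "c \<in> rooted_subtrees d \<Longrightarrow> csize c \<le> csize d"
  by (induction d) auto

text \<open>Filling a hole loses no label, so all labels stored in the top DAG occur in the tree and
  fit in a word.\<close>

lemma labels_sem:
  "(\<Union>t\<in>set h. set_tree t) \<subseteq> (\<Union>t\<in>set (sem c h). set_tree t)"
  "TEdge a b \<in> rooted_subtrees c \<Longrightarrow> b \<in> (\<Union>t\<in>set (sem c h). set_tree t)"
proof -
  show *: "(\<Union>t\<in>set h. set_tree t) \<subseteq> (\<Union>t\<in>set (sem c h). set_tree t)" for c :: "'a top_tree" and h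
  proof (induction c arbitrary: h)
    case (TMerge k A B)
    have "(\<Union>t\<in>set h. set_tree t) \<subseteq> (\<Union>t\<in>set (sem A (sem B h)). set_tree t)"
      using TMerge(2)[of h] TMerge(1)[of "sem B h"] by (rule subset_trans)
    then show ?case using TMerge(1)[of h] TMerge(2)[of h] by auto
  qed auto
  show "TEdge a b \<in> rooted_subtrees c \<Longrightarrow> b \<in> (\<Union>t\<in>set (sem c h). set_tree t)"
  proof (induction c arbitrary: h)
    case (TMerge k A B)
    then consider "TEdge a b \<in> rooted_subtrees A" | "TEdge a b \<in> rooted_subtrees B" by auto
    then show ?case
    proof cases
      case 1
      then show ?thesis using TMerge.IH(1) by (auto simp: bex_Un)
    next
      case 2
      then show ?thesis using TMerge.IH(2)[of h] TMerge.IH(2)[of "[]"] *[of "sem B h" A] by auto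
    qed
  qed simp
qed

text \<open>The additional edge above the root of \<open>T\<close> makes this root an ordinary node of the cluster.\<close>

definition rooted_top_tree :: "'a tree \<Rightarrow> 'a top_tree" where
  "rooted_top_tree T = TMerge VNoBottom (TEdge (label T) (label T)) (top_tree T)"

lemma represented_treeI:
  fixes T :: "nat tree" and root :: "nat top_tree"
  defines "root \<equiv> rooted_top_tree T"
  assumes n: "2 \<le> num_nodes T" and w: "512 * num_nodes T \<le> 2 ^ w" and labels: "\<forall>a\<in>set_tree T. a < 2 ^ w"
  obtains D addr where "represented_tree w (num_nodes T) D addr (rooted_subtrees root) root T"
    "length D = 3 + 8 * card (rooted_subtrees root)" "\<forall>a\<in>set D. a < 2 ^ w"
proof -
  let ?V = "rooted_subtrees root"
  let ?n = "num_nodes T"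
  let ?N = "card ?V"
  have sem: "sem root [] = [T]"
    using top_tree_correct(1)[OF n] by (cases T) (simp add: root_def rooted_top_tree_def)
  then have csize: "csize root = ?n" using forest_size_sem[of root "[]"] by simp
  \<comment> \<open>Any numbering of the vertices will do; vertex number \<open>i\<close> occupies
    the eight words from address \<open>3 + 8 * i\<close> on.\<close>
  obtain h where h: "bij_betw h ?V {0..<?N}"
    using ex_bij_betw_finite_nat[OF finite_rooted_subtrees] by blast
  define g where "g = inv_into ?V h"
  have gh: "g (h c) = c" "h c < ?N" if "c \<in> ?V" for c
    using that h unfolding g_def by (auto simp: bij_betw_def inv_into_f_f)
  have gV: "g i \<in> ?V" if "i < ?N" for i
    using that h unfolding g_def bij_betw_def by (metis atLeastLessThan_iff inv_into_into le0)
  define addr where "addr c = 3 + 8 * h c" for c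
  define D where "D = [3 + 8 * ?N, addr root, Suc ?n] @
    map (\<lambda>p. vertex_words addr (g (p div 8)) ! (p mod 8)) [0..<8 * ?N]"
  have len: "length D = 3 + 8 * ?N" by (simp add: D_def)
  \<comment> \<open>At most \<open>2 * n - 1\<close> vertices make \<open>length D\<close> at most
    \<open>16 * n - 5\<close>; the sum is then at most \<open>80 * n + 59\<close>, which is below
    \<open>512 * n\<close>.\<close>
  have size: "length D + 64 * ?n + 64 < 2 ^ w"
    using card_rooted_subtrees[of root] n w unfolding len csize by linarith
  have addr: "0 < addr c \<and> addr c + 8 \<le> length D" if "c \<in> ?V" for c
    using gh(2)[OF that] by (simp add: addr_def len)
  have rep: "represented_tree w ?n D addr ?V root T"
  proof
    show "A \<in> ?V \<and> B \<in> ?V" if "TMerge k A B \<in> ?V" for k A B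
      using that by (rule rooted_subtrees_children)
    show "0 < addr c \<and> addr c + 8 \<le> length D" if "c \<in> ?V" for c using that by (rule addr)
    show "D ! (addr c + i) = vertex_words addr c ! i" if "c \<in> ?V" "i < 8" for c i
    proof -
      have "D ! (addr c + i) = vertex_words addr (g ((8 * h c + i) div 8)) ! ((8 * h c + i) mod 8)"
        using gh(2)[OF that(1)] that(2) by (simp add: D_def addr_def nth_append nth_Cons' numeral_3_eq_3)
      then show ?thesis using that gh(1) by simp
    qed
    show "3 \<le> length D" "D ! 0 = length D" "D ! 1 = addr root" "D ! 2 = Suc ?n"
      by (simp_all add: len) (simp_all add: D_def)
    show "root \<in> ?V" by (rule rooted_subtrees_self)
    show "csize root = ?n" by (rule csize)
    show "length D + 64 * ?n + 64 < 2 ^ w" by (rule size)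
    show "sem root [] = [T]" by (rule sem)
  qed
  have small: "csize c \<le> ?n" if "c \<in> ?V" for c
    using csize_rooted_subtrees[OF that] csize by simp
  have words: "a < 2 ^ w" if "c \<in> ?V" "a \<in> set (vertex_words addr c)" for a c
  proof (cases c)
    case (TEdge l b)
    then have "b \<in> set_tree T" using labels_sem(2)[of l b root "[]"] that(1) sem by simp
    then show ?thesis using that(2) TEdge labels by auto
  next
    case (TMerge k A B)
    then have AB: "A \<in> ?V" "B \<in> ?V" using that(1) rooted_subtrees_children by blast+
    have "a \<le> max 3 (max (max (addr A) (addr B)) ?n)"
      using that(2) small[OF AB(1)] small[OF AB(2)] cluster_bounds[of A] cluster_bounds[of B]
      by (auto simp: TMerge split: if_splits)
    then show ?thesis using addr[OF AB(1)] addr[OF AB(2)] size by linarith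
  qed
  have "a < 2 ^ w" if a: "a \<in> set D" for a
  proof -
    have lw: "length (vertex_words addr c) = 8" for c by (cases c) simp_all
    have "a < 2 ^ w" if "p < 8 * ?N" "a = vertex_words addr (g (p div 8)) ! (p mod 8)" for p
    proof (rule words)
      show "g (p div 8) \<in> ?V" using that(1) by (intro gV) (simp add: less_mult_imp_div_less mult.commute)
      show "a \<in> set (vertex_words addr (g (p div 8)))" using that(2) lw by simp
    qed
    then show ?thesis
      using a size addr[OF rooted_subtrees_self[of root]] by (auto simp: D_def len)
  qed
  with that rep len show ?thesis by blast
qed

definition query_programs :: "query \<Rightarrow> program" where
  "query_programs q = compile 0 (query_com q)"

definition program_length :: nat where
  "program_length = sum_list (map (\<lambda>q. length (query_programs q))
     [Access, Depth, Height, Size, Parent, Firstchild, NextSibling, LevelAncestor, NCA, Decompress])"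

lemma length_query_programs: "length (query_programs q) \<le> program_length"
  by (cases q) (simp_all add: program_length_def)

lemma (in represented_tree) answers_query:
  assumes "\<And>m. intact m \<Longrightarrow> wp w (query_com q) (post ans N) (initial_vars args) m [] 0"
    and "real (Suc N * program_length) \<le> \<tau>"
  shows "answers w D (query_programs q) args \<tau> ans"
  unfolding query_programs_def
proof (rule answersI)
  show "0 < w" using small(1) by (cases w) simp_all
  show "wp w (query_com q) (\<lambda>\<sigma> m' out t. out = ans \<and> t \<le> N \<and> (\<forall>a < length D. m' a = D ! a)) (initial_vars args) m [] 0"
    if "\<forall>a < length D. m a = D ! a" for m
    using assms(1)[of m] that by (simp add: intact_def)
  have "Suc N * length (compile 0 (query_com q)) \<le> Suc N * program_length"
    using length_query_programs[of q] unfolding query_programs_def by (rule mult_le_mono2)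
  then have "real (Suc N * length (compile 0 (query_com q))) \<le> real (Suc N * program_length)"
    by (rule of_nat_mono)
  with assms(2) show "real (Suc N * length (compile 0 (query_com q))) \<le> \<tau>" by linarith
qed

text \<open>The assumption gives \<open>n ^ 10 \<le> 2 ^ w\<close>, and
  \<open>512 \<le> n ^ 9\<close> because \<open>n\<close> is at least 2.\<close>

lemma word_size_bound:
  assumes "2 \<le> n" "10 * log 2 (real n) \<le> real w"
  shows "512 * n \<le> 2 ^ w"
proof -
  have "log 2 (real n ^ 10) \<le> real w" using assms by (simp add: log_nat_power)
  then have "real n ^ 10 \<le> 2 powr real w"
    using assms(1) by (subst (asm) log_le_iff) auto
  also have "\<dots> = 2 ^ w" by (simp add: powr_realpow)
  finally have "real (n ^ 10) \<le> real (2 ^ w)" by simp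
  then have "n ^ 10 \<le> 2 ^ w" by (simp only: of_nat_le_iff)
  moreover have "512 * n \<le> n ^ 9 * n" using power_mono[OF assms(1), of 9] by (intro mult_le_mono1) simp
  moreover have "n ^ 10 = n ^ 9 * n" by (simp add: numeral_eq_Suc)
  ultimately show ?thesis by linarith
qed

theorem theorem3:
  shows "\<exists>k :: real. \<forall>K :: real. \<exists>(c :: real) (prog :: query \<Rightarrow> program).
    \<forall>(T :: nat tree) (w :: nat).
      let n = num_nodes T; lg = log 2 (real n) in
      n \<ge> 2 \<and> k * lg \<le> real w \<and> real w \<le> K * lg \<and> (\<forall>a \<in> set_tree T. a < 2 ^ w) \<longrightarrow>
      (\<exists>D :: nat list.
         real (length D) \<le> c * real (top_dag_size T) \<and>
         (\<forall>a \<in> set D. a < 2 ^ w) \<and>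
         (\<forall>x < n.
            answers w D (prog Access) [x] (c * lg) [q_access T x] \<and>
            answers w D (prog Depth) [x] (c * lg) [q_depth T x] \<and>
            answers w D (prog Height) [x] (c * lg) [q_height T x] \<and>
            answers w D (prog Size) [x] (c * lg) [q_size T x] \<and>
            answers w D (prog Parent) [x] (c * lg) (node_words (q_parent T x)) \<and>
            answers w D (prog Firstchild) [x] (c * lg) (node_words (q_first_child T x)) \<and>
            answers w D (prog NextSibling) [x] (c * lg) (node_words (q_next_sibling T x)) \<and>
            (\<forall>i < 2 ^ w.
               answers w D (prog LevelAncestor) [x, i] (c * lg)
                 (node_words (q_level_ancestor T x i))) \<and>
            (\<forall>y < n. answers w D (prog NCA) [x, y] (c * lg) (node_words (q_nca T x y))) \<and>
            answers w D (prog Decompress) [x]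
              (c * (lg + real (num_nodes (q_decompress T x)))) (tree_words (q_decompress T x))))"
proof -
  \<comment> \<open>19 = 1 + 2 * 9 stands for two searches of at most \<open>9 * lg\<close>
    iterations each, 27 for the space.\<close>
  define c where "c = 19 * real program_length + 27"
  have main: "\<exists>D :: nat list.
         real (length D) \<le> c * real (top_dag_size T) \<and>
         (\<forall>a \<in> set D. a < 2 ^ w) \<and>
         (\<forall>x < n.
            answers w D (query_programs Access) [x] (c * lg) [q_access T x] \<and>
            answers w D (query_programs Depth) [x] (c * lg) [q_depth T x] \<and>
            answers w D (query_programs Height) [x] (c * lg) [q_height T x] \<and>
            answers w D (query_programs Size) [x] (c * lg) [q_size T x] \<and>
            answers w D (query_programs Parent) [x] (c * lg) (node_words (q_parent T x)) \<and>
            answers w D (query_programs Firstchild) [x] (c * lg) (node_words (q_first_child T x)) \<and>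
            answers w D (query_programs NextSibling) [x] (c * lg) (node_words (q_next_sibling T x)) \<and>
            (\<forall>i < 2 ^ w.
               answers w D (query_programs LevelAncestor) [x, i] (c * lg)
                 (node_words (q_level_ancestor T x i))) \<and>
            (\<forall>y < n. answers w D (query_programs NCA) [x, y] (c * lg) (node_words (q_nca T x y))) \<and>
            answers w D (query_programs Decompress) [x]
              (c * (lg + real (num_nodes (q_decompress T x)))) (tree_words (q_decompress T x)))"
    if n: "n = num_nodes T" and lg: "lg = log 2 (real n)" and "2 \<le> n" "10 * lg \<le> real w"
      and labels: "\<forall>a \<in> set_tree T. a < 2 ^ w" for T :: "nat tree" and w n :: nat and lg :: real
  proof -
    let ?root = "rooted_top_tree T"
    let ?h = "top_height ?root"
    have n2: "2 \<le> num_nodes T" using that by simp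
    have "512 * num_nodes T \<le> 2 ^ w" using word_size_bound[of n w] that by simp
    from represented_treeI[OF n2 this labels]
    obtain D addr where rep: "represented_tree w n D addr (rooted_subtrees ?root) ?root T"
      and len: "length D = 3 + 8 * card (rooted_subtrees ?root)" and D_words: "\<forall>a\<in>set D. a < 2 ^ w"
      unfolding n by blast
    interpret represented_tree w n D addr "rooted_subtrees ?root" ?root T by (rule rep)
    have lg1: "1 \<le> lg" using \<open>2 \<le> n\<close> by (simp add: lg)
    \<comment> \<open>The level of the additional edge above the root is absorbed since
      \<open>lg\<close> is at least 1.\<close>
    have h: "real ?h \<le> 9 * lg"
    proof -
      have "real (top_height (top_tree T)) \<le> 8 * lg"
        using top_tree_correct(2)[OF n2] by (simp only: lg n)
      moreover have "real ?h = 1 + real (top_height (top_tree T))" by (simp add: rooted_top_tree_def)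
      ultimately show ?thesis using lg1 by linarith
    qed
    have time: "real (Suc (2 * ?h) * program_length) \<le> c * lg"
    proof -
      have "real (Suc (2 * ?h)) \<le> 19 * lg" using h lg1 by simp
      then have "real (Suc (2 * ?h)) * real program_length \<le> 19 * lg * real program_length"
        by (rule mult_right_mono) simp
      also have "\<dots> \<le> c * lg" using lg1 by (simp add: c_def algebra_simps)
      finally show ?thesis by (simp only: of_nat_mult)
    qed
    have time': "real (Suc (?h + 3 * s) * program_length) \<le> c * (lg + real s)" for s
    proof -
      have "real (Suc (?h + 3 * s)) \<le> 19 * (lg + real s)" using h lg1 by simp
      then have "real (Suc (?h + 3 * s)) * real program_length \<le> 19 * (lg + real s) * real program_length"
        by (rule mult_right_mono) simp
      also have "\<dots> \<le> c * (lg + real s)" using lg1 by (simp add: c_def algebra_simps)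
      finally show ?thesis by (simp only: of_nat_mult)
    qed
    \<comment> \<open>The additional edge contributes at most two vertices: itself and its merge
      with the top tree.\<close>
    have "card (rooted_subtrees ?root) \<le> card (top_dag_vertices T) + 2"
      unfolding rooted_top_tree_def top_dag_vertices_def
      by (simp add: card_insert_if finite_rooted_subtrees)
    moreover have "0 < card (top_dag_vertices T)"
      using rooted_subtrees_self[of "top_tree T"] finite_rooted_subtrees[of "top_tree T"]
      by (auto simp: top_dag_vertices_def card_gt_0_iff)
    \<comment> \<open>Here \<open>3 + 8 * (b + 2) = 8 * b + 19\<close>, which is at most
      \<open>27 * b\<close> as \<open>b\<close> is positive.\<close>
    moreover have "3 + 8 * a \<le> 27 * (b + e)" if "a \<le> b + 2" "0 < b" for a b e :: nat
      using that by simp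
    ultimately have "length D \<le> 27 * top_dag_size T"
      unfolding len top_dag_size_def by blast
    then have "real (length D) \<le> 27 * real (top_dag_size T)" by linarith
    also have "\<dots> \<le> c * real (top_dag_size T)"
      by (rule mult_right_mono) (simp_all add: c_def)
    finally have size: "real (length D) \<le> c * real (top_dag_size T)" .
    have le: "?h \<le> 2 * ?h" by simp
    show ?thesis
    proof (intro exI[of _ D] conjI allI impI)
      fix x assume x: "x < n"
      show "answers w D (query_programs Access) [x] (c * lg) [q_access T x]"
        by (rule answers_query[OF wp_Access[OF _ x le] time])
      show "answers w D (query_programs Depth) [x] (c * lg) [q_depth T x]"
        by (rule answers_query[OF wp_Depth[OF _ x le] time])
      show "answers w D (query_programs Height) [x] (c * lg) [q_height T x]"
        by (rule answers_query[OF wp_Height[OF _ x le] time])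
      show "answers w D (query_programs Size) [x] (c * lg) [q_size T x]"
        by (rule answers_query[OF wp_Size[OF _ x le] time])
      show "answers w D (query_programs Parent) [x] (c * lg) (node_words (q_parent T x))"
        by (rule answers_query[OF wp_Parent[OF _ x le] time])
      show "answers w D (query_programs Firstchild) [x] (c * lg) (node_words (q_first_child T x))"
        by (rule answers_query[OF wp_Firstchild[OF _ x le] time])
      show "answers w D (query_programs NextSibling) [x] (c * lg) (node_words (q_next_sibling T x))"
        by (rule answers_query[OF wp_NextSibling[OF _ x order.refl] time])
      show "answers w D (query_programs LevelAncestor) [x, i] (c * lg) (node_words (q_level_ancestor T x i))"
        if "i < 2 ^ w" for i
        by (rule answers_query[OF wp_LevelAncestor[OF _ x order.refl that] time])
      show "answers w D (query_programs NCA) [x, y] (c * lg) (node_words (q_nca T x y))" if "y < n" for y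
        by (rule answers_query[OF wp_NCA[OF _ x that le] time])
      show "answers w D (query_programs Decompress) [x]
          (c * (lg + real (num_nodes (q_decompress T x)))) (tree_words (q_decompress T x))"
        by (rule answers_query[OF wp_Decompress[OF _ x order.refl] time'])
    qed (use size D_words in auto)
  qed
  show ?thesis
    unfolding Let_def
    by (rule exI[of _ 10], rule allI, rule exI[of _ c], rule exI[of _ query_programs], intro allI impI,
      rule main[OF refl refl]) auto
qed

end
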